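(* Let $G$ be a cubic graph (multiple edges allowed, no loops). Suppose that $G$ has a vertex $v$ such that $G-v$ has a hamiltonian circuit. Then $G$ has a perfect matching cover of order $5$, i.e. there are five perfect matchings $M_1,\dots,M_5$ of $G$ (not necessarily distinct) such that every edge of $G$ lies in at least one of them.
   Context: A perfect matching of $G$ is the edge set of a spanning 1-regular subgraph. A perfect matching cover of $G$ is a collection of perfect matchings of $G$ such that each edge of $G$ is contained in at least one member; its order is the number of perfect matchings in it. $G-v$ is the subgraph induced by $V(G)\setminus\{v\}$; a hamiltonian circuit is a cycle through all vertices. *)

theory Defs
  imports Main "HOL-Library.Multiset"
begin

text \<open>Finite loopless multigraphs. Edges are elements of an abstract type, each with a set of two
  end vertices, so parallel edges are distinct edges with the same ends. The value of
  \<open>ends\<close> outside the edge set is irrelevant.\<close>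

record ('v, 'e) mgraph =
  verts :: "'v set"
  edges :: "'e set"
  ends :: "'e \<Rightarrow> 'v set"

definition multigraph :: "('v, 'e) mgraph \<Rightarrow> bool" where
  "multigraph G \<longleftrightarrow> finite (verts G) \<and> finite (edges G) \<and>
     (\<forall>e\<in>edges G. ends G e \<subseteq> verts G \<and> card (ends G e) = 2)"

text \<open>No edge is a loop, so every incident edge counts once.\<close>

definition degree :: "('v, 'e) mgraph \<Rightarrow> 'v \<Rightarrow> nat" where
  "degree G v = card {e \<in> edges G. v \<in> ends G e}"

definition regular :: "nat \<Rightarrow> ('v, 'e) mgraph \<Rightarrow> bool" where
  "regular k G \<longleftrightarrow> (\<forall>v\<in>verts G. degree G v = k)"

abbreviation cubic :: "('v, 'e) mgraph \<Rightarrow> bool" where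
  "cubic G \<equiv> regular 3 G"

definition subgraph :: "('v, 'e) mgraph \<Rightarrow> ('v, 'e) mgraph \<Rightarrow> bool" where
  "subgraph H G \<longleftrightarrow> multigraph H \<and> verts H \<subseteq> verts G \<and> edges H \<subseteq> edges G \<and>
     (\<forall>e\<in>edges H. ends H e = ends G e)"

definition spanning_subgraph :: "('v, 'e) mgraph \<Rightarrow> ('v, 'e) mgraph \<Rightarrow> bool" where
  "spanning_subgraph H G \<longleftrightarrow> subgraph H G \<and> verts H = verts G"

definition induced_subgraph :: "('v, 'e) mgraph \<Rightarrow> 'v set \<Rightarrow> ('v, 'e) mgraph" where
  "induced_subgraph G X =
     \<lparr>verts = X, edges = {e \<in> edges G. ends G e \<subseteq> X}, ends = ends G\<rparr>"

definition delete_vertex :: "('v, 'e) mgraph \<Rightarrow> 'v \<Rightarrow> ('v, 'e) mgraph" where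
  "delete_vertex G v = induced_subgraph G (verts G - {v})"

text \<open>A circuit is given by its vertices and edges in cyclic order: the \<open>i\<close>-th edge joins
  the \<open>i\<close>-th vertex to the next one. Two parallel edges form a circuit of length 2.\<close>

definition circuit :: "('v, 'e) mgraph \<Rightarrow> 'v list \<Rightarrow> 'e list \<Rightarrow> bool" where
  "circuit G vs es \<longleftrightarrow>
     length vs \<ge> 2 \<and> length es = length vs \<and> distinct vs \<and> distinct es \<and>
     set vs \<subseteq> verts G \<and> set es \<subseteq> edges G \<and>
     (\<forall>i<length vs. ends G (es ! i) = {vs ! i, vs ! (Suc i mod length vs)})"

definition hamiltonian_circuit :: "('v, 'e) mgraph \<Rightarrow> 'v list \<Rightarrow> 'e list \<Rightarrow> bool" where
  "hamiltonian_circuit G vs es \<longleftrightarrow> circuit G vs es \<and> set vs = verts G"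

definition perfect_matching :: "('v, 'e) mgraph \<Rightarrow> 'e set \<Rightarrow> bool" where
  "perfect_matching G M \<longleftrightarrow>
     (\<exists>H. spanning_subgraph H G \<and> regular 1 H \<and> M = edges H)"

text \<open>The members of a cover need not be distinct, so a cover is a multiset and its order is
  its size.\<close>

definition perfect_matching_cover :: "('v, 'e) mgraph \<Rightarrow> 'e set multiset \<Rightarrow> bool" where
  "perfect_matching_cover G \<M> \<longleftrightarrow>
     (\<forall>M. M \<in># \<M> \<longrightarrow> perfect_matching G M) \<and>
     (\<forall>e\<in>edges G. \<exists>M. M \<in># \<M> \<and> e \<in> M)"

end

theory Submission
  imports Defs
begin

text \<open>Let \<open>C\<close> be the circuit of \<open>G - v\<close>. Its length is odd and each of its vertices is on exactly one
  edge outside \<open>C\<close>: three vertices \<open>u, b, c\<close> are joined to \<open>v\<close>, and an involution \<open>T\<close> pairs the others.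
  Leaving out \<open>u\<close>, the edges of \<open>C\<close> split into a matching \<open>h\<close> of \<open>C - u\<close> and a matching \<open>g\<close>, which misses
  the two neighbours \<open>p1, p2\<close> of \<open>u\<close>, and the two edges at \<open>u\<close>.

  If the path of \<open>g \<union> T\<close> from \<open>b\<close> ends in \<open>p1\<close> or \<open>p2\<close>, three perfect matchings cover \<open>G\<close>. Otherwise it
  ends in \<open>c\<close> and forms an odd circuit with \<open>v\<close>, the path between \<open>p1\<close> and \<open>p2\<close> forms one with \<open>u\<close>, and
  the other components of \<open>g \<union> T\<close> are even circuits. Three odd-circuit matchings are then
  combined: for an odd circuit with chords and spokes, any two spokes belong to a triple of spokes
  such that three matchings, each using one of these spokes and some chords, cover the circuit.
  With \<open>h\<close> and the matching that takes \<open>g\<close> on the circuit through \<open>v\<close> and \<open>T\<close> elsewhere this gives five.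

  The statement on odd circuits is proved for exactly three spokes by induction, deleting matched
  pairs of consecutive vertices and contracting arcs that are left by a single chord; an alternating
  path from one of the two given spokes reduces the general case to this one.\<close>

text \<open>The odd circuit to be covered is the one through \<open>v\<close>. Its chords and spokes
  are in general not edges of the graph: an \<open>h\<close>-edge leaving it is continued through
  the even circuits, alternately by \<open>g\<close> and \<open>h\<close>, until it reaches one of
  the two odd circuits. If it comes back to the circuit through \<open>v\<close>, it acts as a
  chord; if it arrives at the circuit through \<open>u\<close>, it acts as a spoke. The vertex
  \<open>v\<close> is itself a spoke, by its edge to \<open>u\<close>.

  Two spokes have to be prescribed because of the circuit through \<open>u\<close>. The Hamiltonian
  circuit, followed from \<open>p1\<close> and from \<open>p2\<close> away from \<open>u\<close> up
  to the first vertex on the circuit through \<open>v\<close>, gives two disjoint paths, and the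
  vertices where they arrive are two spokes. A matching that takes \<open>h\<close> on one of these
  paths can take \<open>g\<close> on the rest of the circuit through \<open>u\<close>, together with
  the edge from \<open>u\<close> to the start of the other path. As the paths are disjoint, the two
  matchings cover every edge of \<open>g\<close> there and both circuit edges at \<open>u\<close>.
  The third spoke is not under control, so the third matching must be completed for an arbitrary
  one. This is always possible, since an odd circuit minus any vertex has a perfect
  matching.\<close>

section \<open>Matchings of a circuit as Boolean lists\<close>

text \<open>A set of edges of a circuit with vertex list \<open>xs\<close> is a list \<open>gs\<close> of Booleans, where \<open>gs ! i\<close> stands
  for the edge from \<open>xs ! i\<close> to its successor. In \<open>unc\<close> (the set of uncovered vertices) and \<open>sparse\<close>
  (no two consecutive edges), \<open>f\<close> is the edge that precedes the list.\<close>

fun unc :: "bool \<Rightarrow> 'a list \<Rightarrow> bool list \<Rightarrow> 'a set" where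
  "unc f (x # xs) (g # gs) = (if f \<or> g then unc g xs gs else insert x (unc g xs gs))"
| "unc f _ _ = {}"

fun sparse :: "bool \<Rightarrow> bool list \<Rightarrow> bool" where
  "sparse f (g # gs) \<longleftrightarrow> \<not> (f \<and> g) \<and> sparse g gs"
| "sparse f [] \<longleftrightarrow> True"

lemma unc_append:
  "length xs = length gs \<Longrightarrow> unc f (xs @ ys) (gs @ hs) = unc f xs gs \<union> unc (last (f # gs)) ys hs"
  by (induction f xs gs rule: unc.induct) auto

lemma sparse_append: "sparse f (gs @ hs) \<longleftrightarrow> sparse f gs \<and> sparse (last (f # gs)) hs"
  by (induction gs arbitrary: f) auto

lemma unc_subset: "unc f xs gs \<subseteq> set xs"
  by (induction f xs gs rule: unc.induct) auto

lemma unc_conv: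
  "length xs = length gs \<Longrightarrow>
   y \<in> unc f xs gs \<longleftrightarrow> (\<exists>i<length xs. y = xs ! i \<and> \<not> (f # gs) ! i \<and> \<not> gs ! i)"
proof (induction f xs gs rule: unc.induct)
  case (1 f x xs g gs)
  then show ?case by (auto simp del: Ex_less_Suc simp: Ex_less_Suc2)
qed auto

text \<open>\<open>last gs\<close> is the edge that enters the first vertex; feeding it to both
  recursions closes the list up to a circuit.\<close>

definition cyc :: "'a list \<Rightarrow> bool list \<Rightarrow> 'a set \<Rightarrow> bool" where
  "cyc xs gs W \<longleftrightarrow> length gs = length xs \<and> sparse (last gs) gs \<and> unc (last gs) xs gs = W"

lemma cyc_rotate:
  assumes "cyc (xs @ ys) (gs @ hs) W" "length gs = length xs" "length hs = length ys"
  shows "cyc (ys @ xs) (hs @ gs) W"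
  using assms
  by (cases "gs = []"; cases "hs = []")
     (auto simp: cyc_def unc_append sparse_append)

fun alt :: "bool \<Rightarrow> nat \<Rightarrow> bool list" where
  "alt f 0 = []"
| "alt f (Suc n) = f # alt (\<not> f) n"

lemma length_alt [simp]: "length (alt f n) = n"
  by (induction f n rule: alt.induct) auto

lemma unc_alt [simp]: "unc f xs (alt (\<not> f) (length xs)) = {}"
proof (induction xs arbitrary: f)
  case (Cons x xs)
  show ?case using Cons[of "\<not> f"] by simp
qed simp

lemma sparse_alt [simp]: "sparse f (alt (\<not> f) n)"
proof (induction n arbitrary: f)
  case (Suc n)
  show ?case using Suc[of "\<not> f"] by simp
qed simp

lemma last_alt: "last (f # alt (\<not> f) n) = (if even n then f else \<not> f)"
proof (induction n arbitrary: f)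
  case (Suc n)
  show ?case using Suc[of "\<not> f"] by simp
qed simp

lemma unc_replicate_False: "length xs = n \<Longrightarrow> unc f xs (replicate n False) = (if f then set (tl xs) else set xs)"
proof (induction xs arbitrary: n f)
  case (Cons x xs)
  then show ?case by (cases n) auto
qed auto

lemma sparse_replicate_False [simp]: "sparse f (replicate n False)"
  by (induction n arbitrary: f) auto

definition cover3 :: "bool list \<Rightarrow> bool list \<Rightarrow> bool list \<Rightarrow> bool" where
  "cover3 p q r \<longleftrightarrow> list_all (\<lambda>(x, y, z). x \<or> y \<or> z) (zip p (zip q r))"

lemma cover3_append:
  "length p = length q \<Longrightarrow> length q = length r \<Longrightarrow>
   cover3 (p @ p') (q @ q') (r @ r') \<longleftrightarrow> cover3 p q r \<and> cover3 p' q' r'"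
  by (simp add: cover3_def)

lemma cover3_Cons: "cover3 (x # p) (y # q) (z # r) \<longleftrightarrow> (x \<or> y \<or> z) \<and> cover3 p q r"
  by (simp add: cover3_def)

lemma cover3_last:
  "cover3 p q r \<Longrightarrow> length p = length q \<Longrightarrow> length q = length r \<Longrightarrow> p \<noteq> [] \<Longrightarrow>
   last p \<or> last q \<or> last r"
  by (cases p rule: rev_cases; cases q rule: rev_cases; cases r rule: rev_cases)
     (auto simp: cover3_append cover3_Cons)

lemma cover3_perm: "length p = length q \<Longrightarrow> length q = length r \<Longrightarrow> cover3 p q r \<Longrightarrow> cover3 q p r \<and> cover3 p r q"
proof (induction p q arbitrary: r rule: list_induct2)
  case (Cons x p y q)
  then show ?case by (cases r) (auto simp: cover3_Cons)
qed (auto simp: cover3_def)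

lemma cover3_alt: "cover3 (alt f n) (alt (\<not> f) n) r \<longleftrightarrow> True" if "length r = n"
  using that
proof (induction n arbitrary: f r)
  case (Suc n)
  then obtain x r' where "r = x # r'" by (cases r) auto
  with Suc show ?case using Suc.IH[of r' "\<not> f"] by (auto simp: cover3_Cons)
qed (auto simp: cover3_def)

section \<open>Circuit matchings with chords and one spoke\<close>

text \<open>A fixed-point-free involution on \<open>D\<close>, that is, a system of disjoint chords
  with \<open>D\<close> as the set of their ends.\<close>

definition tclosed :: "('a \<Rightarrow> 'a) \<Rightarrow> 'a set \<Rightarrow> bool" where
  "tclosed T D \<longleftrightarrow> (\<forall>x\<in>D. T x \<in> D \<and> T x \<noteq> x \<and> T (T x) = x)"

text \<open>The vertices missed along the circuit are left to the surrounding graph: one to a spoke,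
  the others in pairs to chords.\<close>

definition spoke_match :: "'a list \<Rightarrow> ('a \<Rightarrow> 'a) \<Rightarrow> 'a set \<Rightarrow> 'a \<Rightarrow> bool list \<Rightarrow> bool" where
  "spoke_match xs T D a p \<longleftrightarrow> (\<exists>U. U \<subseteq> D \<and> tclosed T U \<and> cyc xs p (insert a U))"

definition good :: "'a list \<Rightarrow> ('a \<Rightarrow> 'a) \<Rightarrow> 'a set \<Rightarrow> 'a \<Rightarrow> 'a \<Rightarrow> 'a \<Rightarrow> bool" where
  "good xs T D a b c \<longleftrightarrow> (\<exists>p q r. spoke_match xs T D a p \<and> spoke_match xs T D b q \<and>
      spoke_match xs T D c r \<and> cover3 p q r)"

lemma spoke_match_length: "spoke_match xs T D a p \<Longrightarrow> length p = length xs"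
  by (auto simp: spoke_match_def cyc_def)

lemma good_perm: "good xs T D a b c \<Longrightarrow> good xs T D b a c \<and> good xs T D a c b"
  unfolding good_def using cover3_perm spoke_match_length by metis

lemma good_mono: "good xs T D a b c \<Longrightarrow> D \<subseteq> D' \<Longrightarrow> good xs T D' a b c"
  unfolding good_def spoke_match_def by (meson subset_trans)

lemma spoke_match_rotate:
  assumes "spoke_match (xs @ ys) T D a p"
  shows "spoke_match (ys @ xs) T D a (drop (length xs) p @ take (length xs) p)"
proof -
  obtain U where U: "U \<subseteq> D" "tclosed T U" "cyc (xs @ ys) p (insert a U)"
    using assms by (auto simp: spoke_match_def)
  then have "length p = length xs + length ys" by (simp add: cyc_def)
  then have "cyc (ys @ xs) (drop (length xs) p @ take (length xs) p) (insert a U)"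
    using U(3) cyc_rotate[of xs ys "take (length xs) p" "drop (length xs) p"] by simp
  with U show ?thesis by (auto simp: spoke_match_def)
qed

lemma good_rotate:
  assumes "good (xs @ ys) T D a b c"
  shows "good (ys @ xs) T D a b c"
proof -
  obtain p q r where pqr: "spoke_match (xs @ ys) T D a p" "spoke_match (xs @ ys) T D b q"
      "spoke_match (xs @ ys) T D c r" "cover3 p q r"
    using assms by (auto simp: good_def)
  let ?n = "length xs"
  have l: "length p = ?n + length ys" "length q = ?n + length ys" "length r = ?n + length ys"
    using pqr(1-3) by (auto dest: spoke_match_length)
  have "cover3 (take ?n p @ drop ?n p) (take ?n q @ drop ?n q) (take ?n r @ drop ?n r)"
    using pqr(4) by simp
  then have "cover3 (drop ?n p @ take ?n p) (drop ?n q @ take ?n q) (drop ?n r @ take ?n r)"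
    using l by (subst (asm) cover3_append) (auto simp: cover3_append)
  then show ?thesis
    using pqr(1-3)[THEN spoke_match_rotate] unfolding good_def by blast
qed

text \<open>The closing edge is subdivided into a path of three edges. A matching that contained it
  takes the two outer edges, any other one takes the middle edge.\<close>

lemma cyc_insert_pair:
  assumes "cyc ys gs W" "gs \<noteq> []"
  shows "cyc (x # y # ys) ((\<not> last gs) # last gs # gs) W"
  using assms by (auto simp: cyc_def)

lemma good_insert_pair:
  assumes "good ys T D a b c" "ys \<noteq> []"
  shows "good (x # y # ys) T D a b c"
proof -
  obtain p q r where pqr: "spoke_match ys T D a p" "spoke_match ys T D b q"
      "spoke_match ys T D c r" "cover3 p q r"
    using assms by (auto simp: good_def)
  have l: "length p = length ys" "length q = length ys" "length r = length ys"
    using pqr(1-3) by (auto dest: spoke_match_length)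
  have ne: "p \<noteq> []" "q \<noteq> []" "r \<noteq> []" using l assms(2) by auto
  let ?f = "\<lambda>p. (\<not> last p) # last p # p"
  have sm: "spoke_match (x # y # ys) T D s (?f p')" if "spoke_match ys T D s p'" "p' \<noteq> []" for s p'
    using that cyc_insert_pair[OF _ that(2)] unfolding spoke_match_def by (meson cyc_insert_pair)
  have sp: "sparse (last p) p" "sparse (last q) q" "sparse (last r) r"
    using pqr(1-3) by (auto simp: spoke_match_def cyc_def)
  \<comment> \<open>This covers the middle one of the three new edges: the matching that contains
    the first edge of \<open>ys\<close> omits the closing edge next to it.\<close>
  have "\<not> last p \<or> \<not> last q \<or> \<not> last r"
  proof -
    obtain x p' y q' z r' where "p = x # p'" "q = y # q'" "r = z # r'"
      using ne by (meson neq_Nil_conv)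
    with sp pqr(4) show ?thesis by (auto simp: cover3_Cons simp del: last.simps)
  qed
  then have "cover3 (?f p) (?f q) (?f r)"
    using cover3_last[OF pqr(4)] pqr(4) l ne by (auto simp: cover3_Cons)
  then show ?thesis
    using sm pqr(1-3) ne unfolding good_def by blast
qed


section \<open>Alternating paths of two involutions\<close>

text \<open>The union of two involutions has maximum degree two, so the component of a fixed point
  is a path. The list follows it to its other end, which is again a fixed point.\<close>

lemma alternating_path:
  fixes \<alpha> \<beta> :: "'a \<Rightarrow> 'a"
  assumes fin: "finite V" and p: "p \<in> V" "\<beta> p = p"
    and \<alpha>: "\<And>x. x \<in> V \<Longrightarrow> \<alpha> x \<in> V \<and> \<alpha> (\<alpha> x) = x"
    and \<beta>: "\<And>x. x \<in> V \<Longrightarrow> \<beta> x \<in> V \<and> \<beta> (\<beta> x) = x"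
  obtains ws where "ws \<noteq> []" "ws ! 0 = p" "distinct ws" "set ws \<subseteq> V"
    "\<And>i. Suc i < length ws \<Longrightarrow> ws ! Suc i = (if even i then \<alpha> else \<beta>) (ws ! i)"
    "(if odd (length ws) then \<alpha> else \<beta>) (last ws) = last ws"
proof -
  define \<phi> where "\<phi> i = (if even i then \<alpha> else \<beta>)" for i :: nat
  define s where "s = rec_nat p (\<lambda>i x. \<phi> i x)"
  have s0: "s 0 = p" and sS: "s (Suc i) = \<phi> i (s i)" for i by (simp_all add: s_def)
  have \<phi>: "x \<in> V \<Longrightarrow> \<phi> i x \<in> V \<and> \<phi> i (\<phi> i x) = x" for x i using \<alpha> \<beta> by (simp add: \<phi>_def)
  have sV: "s i \<in> V" for i by (induction i) (auto simp: s0 sS p \<phi>)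
  have "\<not> inj s"
  proof
    assume "inj s"
    then have "infinite (range s)" using finite_imageD by blast
    moreover have "range s \<subseteq> V" using sV by auto
    ultimately show False using fin finite_subset by blast
  qed
  then obtain i j where "s i = s j" "i \<noteq> j" by (auto simp: inj_on_def)
  then have "\<exists>N. \<exists>j<N. s j = s N"
    by (cases "i < j") (metis, metis linorder_neqE_nat)
  then obtain N where N: "\<exists>j<N. s j = s N" "\<And>k. k < N \<Longrightarrow> \<not> (\<exists>j<k. s j = s k)"
    using that exists_least_iff[of "\<lambda>N. \<exists>j<N. s j = s N"] by auto
  have inj: "i < N \<Longrightarrow> j < N \<Longrightarrow> s i = s j \<Longrightarrow> i = j" for i j
    using N(2) by (metis linorder_neqE_nat)
  obtain j where j: "j < N" "s j = s N" using N(1) by blast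
  then obtain n where n: "N = Suc n" by (cases N) auto
  have e1: "\<phi> n (s n) = s j" using j n by (simp add: sS)
  then have e2: "s n = \<phi> n (s j)" using \<phi> sV by metis
  \<comment> \<open>If a vertex before the last one recurred, one of its two partners would be the
    last vertex and would already be on the path, against the minimality of \<open>N\<close>. At the
    start, \<open>\<beta> p = p\<close> leaves no second partner.\<close>
  have jn: "j = n"
  proof (rule ccontr)
    assume "j \<noteq> n"
    then have lt: "j < n" using j n by simp
    show False
    proof (cases "even j = even n")
      case True
      then have "s (Suc j) = s n" using e2 by (simp add: sS \<phi>_def)
      then have "Suc j = n" using inj lt n by simp
      then show False using True by auto
    next
      case False
      show False
      proof (cases j)
        case 0
        then have "s n = s 0" using e2 False p(2) by (simp add: \<phi>_def s0 split: if_splits)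
        then show False using inj[of n 0] lt n by simp
      next
        case (Suc i)
        have "\<phi> n = \<phi> i" using False Suc by (auto simp: \<phi>_def)
        then have "s n = s i" using e2 Suc \<phi> sV by (simp add: sS)
        then show False using inj[of n i] lt n Suc by simp
      qed
    qed
  qed
  let ?ws = "map s [0..<N]"
  have "inj_on s {0..<N}" using inj by (auto simp: inj_on_def)
  then have "distinct ?ws" by (simp add: distinct_map)
  moreover have "last ?ws = s n" using n by simp
  moreover have "?ws ! Suc i = (if even i then \<alpha> else \<beta>) (?ws ! i)" if "Suc i < length ?ws" for i
    using that by (simp add: sS \<phi>_def del: upt_Suc)
  moreover have "(if odd N then \<alpha> else \<beta>) (s n) = s n"
    using e1 jn n by (auto simp: \<phi>_def split: if_splits)
  moreover have "?ws ! 0 = p" using n by (simp add: s0 del: upt_Suc)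
  ultimately show ?thesis
    using that[of ?ws] sV n by (simp del: upt_Suc) (metis (no_types, lifting) image_subsetI)
qed

section \<open>Chord systems and sets matched along the circuit\<close>

lemma tclosed_Un: "tclosed T A \<Longrightarrow> tclosed T B \<Longrightarrow> tclosed T (A \<union> B)"
  by (auto simp: tclosed_def)

lemma tclosed_empty [simp]: "tclosed T {}"
  by (simp add: tclosed_def)

lemma tclosed_Diff: "tclosed T A \<Longrightarrow> tclosed T B \<Longrightarrow> tclosed T (A - B)"
  unfolding tclosed_def by (metis Diff_iff)

lemma tclosed_pair: "T x = y \<Longrightarrow> T y = x \<Longrightarrow> x \<noteq> y \<Longrightarrow> tclosed T {x, y}"
  by (auto simp: tclosed_def)

lemma tclosed_even_card:
  assumes "finite D" "tclosed T D"
  shows "even (card D)"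
  using assms
proof (induction D rule: finite_psubset_induct)
  case (psubset D)
  show ?case
  proof (cases "D = {}")
    case False
    then obtain x where x: "x \<in> D" by blast
    have t: "T x \<in> D" "T x \<noteq> x" "T (T x) = x" using psubset.prems x by (auto simp: tclosed_def)
    have c: "tclosed T (D - {x, T x})"
      using t psubset.prems by (intro tclosed_Diff tclosed_pair) auto
    have "even (card (D - {x, T x}))" by (rule psubset.IH) (use x c in auto)
    moreover have "card D = card (D - {x, T x}) + 2"
      using card_Diff_subset[of "{x, T x}" D] card_mono[of D "{x, T x}"] x t psubset.hyps by simp
    ultimately show ?thesis by simp
  qed simp
qed

text \<open>\<open>xs\<close> is read cyclically throughout.\<close>

definition adj :: "'a list \<Rightarrow> 'a \<Rightarrow> 'a \<Rightarrow> bool" where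
  "adj xs x y \<longleftrightarrow> (\<exists>i<length xs. {x, y} = {xs ! i, xs ! (Suc i mod length xs)})"

definition matched :: "'a list \<Rightarrow> 'a set \<Rightarrow> bool" where
  "matched xs X \<longleftrightarrow> (\<exists>\<rho>. tclosed \<rho> X \<and> (\<forall>x\<in>X. adj xs x (\<rho> x)))"

lemma adj_sym: "adj xs x y \<Longrightarrow> adj xs y x"
  unfolding adj_def by (simp add: insert_commute)

lemma matched_empty [simp]: "matched xs {}"
  by (auto simp: matched_def)

lemma matched_Un:
  assumes "matched xs X" "matched xs Y" "X \<inter> Y = {}"
  shows "matched xs (X \<union> Y)"
proof -
  obtain \<rho> \<sigma> where r: "tclosed \<rho> X" "\<forall>x\<in>X. adj xs x (\<rho> x)" and s: "tclosed \<sigma> Y" "\<forall>x\<in>Y. adj xs x (\<sigma> x)"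
    using assms by (auto simp: matched_def)
  have "tclosed (\<lambda>x. if x \<in> X then \<rho> x else \<sigma> x) (X \<union> Y)"
    unfolding tclosed_def
  proof
    fix x assume x: "x \<in> X \<union> Y"
    show "(if x \<in> X then \<rho> x else \<sigma> x) \<in> X \<union> Y \<and> (if x \<in> X then \<rho> x else \<sigma> x) \<noteq> x \<and>
      (if (if x \<in> X then \<rho> x else \<sigma> x) \<in> X then \<rho> (if x \<in> X then \<rho> x else \<sigma> x) else \<sigma> (if x \<in> X then \<rho> x else \<sigma> x)) = x"
    proof (cases "x \<in> X")
      case True
      then show ?thesis using r(1) by (simp add: tclosed_def)
    next
      case False
      then have "x \<in> Y" using x by simp
      then have y: "\<sigma> x \<in> Y" "\<sigma> x \<noteq> x" "\<sigma> (\<sigma> x) = x" using s(1) by (auto simp: tclosed_def)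
      then have "\<sigma> x \<notin> X" using assms(3) by blast
      then show ?thesis using False y by simp
    qed
  qed
  moreover have "\<forall>x\<in>X \<union> Y. adj xs x (if x \<in> X then \<rho> x else \<sigma> x)" using r s by auto
  ultimately show ?thesis unfolding matched_def by (intro exI) auto
qed

lemma matched_pair: "adj xs x y \<Longrightarrow> x \<noteq> y \<Longrightarrow> matched xs {x, y}"
  unfolding matched_def
  by (rule exI[of _ "\<lambda>z. if z = x then y else x"]) (auto simp: tclosed_def dest: adj_sym)

lemma matched_insert2:
  "matched xs X \<Longrightarrow> adj xs x y \<Longrightarrow> x \<noteq> y \<Longrightarrow> x \<notin> X \<Longrightarrow> y \<notin> X \<Longrightarrow> matched xs (insert x (insert y X))"
  using matched_Un[OF matched_pair, of xs x y X] by simp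

lemma adj_consecutive:
  assumes "xs = P @ x # y # S" shows "adj xs x y"
  unfolding adj_def
  by (rule exI[of _ "length P"]) (auto simp: assms nth_append)

lemma matched_segment:
  assumes "xs = P @ A @ S" "even (length A)" "distinct A"
  shows "matched xs (set A)"
  using assms
proof (induction A arbitrary: P rule: induct_list012)
  case (3 x y A)
  have "matched xs (set A)"
    using 3 by (intro "3.IH"(1)[of "P @ [x, y]"]) auto
  moreover have "adj xs x y" using 3(3) by (intro adj_consecutive[of _ P _ _ "A @ S"]) auto
  ultimately show ?case using 3 by (auto intro: matched_insert2)
qed auto

text \<open>The cyclic predecessor is written with \<open>i + n - 1\<close>, since subtraction of
  naturals is cut off at 0.\<close>

lemma pred_mod: "i < n \<Longrightarrow> (i + n - 1) mod n = (if i = 0 then n - 1 else i - 1)" for i n :: nat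
  by (cases i) auto

lemma Suc_mod: "i < n \<Longrightarrow> Suc i mod n = (if Suc i = n then 0 else Suc i)"
  by auto

lemma Suc_pred_mod: "i < n \<Longrightarrow> Suc ((i + n - 1) mod n) mod n = i"
  unfolding pred_mod by auto

lemma pred_Suc_mod: "i < n \<Longrightarrow> (Suc i mod n + n - 1) mod n = i"
  by (cases "Suc i = n") (auto simp: pred_mod Suc_mod)

lemma unc_cyc:
  assumes "length gs = length xs"
  shows "y \<in> unc (last gs) xs gs \<longleftrightarrow>
    (\<exists>i<length xs. y = xs ! i \<and> \<not> gs ! i \<and> \<not> gs ! ((i + length xs - 1) mod length xs))"
proof -
  have "(last gs # gs) ! i = gs ! ((i + length xs - 1) mod length xs)" if "i < length xs" for i
  proof (cases i)
    case 0
    then show ?thesis using that assms by (cases "gs = []") (auto simp: last_conv_nth)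
  next
    case (Suc j)
    then have "(i + length xs - 1) mod length xs = j" using that by simp
    then show ?thesis using Suc by simp
  qed
  then show ?thesis using unc_conv[of xs gs y "last gs"] assms by auto
qed

lemma sparse_conv: "sparse f gs \<longleftrightarrow> (\<forall>i<length gs. \<not> ((f # gs) ! i \<and> gs ! i))"
proof (induction f gs rule: sparse.induct)
  case (1 f g gs)
  have "(\<forall>i<length (g # gs). \<not> ((f # g # gs) ! i \<and> (g # gs) ! i)) \<longleftrightarrow>
     \<not> (f \<and> g) \<and> (\<forall>i<length gs. \<not> ((g # gs) ! i \<and> gs ! i))"
    by (simp add: All_less_Suc2)
  then show ?case using 1 by simp
qed auto

lemma sparse_cyc:
  "sparse (last gs) gs \<longleftrightarrow> (\<forall>i<length gs. \<not> (gs ! i \<and> gs ! (Suc i mod length gs)))"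
proof -
  have a: "(last gs # gs) ! i = gs ! ((i + length gs - 1) mod length gs)" if "i < length gs" for i
  proof (cases i)
    case 0
    then show ?thesis using that by (cases "gs = []") (auto simp: last_conv_nth)
  next
    case (Suc j)
    then have "(i + length gs - 1) mod length gs = j" using that by simp
    then show ?thesis using Suc by simp
  qed
  let ?n = "length gs"
  have "(\<forall>i<?n. \<not> (gs ! ((i + ?n - 1) mod ?n) \<and> gs ! i)) \<longleftrightarrow> (\<forall>i<?n. \<not> (gs ! i \<and> gs ! (Suc i mod ?n)))"
    (is "?L \<longleftrightarrow> ?R")
  proof
    assume ?L
    show ?R
    proof (intro allI impI)
      fix i assume i: "i < ?n"
      have "(Suc i mod ?n + ?n - 1) mod ?n = i" using pred_Suc_mod[OF i] .
      then show "\<not> (gs ! i \<and> gs ! (Suc i mod ?n))"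
        using \<open>?L\<close>[rule_format, of "Suc i mod ?n"] i by (cases "?n = 0") auto
    qed
  next
    assume ?R
    show ?L
    proof (intro allI impI)
      fix i assume i: "i < ?n"
      have "Suc ((i + ?n - 1) mod ?n) mod ?n = i" using Suc_pred_mod[OF i] .
      then show "\<not> (gs ! ((i + ?n - 1) mod ?n) \<and> gs ! i)"
        using \<open>?R\<close>[rule_format, of "(i + ?n - 1) mod ?n"] i by (cases "?n = 0") auto
    qed
  qed
  then show ?thesis using sparse_conv[of "last gs" gs] a by auto
qed

text \<open>An edge is selected when its ends are partners. In a circuit of length 2 both edges have
  the same ends and would both be selected, hence the bound 3.\<close>

lemma matched_imp_cyc:
  assumes d: "distinct xs" "3 \<le> length xs" and X: "X \<subseteq> set xs" and m: "matched xs X"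
  shows "\<exists>gs. cyc xs gs (set xs - X)"
proof -
  obtain \<rho> where r: "tclosed \<rho> X" "\<And>x. x \<in> X \<Longrightarrow> adj xs x (\<rho> x)"
    using m by (auto simp: matched_def)
  let ?n = "length xs"
  let ?s = "\<lambda>i. Suc i mod ?n"
  define G where "G i \<longleftrightarrow> xs ! i \<in> X \<and> \<rho> (xs ! i) = xs ! (?s i)" for i
  let ?gs = "map G [0..<?n]"
  have inj: "i < ?n \<Longrightarrow> j < ?n \<Longrightarrow> xs ! i = xs ! j \<longleftrightarrow> i = j" for i j
    using d(1) nth_eq_iff_index_eq by blast
  have n0: "0 < ?n" using d(2) by linarith
  then have sn: "?s i < ?n" for i by (rule mod_less_divisor)
  have ss: "?s (?s i) \<noteq> i" if "i < ?n" for i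
    using that d(2) by (cases "Suc i = ?n") (auto simp: Suc_mod)
  have sp: "\<not> (G i \<and> G (?s i))" if "i < ?n" for i
  proof
    assume g: "G i \<and> G (?s i)"
    then have "xs ! i = \<rho> (\<rho> (xs ! i))" using r(1) by (auto simp: G_def tclosed_def)
    also have "\<dots> = xs ! ?s (?s i)" using g by (auto simp: G_def)
    finally show False using inj[OF that sn[of "?s i"]] ss[OF that] by simp
  qed
  have pred: "?s ((i + ?n - 1) mod ?n) = i" if "i < ?n" for i
    using Suc_pred_mod[OF that] .
  have cov: "xs ! i \<in> X \<longleftrightarrow> G i \<or> G ((i + ?n - 1) mod ?n)" if i: "i < ?n" for i
  proof
    let ?p = "(i + ?n - 1) mod ?n"
    assume x: "xs ! i \<in> X"
    obtain k where k: "k < ?n" "{xs ! i, \<rho> (xs ! i)} = {xs ! k, xs ! ?s k}"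
      using r(2)[OF x] by (auto simp: adj_def)
    have rx: "\<rho> (xs ! i) \<in> X" "\<rho> (\<rho> (xs ! i)) = xs ! i" using r(1) x by (auto simp: tclosed_def)
    from k(2) consider "xs ! i = xs ! k" "\<rho> (xs ! i) = xs ! ?s k" | "xs ! i = xs ! ?s k" "\<rho> (xs ! i) = xs ! k"
      by (meson doubleton_eq_iff)
    then show "G i \<or> G ?p"
    proof cases
      case 1
      then have "i = k" using inj i k by blast
      then show ?thesis using 1 x by (simp add: G_def)
    next
      case 2
      then have ik: "i = ?s k" using inj i k sn by blast
      have "?p < ?n" using n0 by (rule mod_less_divisor)
      have "k = ?p" using ik pred_Suc_mod[OF k(1)] by simp
      then show ?thesis using 2 rx by (simp add: G_def)
    qed
  next
    let ?p = "(i + ?n - 1) mod ?n"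
    assume "G i \<or> G ?p"
    then show "xs ! i \<in> X"
    proof
      assume "G ?p"
      then have "\<rho> (xs ! ?p) \<in> X" "\<rho> (xs ! ?p) = xs ! i"
        using r(1) pred[OF i] by (auto simp: G_def tclosed_def)
      then show ?thesis by simp
    qed (simp add: G_def)
  qed
  have nth: "i < ?n \<Longrightarrow> ?gs ! i = G i" for i by simp
  have l: "length ?gs = ?n" by simp
  have "sparse (last ?gs) ?gs"
    unfolding sparse_cyc using sp sn nth l by auto
  moreover have "unc (last ?gs) xs ?gs = set xs - X"
  proof (rule set_eqI)
    fix y
    have pl: "(i + ?n - 1) mod ?n < ?n" for i using n0 by (rule mod_less_divisor)
    have "y \<in> unc (last ?gs) xs ?gs \<longleftrightarrow> (\<exists>i<?n. y = xs ! i \<and> xs ! i \<notin> X)"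
      unfolding unc_cyc[OF l] using cov nth pl by auto
    then show "y \<in> unc (last ?gs) xs ?gs \<longleftrightarrow> y \<in> set xs - X"
      by (auto simp: in_set_conv_nth)
  qed
  ultimately show ?thesis using l by (auto simp: cyc_def intro!: exI[of _ ?gs])
qed


section \<open>Three spokes: deletion and contraction\<close>

text \<open>By the last condition the vertices without chord or spoke can be paired along the
  circuit. Such vertices arise when chords are dropped, so the induction has to admit them.\<close>

definition circle :: "'a list \<Rightarrow> ('a \<Rightarrow> 'a) \<Rightarrow> 'a set \<Rightarrow> 'a \<Rightarrow> 'a \<Rightarrow> 'a \<Rightarrow> bool" where
  "circle xs T D a b c \<longleftrightarrow> distinct xs \<and> distinct [a, b, c] \<and> {a, b, c} \<subseteq> set xs \<and>
     D \<subseteq> set xs - {a, b, c} \<and> tclosed T D \<and> (\<exists>gs. cyc xs gs ({a, b, c} \<union> D))"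

definition all_good :: "'a list \<Rightarrow> bool" where
  "all_good xs \<longleftrightarrow> (\<forall>T D a b c. circle xs T D a b c \<longrightarrow> good xs T D a b c)"

lemma cyc_delete_pair:
  assumes "cyc (x # y # ys) gs W" "hd gs" "ys \<noteq> []"
  shows "\<exists>hs. cyc ys hs W"
proof -
  obtain g1 g2 hs where gs: "gs = g1 # g2 # hs" "length hs = length ys"
    using assms(1) by (auto simp: cyc_def length_Suc_conv)
  then have "hs \<noteq> []" "g1" using assms by auto
  then have "cyc ys hs W"
    using assms(1) gs by (cases hs) (auto simp: cyc_def split: if_splits)
  then show ?thesis by blast
qed

lemma last_replicate_False [simp]: "\<not> last (False # replicate n False)"
  by (induction n) auto

lemma cyc_replicate_False: "xs \<noteq> [] \<Longrightarrow> cyc xs (replicate (length xs) False) (set xs)"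
  by (auto simp: cyc_def unc_replicate_False last_replicate)

lemma cyc_has_True:
  assumes "cyc xs gs W" "True \<notin> set gs" shows "W = set xs"
proof -
  have "gs = replicate (length xs) False"
    using assms by (metis (full_types) cyc_def replicate_eqI)
  moreover have "\<not> last (replicate (length xs) False)" if "xs \<noteq> []"
    using that by (cases xs) (auto simp: last_replicate)
  ultimately show ?thesis using assms(1)
    by (cases "xs = []") (auto simp: cyc_def unc_replicate_False last_replicate)
qed

text \<open>An edge of the given matching joins two vertices without chord or spoke. Deleting both
  undoes a subdivision, and \<open>good_insert_pair\<close> restores it afterwards.\<close>

lemma good_by_deletion:
  fixes xs :: "'a list"
  assumes IH: "\<And>ys :: 'a list. length ys < length xs \<Longrightarrow> all_good ys"
    and c: "circle xs T D a b c" and gs: "cyc xs gs ({a, b, c} \<union> D)" "True \<in> set gs"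
  shows "good xs T D a b c"
proof -
  obtain hs hs' where s: "gs = hs @ True # hs'" using gs(2) by (meson split_list)
  define P S where "P = take (length hs) xs" and "S = drop (length hs) xs"
  have l: "length gs = length xs" using gs(1) by (simp add: cyc_def)
  have PS: "xs = P @ S" "length P = length hs" "length S = length (True # hs')"
    using l s by (auto simp: P_def S_def)
  have cy: "cyc (S @ P) (True # hs' @ hs) ({a, b, c} \<union> D)"
    using cyc_rotate[of P S hs "True # hs'"] gs(1) PS s by simp
  have c3: "card {a, b, c} = 3" using c by (auto simp: circle_def)
  have "card {a, b, c} \<le> card (set xs)" using c by (intro card_mono) (auto simp: circle_def)
  then have "3 \<le> length xs" using c3 card_length[of xs] by linarith
  then have "Suc (Suc (Suc 0)) \<le> length (S @ P)" using PS by simp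
  then obtain x y ys where ys: "S @ P = x # y # ys" "ys \<noteq> []"
    unfolding Suc_le_length_iff by auto
  obtain ks where ks: "cyc ys ks ({a, b, c} \<union> D)"
    using cyc_delete_pair[of x y ys "True # hs' @ hs"] cy ys by auto
  have sub: "{a, b, c} \<union> D \<subseteq> set ys" using ks unc_subset by (fastforce simp: cyc_def)
  have "distinct (S @ P)" using c PS(1) by (auto simp: circle_def)
  then have "circle ys T D a b c"
    using c ks sub ys(1) by (auto simp: circle_def)
  moreover have "length ys < length xs"
    using arg_cong[OF ys(1), of length] PS(1) by simp
  ultimately have "good ys T D a b c" using IH by (auto simp: all_good_def)
  then have "good (S @ P) T D a b c" using good_insert_pair ys by metis
  then show ?thesis using good_rotate PS(1) by metis
qed

text \<open>Chords whose ends can be matched along the circuit may be dropped: their ends turn into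
  vertices without chord, to which deletion applies.\<close>

lemma good_by_matching:
  fixes xs :: "'a list"
  assumes IH: "\<And>ys :: 'a list. length ys < length xs \<Longrightarrow> all_good ys"
    and c: "circle xs T D a b c" and X: "X \<subseteq> D" "X \<noteq> {}" "tclosed T X"
      "set xs = {a, b, c} \<union> D" "matched xs X"
  shows "good xs T D a b c"
proof -
  have c3: "card {a, b, c} = 3" using c by (auto simp: circle_def)
  have "card {a, b, c} \<le> card (set xs)" using c by (intro card_mono) (auto simp: circle_def)
  then have "3 \<le> length xs" using c3 card_length[of xs] by linarith
  then obtain gs where gs: "cyc xs gs (set xs - X)"
    using matched_imp_cyc[of xs X] c X by (auto simp: circle_def)
  have e: "set xs - X = {a, b, c} \<union> (D - X)" using X c by (auto simp: circle_def)
  have "circle xs T (D - X) a b c"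
    using c gs e X tclosed_Diff[of T D X] unfolding circle_def by auto
  moreover have "True \<in> set gs" using cyc_has_True[OF gs] X c by (auto simp: circle_def)
  ultimately have "good xs T (D - X) a b c"
    using good_by_deletion[OF IH] gs e by metis
  then show ?thesis by (rule good_mono) auto
qed

lemma unc_Cons_covered: "f \<or> g \<Longrightarrow> unc f (x # xs) (g # gs) = unc f (y # xs) (g # gs)"
  by auto

text \<open>An arc all of whose vertices but one are paired up within the arc is contracted to a single
  vertex, which becomes a spoke.\<close>

lemma good_contract_arc:
  fixes xs :: "'a list"
  assumes IH: "\<And>ys :: 'a list. length ys < length xs \<Longrightarrow> all_good ys"
    and c: "circle xs T D a b c" and xs: "xs = a # A @ b # R" "c \<in> set R" and D: "set xs = {a, b, c} \<union> D"
    and A: "odd (length A)" "x \<in> set A" "T x \<notin> set A" "tclosed T (set A - {x})"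
  shows "good xs T D a b c"
proof -
  define y where "y = T x"
  have dx: "distinct xs" and abc: "a \<noteq> b" "b \<noteq> c" "a \<noteq> c"
    and Deq: "D = set A \<union> (set R - {c})" and tD: "tclosed T D"
    using c D xs by (auto simp: circle_def)
  have xD: "x \<in> D" using A Deq by simp
  have ty: "T y = x" "y \<noteq> x" "y \<in> D" using tD xD by (auto simp: tclosed_def y_def)
  have yR: "y \<in> set R" "y \<noteq> c" using ty A Deq by (auto simp: y_def)
  let ?E = "set R - {y, c}"
  have "?E = D - ((set A - {x}) \<union> {x, y})" using Deq dx xs A yR by auto
  then have tE: "tclosed T ?E"
    using tclosed_Diff[OF tD tclosed_Un[OF A(4) tclosed_pair[of T x y]]] ty y_def by simp
  \<comment> \<open>The contracted vertex keeps the name \<open>x\<close>. It and the other end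
    \<open>y\<close> of the only chord leaving the arc replace the spokes \<open>a\<close> and
    \<open>b\<close>.\<close>
  have "cyc (x # R) (replicate (length (x # R)) False) (set (x # R))"
    by (rule cyc_replicate_False) simp
  moreover have "set (x # R) = {x, y, c} \<union> ?E" using yR xs by auto
  ultimately have "circle (x # R) T ?E x y c"
    using dx xs yR A tE ty abc unfolding circle_def by auto
  then have "good (x # R) T ?E x y c" using IH[of "x # R"] xs by (auto simp: all_good_def)
  then obtain p q r where p: "spoke_match (x # R) T ?E x p" and q: "spoke_match (x # R) T ?E y q"
    and r: "spoke_match (x # R) T ?E c r" and cov: "cover3 p q r"
    by (auto simp: good_def)
  have lens: "length p = length (x # R)" "length q = length (x # R)" "length r = length (x # R)"
    using p q r spoke_match_length by metis+
  have xE: "x \<notin> ?E" "x \<noteq> y" "x \<noteq> c" using dx xs A ty by auto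
  have ends: "\<not> (hd s \<and> last s)" "(hd s \<or> last s) \<longleftrightarrow> z \<noteq> x"
    if s: "spoke_match (x # R) T ?E z s" for z s
  proof -
    obtain U where U: "U \<subseteq> ?E" "cyc (x # R) s (insert z U)"
      using s by (auto simp: spoke_match_def)
    then obtain e es where es: "s = e # es" "length es = length R" by (auto simp: cyc_def length_Suc_conv)
    show "\<not> (hd s \<and> last s)" using U es by (auto simp: cyc_def)
    have "x \<in> unc (last s) (x # R) s \<longleftrightarrow> \<not> (hd s \<or> last s)"
      using es dx xs A unc_subset[of e R es] by (auto simp del: last.simps)
    moreover have "x \<in> insert z U \<longleftrightarrow> z = x" using U xE by auto
    ultimately show "(hd s \<or> last s) \<longleftrightarrow> z \<noteq> x" using U by (auto simp: cyc_def)
  qed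
  have last_pat: "last (f # alt (\<not> f) (Suc (length A))) = f" for f
    using A(1) last_alt[of f "Suc (length A)"] by simp
  \<comment> \<open>\<open>r\<close> reaches the arc at exactly one of its two ends. An even number
    of its vertices is left, and they are matched alternately.\<close>
  have lift_other: "spoke_match xs T D c (alt (\<not> last r) (Suc (length A)) @ r)"
  proof -
    obtain U where U: "U \<subseteq> ?E" "tclosed T U" "cyc (x # R) r (insert c U)"
      using r by (auto simp: spoke_match_def)
    have rne: "r \<noteq> []" using lens by auto
    obtain e es where es: "r = e # es" using rne by (cases r) auto
    have h: "last r \<or> e" using ends(2)[OF r] xE es by auto
    have "cyc xs (alt (\<not> last r) (Suc (length A)) @ r) (insert c U)"
      unfolding cyc_def
    proof (intro conjI)
      show "length (alt (\<not> last r) (Suc (length A)) @ r) = length xs" using lens xs by simp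
      have la: "last (alt (\<not> last r) (Suc (length A)) @ r) = last r" using rne by simp
      show "sparse (last (alt (\<not> last r) (Suc (length A)) @ r)) (alt (\<not> last r) (Suc (length A)) @ r)"
        unfolding la sparse_append last_pat using U(3) sparse_alt by (auto simp: cyc_def simp del: alt.simps)
      have "xs = (a # A) @ b # R" using xs by simp
      moreover have "unc (last r) (b # R) r = insert c U"
        using U(3) unc_Cons_covered[of "last r" e b R es x] h es by (simp add: cyc_def del: last.simps unc.simps)
      ultimately show "unc (last (alt (\<not> last r) (Suc (length A)) @ r)) xs (alt (\<not> last r) (Suc (length A)) @ r) = insert c U"
        unfolding la by (simp only:) (subst unc_append; use unc_alt[of "last r" "a # A"] last_pat in \<open>simp del: alt.simps unc.simps last.simps\<close>)
    qed
    then show ?thesis using U Deq unfolding spoke_match_def by (intro exI[of _ U]) auto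
  qed
  \<comment> \<open>\<open>y\<close> is now covered by the chord to \<open>x\<close> and all of
    \<open>A\<close> by chords; the end of the arc that \<open>q\<close> does not reach becomes the
    spoke.\<close>
  have lift_y: "spoke_match xs T D (if last q then b else a) (replicate (Suc (length A)) False @ q)"
  proof -
    obtain U where U: "U \<subseteq> ?E" "tclosed T U" "cyc (x # R) q (insert y U)"
      using q by (auto simp: spoke_match_def)
    obtain e es where es: "q = e # es" using lens by (cases q) auto
    have h: "last q \<or> e" "\<not> (last q \<and> e)" using ends[OF q] xE es by auto
    let ?q = "replicate (Suc (length A)) False @ q"
    let ?V = "U \<union> (set A - {x}) \<union> {x, y}"
    have la: "last ?q = last q" using es by simp
    have sq: "sparse (last q) q" "unc (last q) (x # R) q = insert y U" using U(3) by (auto simp: cyc_def)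
    have tail: "unc False (b # R) q = (if last q then {b} else {}) \<union> insert y U"
    proof -
      have "(last q \<or> e) = True" using h by simp
      then have "unc e R es = insert y U" using sq(2) unfolding es by simp
      then show ?thesis using h unfolding es by (cases e) (auto simp del: last.simps)
    qed
    have "unc (last q) xs ?q = unc (last q) (a # A) (replicate (Suc (length A)) False) \<union> unc False (b # R) q"
      unfolding xs using unc_append[of "a # A" "replicate (Suc (length A)) False" "last q" "b # R" q]
      by (simp del: unc.simps)
    also have "\<dots> = insert (if last q then b else a) ?V"
      using A(2) unc_replicate_False[of "a # A" "Suc (length A)" "last q"]
      by (cases "last q") (auto simp: tail simp del: last.simps unc.simps replicate.simps)
    finally have "cyc xs ?q (insert (if last q then b else a) ?V)"
      using sq(1) es lens xs la by (auto simp: cyc_def sparse_append simp del: last.simps replicate.simps)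
    moreover have "tclosed T ?V" 
      using tclosed_Un[OF tclosed_Un[OF U(2) A(4)] tclosed_pair[of T x y]] ty by (simp add: y_def)
    moreover have "?V \<subseteq> D" using U Deq A yR by auto
    ultimately show ?thesis unfolding spoke_match_def by blast
  qed
  \<comment> \<open>\<open>p\<close> reaches neither end of the arc, so either end may be the spoke
    while the rest is matched alternately; \<open>f\<close> makes the choice.\<close>
  have lift_x: "spoke_match xs T D (if f then b else a) (alt f (Suc (length A)) @ p)" for f
  proof -
    obtain U where U: "U \<subseteq> ?E" "tclosed T U" "cyc (x # R) p (insert x U)"
      using p by (auto simp: spoke_match_def)
    obtain e es where es: "p = e # es" using lens by (cases p) auto
    have h: "\<not> last p" "\<not> e" using ends(2)[OF p] es by auto
    let ?q = "alt f (Suc (length A)) @ p"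
    have sq: "sparse (last p) p" "unc (last p) (x # R) p = insert x U" using U(3) by (auto simp: cyc_def)
    have xn: "x \<notin> unc False R es" using unc_subset[of False R es] dx xs A by auto
    have tail: "unc False R es = U" using sq(2) es h xn xE U(1) by (auto simp del: last.simps)
    have la: "last ?q = False" using es h by simp
    have lal: "last (False # alt f (Suc (length A))) = (\<not> f)"
      using A(1) last_alt[of True "Suc (length A)"] last_alt[of False "Suc (length A)"] by (cases f) simp_all
    have unc1: "unc False (a # A) (alt f (Suc (length A))) = (if f then {} else {a})"
      using unc_alt[of True A] unc_alt[of False A] by (cases f) auto
    have "unc False xs ?q = (if f then {} else {a}) \<union> unc (\<not> f) (b # R) p"
      unfolding xs using unc_append[of "a # A" "alt f (Suc (length A))" False "b # R" p] unc1 lal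
      by (simp del: unc.simps alt.simps)
    also have "\<dots> = insert (if f then b else a) U" using es h tail by auto
    finally have "unc False xs ?q = insert (if f then b else a) U" .
    moreover have "sparse False ?q"
      unfolding sparse_append lal using sq(1) es h sparse_alt[of False "Suc (length A)"] sparse_alt[of True "length A"] sparse_alt[of False "length A"]
      by (cases f) (auto simp del: last.simps)
    ultimately have "cyc xs ?q (insert (if f then b else a) U)"
      using es lens xs la by (auto simp: cyc_def simp del: alt.simps)
    moreover have "U \<subseteq> D" using U Deq by auto
    ultimately show ?thesis using U unfolding spoke_match_def by blast
  qed
  \<comment> \<open>\<open>p\<close> avoids both edges at the contracted vertex and
    \<open>q\<close>, \<open>r\<close> take one each, so these differ. The choice of
    \<open>f\<close> that avoids the spoke of \<open>q\<close> is then complementary to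
    \<open>r\<close> on the arc.\<close>
  have opp: "last r \<longleftrightarrow> \<not> last q"
  proof -
    obtain e1 p' where e1: "p = e1 # p'" using lens by (cases p) auto
    obtain e2 q' where e2: "q = e2 # q'" using lens by (cases q) auto
    obtain e3 r' where e3: "r = e3 # r'" using lens by (cases r) auto
    note e = e1 e2 e3
    have l: "length p = length q" "length q = length r" "p \<noteq> []" using lens by auto
    show ?thesis
      using ends[OF p] ends[OF q] ends[OF r] xE cover3_last[OF cov l] cov e
      by (auto simp: cover3_Cons simp del: last.simps)
  qed
  let ?n = "Suc (length A)"
  have l: "length p = length q" "length q = length r" using lens by auto
  show ?thesis
  proof (cases "last q")
    case True
    have "cover3 (alt False ?n @ p) (replicate ?n False @ q) (alt True ?n @ r)"
      using cover3_perm[OF _ _ cover3_alt[of "replicate ?n False" ?n False, THEN iffD2]] cov l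
      by (subst cover3_append) (auto simp del: alt.simps replicate.simps)
    moreover have "spoke_match xs T D a (alt False ?n @ p)" using lift_x[of False] by simp
    ultimately show ?thesis
      using lift_y lift_other opp True unfolding good_def by (metis (full_types))
  next
    case False
    have "cover3 (replicate ?n False @ q) (alt True ?n @ p) (alt False ?n @ r)"
      using cover3_perm[of "alt True ?n" "alt False ?n" "replicate ?n False"] cover3_perm[of p q r] cov l
        cover3_perm[of "alt True ?n" "replicate ?n False" "alt False ?n"]
        cover3_alt[of "replicate ?n False" ?n True]
      by (subst cover3_append) (auto simp del: alt.simps replicate.simps)
    moreover have "spoke_match xs T D b (alt True ?n @ p)" using lift_x[of True] by simp
    ultimately show ?thesis
      using lift_y lift_other opp False unfolding good_def by (metis (full_types))
  qed
qed


section \<open>Two odd arcs: growing a blossom\<close>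

lemma circle_perm: "circle xs T D a b c \<Longrightarrow> circle xs T D b a c \<and> circle xs T D a c b"
  by (simp add: circle_def insert_commute) (metis insert_commute)

lemma circle_rotate:
  assumes "circle (xs @ ys) T D a b c" shows "circle (ys @ xs) T D a b c"
proof -
  obtain gs where gs: "cyc (xs @ ys) gs ({a, b, c} \<union> D)" using assms by (auto simp: circle_def)
  then have l: "length gs = length xs + length ys" by (simp add: cyc_def)
  have "cyc (ys @ xs) (drop (length xs) gs @ take (length xs) gs) ({a, b, c} \<union> D)"
    using gs l cyc_rotate[of xs ys "take (length xs) gs" "drop (length xs) gs"] by simp
  then show ?thesis using assms by (auto simp: circle_def)
qed

lemma segment_within:
  assumes "xs = P @ A @ S"
    and "\<And>x y. x \<in> set A \<Longrightarrow> y \<in> set A \<Longrightarrow> adj xs x y \<Longrightarrow> x \<in> Q \<Longrightarrow> y \<in> Q"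
  shows "set A \<subseteq> Q \<or> set A \<inter> Q = {}"
  using assms
proof (induction A arbitrary: P)
  case (Cons x A)
  show ?case
  proof (cases A)
    case (Cons y A')
    have "set A \<subseteq> Q \<or> set A \<inter> Q = {}"
      by (rule Cons.IH[of "P @ [x]"]) (use Cons.prems in auto)
    moreover have "adj xs x y" using Cons.prems(1) Cons by (intro adj_consecutive[of _ P _ _ "A' @ S"]) auto
    then have "x \<in> Q \<longleftrightarrow> y \<in> Q" using Cons.prems(2)[of x y] Cons.prems(2)[of y x] Cons adj_sym[of xs x y] by auto
    ultimately show ?thesis using Cons by auto
  qed auto
qed auto

text \<open>Two arcs are odd. Match them up except for one vertex each and join these two vertices by a path
  alternating with \<open>T\<close>. Growing an alternating path from one end as in the blossom algorithm, either an
  alternating circuit appears, which can be matched, or the grown set is a union of arcs left by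
  a single edge of \<open>T\<close>, so that one arc can be contracted.\<close>

lemma good_two_odd_arcs:
  fixes xs :: "'a list"
  assumes IH: "\<And>ys :: 'a list. length ys < length xs \<Longrightarrow> all_good ys"
    and c: "circle xs T D a b c" and D: "set xs = {a, b, c} \<union> D"
    and xs: "xs = a # A1 @ b # A2 @ c # A3" and par: "odd (length A1)" "odd (length A2)" "even (length A3)"
  shows "good xs T D a b c"
proof (rule ccontr)
  assume ng: "\<not> good xs T D a b c"
  have noX: "X = {}" if "X \<subseteq> D" "tclosed T X" "matched xs X" for X
    using good_by_matching[OF IH c that(1) _ that(2) D that(3)] ng by blast
  have dx: "distinct xs" and tD: "tclosed T D" and Deq: "D = set A1 \<union> set A2 \<union> set A3"
    using c D xs by (auto simp: circle_def)
  obtain x1 B1 where A1: "A1 = x1 # B1" using par by (cases A1) auto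
  obtain x2 B2 where A2: "A2 = x2 # B2" using par by (cases A2) auto
  have x12: "x1 \<noteq> x2" "x1 \<in> D" "x2 \<in> D" using dx xs A1 A2 Deq by auto
  have m1: "matched xs (set B1)"
    using dx xs A1 par by (intro matched_segment[of _ "[a, x1]" _ "b # A2 @ c # A3"]) auto
  have m2: "matched xs (set B2)"
    using dx xs A2 par by (intro matched_segment[of _ "a # A1 @ [b, x2]" _ "c # A3"]) auto
  have m3: "matched xs (set A3)"
    using dx xs par by (intro matched_segment[of _ "a # A1 @ b # A2 @ [c]" _ "[]"]) auto
  have "matched xs (set B1 \<union> set B2 \<union> set A3)"
    using dx xs A1 A2 by (intro matched_Un m1 m2 m3) auto
  moreover have "set B1 \<union> set B2 \<union> set A3 = D - {x1, x2}" using dx xs A1 A2 Deq by auto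
  ultimately obtain \<rho> where r: "tclosed \<rho> (D - {x1, x2})" "\<And>x. x \<in> D - {x1, x2} \<Longrightarrow> adj xs x (\<rho> x)"
    by (auto simp: matched_def)
  define \<sigma> where "\<sigma> z = (if z = x1 \<or> z = x2 then z else \<rho> z)" for z
  have finD: "finite D" using Deq by simp
  have T: "x \<in> D \<Longrightarrow> T x \<in> D \<and> T (T x) = x" "x \<in> D \<Longrightarrow> T x \<noteq> x" for x
    using tD by (auto simp: tclosed_def)
  have S: "x \<in> D \<Longrightarrow> \<sigma> x \<in> D \<and> \<sigma> (\<sigma> x) = x" for x
    using r(1) x12 by (auto simp: tclosed_def \<sigma>_def)
  have sfix: "x \<in> D \<Longrightarrow> \<sigma> x = x \<Longrightarrow> x \<in> {x1, x2}" for x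
    using r(1) by (auto simp: tclosed_def \<sigma>_def split: if_splits)
  have sx1: "\<sigma> x1 = x1" by (simp add: \<sigma>_def)
  obtain ws where ws: "ws \<noteq> []" "ws ! 0 = x1" "distinct ws" "set ws \<subseteq> D"
    and step: "\<And>i. Suc i < length ws \<Longrightarrow> ws ! Suc i = (if even i then T else \<sigma>) (ws ! i)"
    and last: "(if odd (length ws) then T else \<sigma>) (last ws) = last ws"
    by (rule alternating_path[of D x1 \<sigma> T, OF finD x12(2) sx1], (use T(1) in blast)?, (use S in blast)?, rule that, assumption+)
  let ?n = "length ws"
  have inD: "i < ?n \<Longrightarrow> ws ! i \<in> D" for i using ws(4) by auto
  have lastD: "last ws \<in> D" using ws by auto
  \<comment> \<open>\<open>T\<close> moves every vertex of \<open>D\<close>, so the path can only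
    stop at a fixed point of \<open>\<sigma>\<close>, and \<open>x2\<close> is the only one besides
    the start.\<close>
  have ev: "even ?n" using last lastD T(2) by (metis (full_types))
  then have n2: "2 \<le> ?n" using ws(1) by (cases ws; cases "tl ws") auto
  have inj: "i < ?n \<Longrightarrow> j < ?n \<Longrightarrow> ws ! i = ws ! j \<longleftrightarrow> i = j" for i j
    using ws(3) nth_eq_iff_index_eq by blast
  have last': "last ws = ws ! (?n - 1)" using ws(1) by (rule last_conv_nth)
  have wlast: "ws ! (?n - 1) = x2"
  proof -
    have "\<sigma> (last ws) = last ws" using last ev by simp
    then have "last ws \<in> {x1, x2}" using sfix lastD by blast
    moreover have "last ws \<noteq> x1" using inj[of "?n - 1" 0] n2 ws(1,2) last' by auto
    ultimately show ?thesis using last' by auto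
  qed
  define seg where "seg i j = (\<lambda>k. ws ! k) ` {i..<j}" for i j
  have seg_all: "seg 0 ?n = set ws" by (auto simp: seg_def set_conv_nth)
  have segD: "j \<le> ?n \<Longrightarrow> seg i j \<subseteq> D" for i j using inD by (auto simp: seg_def)
  have in_seg: "j \<le> ?n \<Longrightarrow> k < ?n \<Longrightarrow> ws ! k \<in> seg i j \<longleftrightarrow> i \<le> k \<and> k < j" for i j k
    by (auto simp: seg_def inj)
  have Tup: "T (ws ! i) = ws ! Suc i" if "even i" "Suc i < ?n" for i using step that by simp
  have Tdn: "T (ws ! Suc i) = ws ! i" if "even i" "Suc i < ?n" for i
    using Tup[OF that] T(1)[OF inD[of i]] that by auto
  have Sup: "\<sigma> (ws ! i) = ws ! Suc i" if "odd i" "Suc i < ?n" for i using step that by simp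
  have Sdn: "\<sigma> (ws ! Suc i) = ws ! i" if "odd i" "Suc i < ?n" for i
    using Sup[OF that] S[OF inD[of i]] that by auto
  have tseg: "tclosed T (seg i j)" if ij: "even i" "even j" "j \<le> ?n" for i j
    unfolding tclosed_def
  proof
    fix x assume "x \<in> seg i j"
    then obtain k where k: "x = ws ! k" "i \<le> k" "k < j" by (auto simp: seg_def)
    have "T x \<in> seg i j"
    proof (cases "even k")
      case True
      then have "Suc k < j" using k ij by (metis Suc_lessI even_Suc)
      then show ?thesis using Tup[OF True] k ij in_seg[of j "Suc k" i] by auto
    next
      case False
      then obtain l where l: "k = Suc l" "even l" by (cases k) auto
      then have "i \<le> l" using k ij False by (metis le_SucE)
      then show ?thesis using Tdn[of l] l k ij in_seg[of j l i] by auto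
    qed
    moreover have "x \<in> D" using k ij inD by auto
    ultimately show "T x \<in> seg i j \<and> T x \<noteq> x \<and> T (T x) = x" using T by auto
  qed
  have rseg: "tclosed \<rho> (seg i j)" "seg i j \<subseteq> D - {x1, x2}" if ij: "odd i" "odd j" "j \<le> ?n" for i j
  proof -
    have jn: "j < ?n" using ij ev by (metis le_neq_implies_less)
    have i0: "0 < i" using ij(1) by (cases i) auto
    show sub: "seg i j \<subseteq> D - {x1, x2}"
    proof
      fix x assume "x \<in> seg i j"
      then obtain k where k: "x = ws ! k" "i \<le> k" "k < j" by (auto simp: seg_def)
      then show "x \<in> D - {x1, x2}"
        using inj[of k 0] inj[of k "?n - 1"] i0 jn inD[of k] ws(1,2) wlast by auto
    qed
    show "tclosed \<rho> (seg i j)"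
      unfolding tclosed_def
    proof
      fix x assume x: "x \<in> seg i j"
      then obtain k where k: "x = ws ! k" "i \<le> k" "k < j" by (auto simp: seg_def)
      have "\<sigma> x \<in> seg i j"
      proof (cases "odd k")
        case True
        then have "Suc k < j" using k ij by (metis Suc_lessI even_Suc)
        then show ?thesis using Sup[OF True] k ij in_seg[of j "Suc k" i] by auto
      next
        case False
        then obtain l where l: "k = Suc l" "odd l" using k i0 by (cases k) auto
        then have "i \<le> l" using k ij False by (metis le_SucE)
        then show ?thesis using Sdn[of l] l k ij in_seg[of j l i] by auto
      qed
      moreover have "x \<in> D - {x1, x2}" using x sub by blast
      ultimately show "\<rho> x \<in> seg i j \<and> \<rho> x \<noteq> x \<and> \<rho> (\<rho> x) = x"
        using r(1) by (auto simp: \<sigma>_def tclosed_def)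
    qed
  qed
  have mseg: "matched xs (seg i j)" if "odd i" "odd j" "j \<le> ?n" for i j
    using rseg[OF that] r(2) unfolding matched_def by blast
  \<comment> \<open>Off the path both \<open>T\<close> and \<open>\<rho>\<close> pair the vertices
    up, so the chords there could be dropped.\<close>
  have "D = set ws"
  proof (rule ccontr)
    assume ne: "D \<noteq> set ws"
    let ?X = "D - set ws"
    have "set ws = insert x1 (insert x2 (seg 1 (?n - 1)))"
    proof -
      have "{0..<?n} = insert 0 (insert (?n - 1) {1..<?n - 1})" using n2 by auto
      then show ?thesis using seg_all ws(2) wlast unfolding seg_def by auto
    qed
    then have "?X = (D - {x1, x2}) - seg 1 (?n - 1)" by auto
    moreover have "tclosed \<rho> (seg 1 (?n - 1))" using rseg(1)[of 1 "?n - 1"] ev n2 ws(1) by simp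
    ultimately have "tclosed \<rho> ?X" using tclosed_Diff[OF r(1)] by simp
    moreover have "\<forall>x\<in>?X. adj xs x (\<rho> x)"
    proof
      fix x assume "x \<in> ?X"
      moreover have "x1 \<in> set ws" "x2 \<in> set ws" using ws n2 wlast nth_mem[of 0 ws] nth_mem[of "?n - 1" ws] by auto
      ultimately show "adj xs x (\<rho> x)" using r(2) by blast
    qed
    ultimately have "matched xs ?X" by (auto simp: matched_def)
    moreover have "tclosed T ?X" using tclosed_Diff[OF tD] tseg[of 0 ?n] ev seg_all by simp
    ultimately have "?X = {}" by (intro noX) auto
    then show False using ne ws(4) by blast
  qed
  note Dws = this
  \<comment> \<open>The first \<open>k + 1\<close> vertices form a blossom with tip
    \<open>ws ! k\<close>. \<open>S\<close> consists of an alternating path from \<open>z\<close> to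
    the tip, with a chord at \<open>z\<close> and a circle edge at the tip, and possibly of
    alternating circuits.\<close>
  define Q where "Q k \<longleftrightarrow> (\<forall>z\<in>seg 0 (Suc k). \<exists>S\<subseteq>seg 0 (Suc k). z \<in> S \<and> ws ! k \<in> S \<and>
      tclosed T (S - {ws ! k}) \<and> matched xs (S - {z}))" for k
  have Q0: "Q 0"
    unfolding Q_def
  proof
    fix z assume "z \<in> seg 0 (Suc 0)"
    then show "\<exists>S\<subseteq>seg 0 (Suc 0). z \<in> S \<and> ws ! 0 \<in> S \<and> tclosed T (S - {ws ! 0}) \<and> matched xs (S - {z})"
      by (intro exI[of _ "{z}"]) (auto simp: seg_def)
  qed
  have grow: "even k' \<and> Q k'" if k: "even k" "Q k" "a' \<le> k" "k < k'" "k' < ?n" "adj xs (ws ! a') (ws ! k')" for k a' k'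
  proof -
    let ?z = "ws ! a'"
    have za: "?z \<in> seg 0 (Suc k)" using k in_seg by simp
    then obtain S where Ss: "S \<subseteq> seg 0 (Suc k)" "?z \<in> S" "ws ! k \<in> S" "tclosed T (S - {ws ! k})" "matched xs (S - {?z})"
      using k(2) unfolding Q_def by blast
    have low: "x \<in> seg 0 (Suc k) \<Longrightarrow> j \<le> ?n \<Longrightarrow> x \<notin> seg (Suc k) j" for x j
      using k by (auto simp: seg_def inj)
    have zk: "?z \<noteq> ws ! k'" using k inj by auto
    have ext: "tclosed T (S' - {ws ! k} \<union> seg k j)"
      if "tclosed T (S' - {ws ! k})" "even j" "j \<le> ?n" for S' j
      using that tseg[of k j] k(1) by (intro tclosed_Un) auto
    have segk: "seg k j = insert (ws ! k) (seg (Suc k) j)" if "k < j" for j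
    proof -
      have "{k..<j} = insert k {Suc k..<j}" using that by auto
      then show ?thesis by (simp add: seg_def)
    qed
    \<comment> \<open>For odd \<open>k'\<close>, the path from \<open>ws ! a'\<close> to the tip,
      the part of \<open>ws\<close> from there to \<open>ws ! k'\<close> and the new edge close up
      to an alternating circuit.\<close>
    have evk: "even k'"
    proof (rule ccontr)
      assume odd: "odd k'"
      let ?V = "S \<union> seg (Suc k) (Suc k')"
      have "?V = S - {ws ! k} \<union> seg k (Suc k')" using segk[of "Suc k'"] Ss(3) k by auto
      then have "tclosed T ?V" using ext[OF Ss(4), of "Suc k'"] odd k by simp
      moreover have "matched xs ?V"
      proof -
        have "?V = (S - {?z}) \<union> seg (Suc k) k' \<union> {?z, ws ! k'}"
          using Ss(2) k by (auto simp: seg_def less_Suc_eq)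
        moreover have "matched xs (seg (Suc k) k')" using mseg[of "Suc k" k'] k odd by simp
        moreover have "matched xs {?z, ws ! k'}" using matched_pair[OF k(6) zk] .
        moreover have "(S - {?z}) \<inter> seg (Suc k) k' = {}" using Ss(1) low[of _ k'] k by auto
        moreover have "(S - {?z} \<union> seg (Suc k) k') \<inter> {?z, ws ! k'} = {}"
          using Ss(1) low[OF za, of k'] low[of "ws ! k'" "Suc k'"] in_seg[of "Suc k'" k' "Suc k"] in_seg[of k' k' "Suc k"] k by auto
        ultimately show ?thesis using Ss(5) matched_Un by metis
      qed
      moreover have "?V \<subseteq> D" using Ss(1) segD[of "Suc k" 0] segD[of "Suc k'" "Suc k"] k by auto
      ultimately have "?V = {}" by (intro noX)
      then show False using Ss(2) by auto
    qed
    moreover have "Q k'"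
      unfolding Q_def
    proof
      fix z assume "z \<in> seg 0 (Suc k')"
      then obtain j where j: "z = ws ! j" "j \<le> k'" by (auto simp: seg_def)
      let ?G = "\<lambda>S. S \<subseteq> seg 0 (Suc k') \<and> z \<in> S \<and> ws ! k' \<in> S \<and> tclosed T (S - {ws ! k'}) \<and> matched xs (S - {z})"
      have sub: "seg 0 (Suc k) \<subseteq> seg 0 (Suc k')" using k by (auto simp: seg_def)
      consider "j \<le> k" | "k < j" "even j" | "k < j" "odd j" by linarith
      then have "\<exists>S. ?G S"
      proof cases
        case 1
        then have zs: "z \<in> seg 0 (Suc k)" using j k in_seg by simp
        then obtain S where Ss: "S \<subseteq> seg 0 (Suc k)" "z \<in> S" "ws ! k \<in> S" "tclosed T (S - {ws ! k})" "matched xs (S - {z})"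
          using k(2) unfolding Q_def by blast
        let ?S = "S \<union> seg (Suc k) (Suc k')"
        have kS: "ws ! k' \<notin> S" using Ss(1) in_seg[of "Suc k" k' 0] k by auto
        have "?S - {ws ! k'} = S - {ws ! k} \<union> seg k k'"
          using Ss(3) segk[of k'] k kS by (auto simp: seg_def inj less_Suc_eq)
        then have "tclosed T (?S - {ws ! k'})" using ext[OF Ss(4), of k'] evk k by simp
        moreover have "?S - {z} = (S - {z}) \<union> seg (Suc k) (Suc k')" using low[OF zs, of "Suc k'"] k by auto
        then have "matched xs (?S - {z})"
          using matched_Un[OF Ss(5) mseg[of "Suc k" "Suc k'"]] k evk low[of _ "Suc k'"] Ss(1) by auto
        moreover have "?S \<subseteq> seg 0 (Suc k')" using Ss(1) sub by (auto simp: seg_def)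
        moreover have "ws ! k' \<in> ?S" using in_seg[of "Suc k'" k' "Suc k"] k by simp
        ultimately show ?thesis using Ss(2) by (intro exI[of _ ?S]) simp
      next
        case 2
        let ?S = "seg j (Suc k')"
        have "?S - {ws ! k'} = seg j k'" using k by (auto simp: seg_def inj less_Suc_eq)
        moreover have "?S - {z} = seg (Suc j) (Suc k')"
          using k j by (auto simp: seg_def inj)
        ultimately have "tclosed T (?S - {ws ! k'})" "matched xs (?S - {z})"
          using tseg[of j k'] mseg[of "Suc j" "Suc k'"] 2 evk k by simp_all
        moreover have "?S \<subseteq> seg 0 (Suc k')" by (auto simp: seg_def)
        moreover have "ws ! k' \<in> ?S" "z \<in> ?S" using j by (auto simp: seg_def)
        ultimately show ?thesis by blast
      next
        \<comment> \<open>From \<open>z\<close> go back along \<open>ws\<close> to the old tip,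
          through the old blossom to \<open>ws ! a'\<close>, and across the new edge to the new
          tip.\<close>
        case 3
        have jk: "j < k'" using j 3 evk by (metis le_neq_implies_less)
        let ?S = "S \<union> seg (Suc k) (Suc j) \<union> {ws ! k'}"
        have kS: "ws ! k' \<notin> S" using Ss(1) in_seg[of "Suc k" k' 0] k by auto
        have ks: "ws ! k' \<notin> seg i (Suc j)" for i using in_seg[of "Suc j" k' i] k jk by simp
        have "?S - {ws ! k'} = S - {ws ! k} \<union> seg k (Suc j)"
          using segk[of "Suc j"] Ss(3) kS ks 3 by auto
        then have "tclosed T (?S - {ws ! k'})" using ext[OF Ss(4), of "Suc j"] 3 k jk by simp
        moreover have "matched xs (?S - {z})"
        proof -
          have zS: "z \<notin> S" using Ss(1) in_seg[of "Suc k" j 0] j 3 jk k by auto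
          have zk': "z \<noteq> ws ! k'" using j jk k inj by auto
          have "seg (Suc k) (Suc j) - {z} = seg (Suc k) j"
            using j jk k by (auto simp: seg_def inj less_Suc_eq)
          then have "?S - {z} = (S - {?z}) \<union> seg (Suc k) j \<union> {?z, ws ! k'}"
            using zS zk' Ss(2) by auto
          moreover have "matched xs (seg (Suc k) j)" using mseg[of "Suc k" j] k 3 jk by simp
          moreover have "matched xs {?z, ws ! k'}" using matched_pair[OF k(6) zk] .
          moreover have "(S - {?z}) \<inter> seg (Suc k) j = {}" using Ss(1) low[of _ j] k jk by auto
          moreover have "(S - {?z} \<union> seg (Suc k) j) \<inter> {?z, ws ! k'} = {}"
            using kS low[OF za, of j] in_seg[of j k' "Suc k"] k jk by auto
          ultimately show ?thesis using Ss(5) matched_Un by metis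
        qed
        moreover have "?S \<subseteq> seg 0 (Suc k')" using Ss(1) sub jk by (auto simp: seg_def)
        moreover have "z \<in> ?S" using in_seg[of "Suc j" j "Suc k"] j 3 jk k by auto
        ultimately show ?thesis by (intro exI[of _ ?S]) simp
      qed
      then show "\<exists>S\<subseteq>seg 0 (Suc k'). z \<in> S \<and> ws ! k' \<in> S \<and> tclosed T (S - {ws ! k'}) \<and> matched xs (S - {z})"
        by blast
    qed
    ultimately show ?thesis by blast
  qed
  let ?B = "{k. k < ?n \<and> even k \<and> Q k}"
  \<comment> \<open>No circle edge joins a largest blossom to the rest of \<open>D\<close>, so each
    arc lies inside it or outside it.\<close>
  define k where "k = Max ?B"
  have "0 \<in> ?B" using Q0 ws(1) by simp
  then have "k \<in> ?B" unfolding k_def by (intro Max_in) auto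
  then have kB: "k < ?n" "even k" "Q k" by auto
  have noadj: "\<not> adj xs (ws ! a') (ws ! k')" if "a' \<le> k" "k < k'" "k' < ?n" for a' k'
  proof
    assume "adj xs (ws ! a') (ws ! k')"
    then have "k' \<in> ?B" using grow[OF kB(2,3) that] that by blast
    then have "k' \<le> k" unfolding k_def by (intro Max_ge) auto
    then show False using that by simp
  qed
  have k1: "Suc k < ?n" using kB ev by (metis Suc_lessI even_Suc)
  let ?P = "seg 0 (Suc k)"
  have closed: "y \<in> ?P" if xP: "x \<in> ?P" and yD: "y \<in> D" and xy: "adj xs x y" for x y
  proof (rule ccontr)
    assume y: "y \<notin> ?P"
    obtain a' where "x = ws ! a'" "a' \<le> k" using xP by (auto simp: seg_def)
    moreover obtain k' where "y = ws ! k'" "k' < ?n" using yD Dws by (auto simp: in_set_conv_nth)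
    moreover have "k < k'" using y calculation by (auto simp: seg_def)
    ultimately show False using noadj xy by blast
  qed
  have arc: "set A \<subseteq> ?P \<or> set A \<inter> ?P = {}" if "xs = P' @ A @ S'" "set A \<subseteq> D" for A P' S'
    using that(2) closed by (intro segment_within[OF that(1)]) blast
  have "x1 \<in> ?P" using in_seg[of "Suc k" 0 0] kB ws(1,2) by simp
  then have p1: "set A1 \<subseteq> ?P" using arc[of "[a]" A1 "b # A2 @ c # A3"] xs Deq A1 by auto
  have "x2 \<notin> ?P" using in_seg[of "Suc k" "?n - 1" 0] k1 wlast by simp
  then have p2: "set A2 \<inter> ?P = {}" using arc[of "a # A1 @ [b]" A2 "c # A3"] xs Deq A2 by auto
  have p3: "set A3 \<subseteq> ?P \<or> set A3 \<inter> ?P = {}" using arc[of "a # A1 @ b # A2 @ [c]" A3 "[]"] xs Deq by auto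
  have PD: "?P \<subseteq> D" using segD kB by simp
  \<comment> \<open>This is the only chord that leaves the blossom. Depending on the place of
    \<open>A3\<close>, either \<open>A1\<close> is the blossom or \<open>A2\<close> is its
    complement in \<open>D\<close>, and that arc is contracted.\<close>
  have Tk: "T (ws ! k) = ws ! Suc k" "T (ws ! Suc k) = ws ! k" using Tup Tdn kB k1 by auto
  show False
  proof (cases "set A3 \<inter> ?P = {}")
    case True
    then have "set A1 = ?P" using p1 p2 PD Deq by blast
    moreover have "?P - {ws ! k} = seg 0 k" using kB by (auto simp: seg_def inj less_Suc_eq)
    moreover have "tclosed T (seg 0 k)" using tseg[of 0 k] kB by simp
    moreover have "ws ! k \<in> ?P" "ws ! Suc k \<notin> ?P" using in_seg kB k1 by simp_all
    ultimately have "good xs T D a b c"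
      using good_contract_arc[OF IH c, of A1 "A2 @ c # A3" "ws ! k"] xs D par Tk by simp
    then show False using ng by simp
  next
    case False
    then have "set A3 \<subseteq> ?P" using p3 by blast
    then have "set A2 = D - ?P" using p1 p2 Deq by blast
    also have "\<dots> = seg (Suc k) ?n"
    proof -
      have "{0..<?n} = {0..<Suc k} \<union> {Suc k..<?n}" using kB by auto
      then have "D = ?P \<union> seg (Suc k) ?n" using Dws seg_all by (simp add: seg_def image_Un)
      moreover have "?P \<inter> seg (Suc k) ?n = {}" using kB by (auto simp: seg_def inj)
      ultimately show ?thesis by blast
    qed
    finally have A2s: "set A2 = seg (Suc k) ?n" .
    moreover have "seg (Suc k) ?n - {ws ! Suc k} = seg (Suc (Suc k)) ?n"
      using k1 by (auto simp: seg_def inj)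
    moreover have "tclosed T (seg (Suc (Suc k)) ?n)" using tseg[of "Suc (Suc k)" ?n] kB ev by simp
    moreover have "ws ! Suc k \<in> set A2" "ws ! k \<notin> set A2"
      using A2s in_seg[of ?n "Suc k" "Suc k"] in_seg[of ?n k "Suc k"] kB k1 by simp_all
    moreover let ?ys = "b # A2 @ c # A3 @ a # A1"
    have cr: "circle ?ys T D b c a"
      using circle_rotate[of "a # A1" "b # A2 @ c # A3"] c xs circle_perm by (metis append_Cons append_assoc)
    ultimately have "good ?ys T D b c a"
      using good_contract_arc[OF _ cr, of A2 "A3 @ a # A1" "ws ! Suc k"] IH xs D par Tk by auto
    then have "good xs T D b c a" using good_rotate[of "b # A2 @ c # A3" "a # A1"] xs by simp
    then show False using ng good_perm by metis
  qed
qed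

section \<open>The statement for exactly three spokes\<close>

lemma all_good: "all_good xs"
proof (induction xs rule: length_induct)
  case (1 xs)
  then have IH: "length ys < length xs \<Longrightarrow> all_good ys" for ys :: "'a list" by blast
  have main: "good xs T D a b c"
    if zs: "circle zs T D a b c" "zs = a # A1 @ b # A2 @ c # A3" and l: "length zs = length xs"
      and ret: "good zs T D a b c \<Longrightarrow> good xs T D a b c" for zs T D a b c A1 A2 A3
  proof -
    have IH': "length ys < length zs \<Longrightarrow> all_good ys" for ys :: "'a list" using IH l by simp
    obtain gs where gs: "cyc zs gs ({a, b, c} \<union> D)" using zs(1) by (auto simp: circle_def)
    have "good zs T D a b c"
    proof (cases "True \<in> set gs")
      case True
      then show ?thesis using good_by_deletion[OF IH' zs(1) gs] by blast
    next
      case False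
      then have D: "set zs = {a, b, c} \<union> D" using cyc_has_True[OF gs] by simp
      have dx: "distinct zs" and tD: "tclosed T D" and Deq: "D = set A1 \<union> set A2 \<union> set A3"
        using zs D by (auto simp: circle_def)
      have "card D = length A1 + length A2 + length A3"
        using dx zs(2) unfolding Deq by (subst card_Un_disjoint; auto simp: distinct_card)+
      then have ev: "even (length A1 + length A2 + length A3)"
        using tclosed_even_card[OF _ tD] Deq by simp
      consider "even (length A1)" "even (length A2)" "even (length A3)"
        | "odd (length A1)" "odd (length A2)" "even (length A3)"
        | "odd (length A1)" "even (length A2)" "odd (length A3)"
        | "even (length A1)" "odd (length A2)" "odd (length A3)"
        using ev by auto
      then show ?thesis
      proof cases
        case 1
        have "matched zs (set A1)" "matched zs (set A2)" "matched zs (set A3)"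
          using matched_segment[of zs "[a]" A1 "b # A2 @ c # A3"] matched_segment[of zs "a # A1 @ [b]" A2 "c # A3"]
            matched_segment[of zs "a # A1 @ b # A2 @ [c]" A3 "[]"] 1 zs(2) dx by auto
        then have m: "matched zs D"
          unfolding Deq using dx zs(2) by (intro matched_Un) auto
        show ?thesis
        proof (cases "D = {}")
          case False
          then show ?thesis using good_by_matching[OF IH' zs(1) _ _ tD D m] by blast
        next
          case True
          then have "zs = [a, b, c]" using zs(2) Deq by simp
          \<comment> \<open>Each spoke is combined with the opposite edge of the triangle.\<close>
          moreover have "spoke_match [a, b, c] T D a [False, True, False]"
              "spoke_match [a, b, c] T D b [False, False, True]" "spoke_match [a, b, c] T D c [True, False, False]"
            by (auto simp: spoke_match_def cyc_def intro!: exI[of _ "{}"])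
          moreover have "cover3 [False, True, False] [False, False, True] [True, False, False]"
            by (simp add: cover3_def)
          ultimately show ?thesis unfolding good_def by blast
        qed
      next
        case 2
        then show ?thesis using good_two_odd_arcs[OF IH' zs(1) D zs(2)] by blast
      next
        case 3
        let ?ys = "c # A3 @ a # A1 @ b # A2"
        have "circle ?ys T D c a b"
          using circle_rotate[of "a # A1 @ b # A2" "c # A3"] zs circle_perm by (metis append_Cons append_assoc)
        then have "good ?ys T D c a b"
          using good_two_odd_arcs[of ?ys T D c a b A3 A1 A2] 3 D IH' zs(2) by auto
        then have "good zs T D c a b"
          using good_rotate[of "c # A3" "a # A1 @ b # A2"] zs(2) by simp
        then show ?thesis using good_perm by metis
      next
        case 4
        let ?ys = "b # A2 @ c # A3 @ a # A1"
        have "circle ?ys T D b c a"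
          using circle_rotate[of "a # A1" "b # A2 @ c # A3"] zs circle_perm by (metis append_Cons append_assoc)
        then have "good ?ys T D b c a"
          using good_two_odd_arcs[of ?ys T D b c a A2 A3 A1] 4 D IH' zs(2) by auto
        then have "good zs T D b c a"
          using good_rotate[of "b # A2 @ c # A3" "a # A1"] zs(2) by simp
        then show ?thesis using good_perm by metis
      qed
    qed
    then show ?thesis by (rule ret)
  qed
  show ?case
    unfolding all_good_def
  proof (intro allI impI)
    fix T :: "'a \<Rightarrow> 'a" and D a b c
    assume c: "circle xs T D a b c"
    then have abc: "a \<in> set xs" "b \<in> set xs" "c \<in> set xs" "distinct [a, b, c]" by (auto simp: circle_def)
    obtain P S where PS: "xs = P @ a # S" using abc(1) by (meson split_list)
    let ?zs = "a # S @ P"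
    have cz: "circle ?zs T D a b c" using circle_rotate[of P "a # S"] c PS by simp
    have ret: "good ?zs T D a b c \<Longrightarrow> good xs T D a b c" for a b c
      using good_rotate[of "a # S" P] PS by (metis append_Cons good_rotate)
    have lz: "length ?zs = length xs" using PS by simp
    have "b \<in> set (S @ P)" using abc PS by auto
    then obtain A1 R where R: "S @ P = A1 @ b # R" by (meson split_list)
    have "c \<in> set A1 \<or> c \<in> set R" using abc PS arg_cong[OF R, of set] by auto
    then show "good xs T D a b c"
    proof
      assume "c \<in> set R"
      then obtain A2 A3 where "R = A2 @ c # A3" by (meson split_list)
      then show ?thesis using main[OF cz _ lz ret, of A1 A2 A3] R by simp
    next
      assume "c \<in> set A1"
      then obtain B1 B2 where "A1 = B1 @ c # B2" by (meson split_list)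
      then have "good xs T D a c b"
        using main[OF circle_perm[OF cz, THEN conjunct2] _ lz ret, of B1 B2 R] R by simp
      then show ?thesis using good_perm by metis
    qed
  qed
qed


section \<open>Components of two involutions that are paths\<close>

definition involution_on :: "'a set \<Rightarrow> ('a \<Rightarrow> 'a) \<Rightarrow> bool" where
  "involution_on V \<alpha> \<longleftrightarrow> (\<forall>x\<in>V. \<alpha> x \<in> V \<and> \<alpha> (\<alpha> x) = x)"

text \<open>Closure of \<open>set ws\<close> under both involutions is part of the definition, so
  that later arguments can avoid positions.\<close>

definition alt_path :: "('a \<Rightarrow> 'a) \<Rightarrow> ('a \<Rightarrow> 'a) \<Rightarrow> 'a \<Rightarrow> 'a list \<Rightarrow> bool" where
  "alt_path \<alpha> \<beta> p ws \<longleftrightarrow> ws \<noteq> [] \<and> ws ! 0 = p \<and> distinct ws \<and> \<beta> p = p \<and>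
     (\<forall>i. Suc i < length ws \<longrightarrow> ws ! Suc i = (if even i then \<alpha> else \<beta>) (ws ! i)) \<and>
     (if odd (length ws) then \<alpha> else \<beta>) (last ws) = last ws \<and>
     involution_on (set ws) \<alpha> \<and> involution_on (set ws) \<beta>"

lemma alt_path_exists:
  assumes V: "finite V" "p \<in> V" "\<beta> p = p" and ab: "involution_on V \<alpha>" "involution_on V \<beta>"
  obtains ws where "alt_path \<alpha> \<beta> p ws" "set ws \<subseteq> V"
proof -
  have a: "\<And>x. x \<in> V \<Longrightarrow> \<alpha> x \<in> V \<and> \<alpha> (\<alpha> x) = x" and b: "\<And>x. x \<in> V \<Longrightarrow> \<beta> x \<in> V \<and> \<beta> (\<beta> x) = x"
    using ab by (auto simp: involution_on_def)
  show thesis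
  proof (rule alternating_path[of V p \<beta> \<alpha>, OF V], use a in blast, use b in blast)
    fix ws assume ws: "ws \<noteq> []" "ws ! 0 = p" "distinct ws" "set ws \<subseteq> V"
      and step: "\<And>i. Suc i < length ws \<Longrightarrow> ws ! Suc i = (if even i then \<alpha> else \<beta>) (ws ! i)"
      and fin: "(if odd (length ws) then \<alpha> else \<beta>) (last ws) = last ws"
    have lst: "last ws = ws ! (length ws - 1)" using ws(1) by (rule last_conv_nth)
    have V': "x \<in> set ws \<Longrightarrow> x \<in> V" for x using ws(4) by blast
    have up: "(if even i then \<alpha> else \<beta>) (ws ! i) \<in> set ws" if "i < length ws" for i
    proof (cases "Suc i < length ws")
      case True
      then show ?thesis using step[OF True] nth_mem[OF True] by simp
    next
      case False
      then have s: "length ws = Suc i" using that by linarith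
      then have "i = length ws - 1" "odd (length ws) \<longleftrightarrow> even i" unfolding s by simp_all
      then show ?thesis using fin lst that by auto
    qed
    have dn: "(if even i then \<beta> else \<alpha>) (ws ! i) \<in> set ws" if "i < length ws" for i
    proof (cases i)
      case 0
      then show ?thesis using ws V(3) by auto
    next
      case (Suc j)
      have "ws ! i = (if even j then \<alpha> else \<beta>) (ws ! j)" using step[of j] Suc that by simp
      moreover have "ws ! j \<in> V" using Suc that V' by simp
      ultimately have "(if even i then \<beta> else \<alpha>) (ws ! i) = ws ! j" using Suc a b by simp
      then show ?thesis using Suc that by simp
    qed
    have "\<alpha> x \<in> set ws \<and> \<beta> x \<in> set ws" if x: "x \<in> set ws" for x
    proof -
      obtain i where "i < length ws" "x = ws ! i" using x by (auto simp: in_set_conv_nth)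
      then show ?thesis using up[of i] dn[of i] by (auto split: if_splits)
    qed
    then have "involution_on (set ws) \<alpha>" "involution_on (set ws) \<beta>"
      using a b V' by (auto simp: involution_on_def)
    then show thesis using that[of ws] ws step fin V(3) by (auto simp: alt_path_def)
  qed
qed

context
  fixes \<alpha> \<beta> :: "'a \<Rightarrow> 'a" and p ws
  assumes ap: "alt_path \<alpha> \<beta> p ws"
begin

lemma alt_path_inj: "i < length ws \<Longrightarrow> j < length ws \<Longrightarrow> ws ! i = ws ! j \<longleftrightarrow> i = j"
  using ap nth_eq_iff_index_eq by (auto simp: alt_path_def)

lemma alt_path_ends: "p \<in> set ws" "last ws \<in> set ws"
  using ap nth_mem[of 0 ws] by (auto simp: alt_path_def)

lemma alt_path_closed: "x \<in> set ws \<Longrightarrow> \<alpha> x \<in> set ws" "x \<in> set ws \<Longrightarrow> \<beta> x \<in> set ws"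
    "x \<in> set ws \<Longrightarrow> \<alpha> (\<alpha> x) = x" "x \<in> set ws \<Longrightarrow> \<beta> (\<beta> x) = x"
  using ap by (auto simp: alt_path_def involution_on_def)

lemma alt_path_up:
  assumes "Suc i < length ws"
  shows "even i \<Longrightarrow> \<alpha> (ws ! i) = ws ! Suc i" "even i \<Longrightarrow> \<alpha> (ws ! Suc i) = ws ! i"
    "odd i \<Longrightarrow> \<beta> (ws ! i) = ws ! Suc i" "odd i \<Longrightarrow> \<beta> (ws ! Suc i) = ws ! i"
proof -
  have s: "ws ! Suc i = (if even i then \<alpha> else \<beta>) (ws ! i)" using ap assms by (auto simp: alt_path_def)
  have m: "ws ! i \<in> set ws" using assms by simp
  show "even i \<Longrightarrow> \<alpha> (ws ! i) = ws ! Suc i" "odd i \<Longrightarrow> \<beta> (ws ! i) = ws ! Suc i" using s by simp_all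
  show "even i \<Longrightarrow> \<alpha> (ws ! Suc i) = ws ! i" "odd i \<Longrightarrow> \<beta> (ws ! Suc i) = ws ! i"
    using s alt_path_closed(3,4)[OF m] by simp_all
qed

text \<open>Each vertex arises from \<open>p\<close> by applying the involutions, so
  \<open>set ws\<close> is the orbit of \<open>p\<close>.\<close>

lemma alt_path_least:
  assumes "p \<in> C" "\<And>x. x \<in> C \<Longrightarrow> \<alpha> x \<in> C \<and> \<beta> x \<in> C"
  shows "set ws \<subseteq> C"
proof -
  have "ws ! i \<in> C" if "i < length ws" for i
    using that
  proof (induction i)
    case 0
    then show ?case using ap assms(1) by (simp add: alt_path_def)
  next
    case (Suc i)
    then show ?case using assms(2)[of "ws ! i"] alt_path_up(1,3)[of i] by (cases "even i") auto
  qed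
  then show ?thesis by (auto simp: in_set_conv_nth)
qed

lemma alt_path_last: "last ws = ws ! (length ws - 1)"
  using ap by (intro last_conv_nth) (simp add: alt_path_def)

lemma alt_path_pos: "0 < length ws"
  using ap by (simp add: alt_path_def)

lemma alt_path_moves:
  assumes "x \<in> set ws" "x \<noteq> last ws"
  shows "\<alpha> x \<noteq> x \<or> \<beta> x \<noteq> x" "x \<noteq> p \<Longrightarrow> \<alpha> x \<noteq> x \<and> \<beta> x \<noteq> x" "\<alpha> p \<noteq> p"
proof -
  obtain i where i: "i < length ws" "x = ws ! i" using assms(1) by (auto simp: in_set_conv_nth)
  then have i1: "Suc i < length ws" using assms(2) alt_path_last by (metis Suc_lessI diff_Suc_1)
  have a: "(if even i then \<alpha> else \<beta>) x \<noteq> x"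
    using alt_path_up(1,3)[OF i1] alt_path_inj[of "Suc i" i] i i1 by auto
  then show "\<alpha> x \<noteq> x \<or> \<beta> x \<noteq> x" by (auto split: if_splits)
  show "\<alpha> x \<noteq> x \<and> \<beta> x \<noteq> x" if "x \<noteq> p"
  proof -
    have "i \<noteq> 0" using that i ap by (metis alt_path_def)
    then obtain j where j: "i = Suc j" by (cases i) auto
    then have "(if even j then \<alpha> else \<beta>) x \<noteq> x"
      using alt_path_up(2,4)[of j] alt_path_inj[of "Suc j" j] i by auto
    then show ?thesis using a j by (auto split: if_splits)
  qed
  have "0 < length ws" "Suc 0 < length ws" using i1 by auto
  then show "\<alpha> p \<noteq> p"
    using alt_path_up(1)[of 0] alt_path_inj[of "Suc 0" 0] ap by (auto simp: alt_path_def)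
qed

lemma alt_path_last_fixed:
  assumes "last ws \<noteq> p"
  shows "\<alpha> (last ws) = last ws \<longleftrightarrow> \<beta> (last ws) \<noteq> last ws"
    "even (length ws) \<longleftrightarrow> \<beta> (last ws) = last ws"
proof -
  have n: "length ws \<noteq> 1" using assms alt_path_last ap by (auto simp: alt_path_def)
  then obtain j where j: "length ws = Suc (Suc j)" using alt_path_pos by (metis One_nat_def not0_implies_Suc not_gr0)
  then have l: "last ws = ws ! Suc j" using alt_path_last by simp
  have "(if even j then \<alpha> else \<beta>) (last ws) \<noteq> last ws"
    using alt_path_up(2,4)[of j] alt_path_inj[of "Suc j" j] j l by auto
  moreover have "(if odd (length ws) then \<alpha> else \<beta>) (last ws) = last ws" using ap by (simp add: alt_path_def)
  ultimately show "\<alpha> (last ws) = last ws \<longleftrightarrow> \<beta> (last ws) \<noteq> last ws" "even (length ws) \<longleftrightarrow> \<beta> (last ws) = last ws"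
    using j by (auto split: if_splits)
qed

lemma alt_path_fixed_p: "last ws = p \<Longrightarrow> \<alpha> p = p"
proof -
  assume l: "last ws = p"
  then have "length ws - 1 = 0"
    using alt_path_inj[of "length ws - 1" 0] alt_path_last alt_path_pos ap by (simp add: alt_path_def)
  then have "odd (length ws)" using alt_path_pos by (cases "length ws") auto
  then show "\<alpha> p = p" using ap l by (simp add: alt_path_def)
qed

text \<open>The steps from even positions are steps of \<open>\<alpha>\<close>, those from odd
  positions steps of \<open>\<beta>\<close>; cutting before even positions therefore cuts no step of
  \<open>\<alpha>\<close>, and likewise for \<open>\<beta>\<close>.\<close>

lemma alt_path_seg:
  assumes "j \<le> length ws" "i < length ws" "x \<in> (!) ws ` {i..<j}"
  shows "even i \<Longrightarrow> even j \<Longrightarrow> \<alpha> x \<in> (!) ws ` {i..<j}" "odd i \<Longrightarrow> odd j \<Longrightarrow> \<beta> x \<in> (!) ws ` {i..<j}"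
proof -
  obtain k where k: "x = ws ! k" "i \<le> k" "k < j" using assms(3) by auto
  have *: "(if even i then \<alpha> else \<beta>) x \<in> (!) ws ` {i..<j}" if e: "even i \<longleftrightarrow> even j"
  proof (cases "even k \<longleftrightarrow> even i")
    case True
    then have "Suc k < j" using k e by (metis Suc_lessI even_Suc)
    then show ?thesis using alt_path_up(1,3)[of k] True k assms by auto
  next
    case False
    then have "i < k" using k by (metis le_neq_implies_less)
    then obtain l where l: "k = Suc l" "i \<le> l" by (cases k) auto
    then show ?thesis using alt_path_up(2,4)[of l] False k assms by auto
  qed
  show "even i \<Longrightarrow> even j \<Longrightarrow> \<alpha> x \<in> (!) ws ` {i..<j}" "odd i \<Longrightarrow> odd j \<Longrightarrow> \<beta> x \<in> (!) ws ` {i..<j}"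
    using * by auto
qed

end

section \<open>From three spokes to arbitrarily many\<close>

text \<open>Without \<open>l\<close> the circuit is a path that is matched by consecutive pairs.
  Alternating these pairs with chords from \<open>r\<close> ends at another spoke \<open>d\<close>.
  The vertices off this alternating path stay matched along the circuit, so only its own chords are
  kept.\<close>

lemma third_spoke:
  assumes d: "distinct ys" "odd (length ys)" and Sp: "Sp \<subseteq> set ys" "tclosed T (set ys - Sp)"
    and lr: "l \<in> Sp" "r \<in> Sp" "l \<noteq> r"
  shows "\<exists>d\<in>Sp - {l, r}. good ys T (set ys - Sp) l r d"
proof -
  obtain P S where PS: "ys = P @ l # S" using lr Sp(1) by (meson split_list subsetD)
  let ?B = "S @ P" let ?zs = "l # S @ P" let ?V = "set ?B"
  have dz: "distinct ?zs" "even (length ?B)" "set ?zs = set ys" using d PS by auto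
  have "matched ?zs ?V" using dz by (intro matched_segment[of _ "[l]" _ "[]"]) auto
  then obtain \<rho> where r: "tclosed \<rho> ?V" "\<And>x. x \<in> ?V \<Longrightarrow> adj ?zs x (\<rho> x)" by (auto simp: matched_def)
  \<comment> \<open>Spokes become fixed points, so that alternating paths stop there.\<close>
  define T' where "T' x = (if x \<in> Sp then x else T x)" for x
  have iT: "involution_on ?V T'"
    unfolding involution_on_def
  proof
    fix x assume "x \<in> ?V"
    then show "T' x \<in> ?V \<and> T' (T' x) = x"
      using Sp(2) dz lr(1) by (auto simp: T'_def tclosed_def)
  qed
  have ir: "involution_on ?V \<rho>" using r(1) by (auto simp: involution_on_def tclosed_def)
  have rV: "r \<in> ?V" using lr Sp(1) dz(3) by auto
  obtain ws where ws: "alt_path \<rho> T' r ws" "set ws \<subseteq> ?V"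
    by (rule alt_path_exists[of ?V r T' \<rho>, OF _ rV _ ir iT]) (use lr in \<open>auto simp: T'_def\<close>)
  let ?d = "last ws"
  have nofix: "x \<in> ?V \<Longrightarrow> \<rho> x \<noteq> x" for x using r(1) by (auto simp: tclosed_def)
  have dr: "?d \<noteq> r" using alt_path_fixed_p[OF ws(1)] nofix rV by blast
  have dV: "?d \<in> ?V" using alt_path_ends(2)[OF ws(1)] ws(2) by blast
  have "T' ?d = ?d" using alt_path_last_fixed(1)[OF ws(1) dr] nofix dV by blast
  then have dS: "?d \<in> Sp"
    using Sp(2) dV dz(3) by (force simp: T'_def tclosed_def split: if_splits)
  have dl: "?d \<noteq> l" using dV dz(1) by auto
  define D where "D = set ws - {r, ?d}"
  have Dsub: "D \<subseteq> set ys - Sp"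
  proof
    fix x assume "x \<in> D"
    then have "T' x \<noteq> x" "x \<in> ?V" using alt_path_moves(2)[OF ws(1), of x] ws(2) by (auto simp: D_def)
    then show "x \<in> set ys - Sp" using dz(3) by (auto simp: T'_def)
  qed
  have tD: "tclosed T D"
    unfolding tclosed_def
  proof
    fix x assume x: "x \<in> D"
    then have t: "T x \<in> set ys - Sp" "T x \<noteq> x" "T (T x) = x" using Dsub Sp(2) by (auto simp: tclosed_def)
    have "T' x = T x" using x Dsub by (auto simp: T'_def)
    then have "T x \<in> set ws" using alt_path_closed(2)[OF ws(1), of x] x by (simp add: D_def)
    then show "T x \<in> D \<and> T x \<noteq> x \<and> T (T x) = x" using t dS lr by (auto simp: D_def)
  qed
  have c3: "card {l, r, ?d} = 3" using lr dr dl by auto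
  have "card {l, r, ?d} \<le> card (set ?zs)" using rV dV by (intro card_mono) auto
  then have l3: "3 \<le> length ?zs" using c3 card_length[of ?zs] by linarith
  have "tclosed \<rho> (set ws)"
    using alt_path_closed(1,3)[OF ws(1)] nofix ws(2) by (auto simp: tclosed_def)
  then have "tclosed \<rho> (?V - set ws)" using r(1) by (intro tclosed_Diff)
  then have "matched ?zs (?V - set ws)" using r(2) by (auto simp: matched_def)
  then obtain gs where gs: "cyc ?zs gs (set ?zs - (?V - set ws))"
    using matched_imp_cyc[OF dz(1) l3, of "?V - set ws"] by auto
  have "set ws = {r, ?d} \<union> D" using alt_path_ends[OF ws(1)] by (auto simp: D_def)
  then have "set ?zs - (?V - set ws) = {l, r, ?d} \<union> D" using ws(2) dz(1) by auto
  then have "circle ?zs T D l r ?d"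
    using gs dz(1,3) lr Sp(1) dS dr dl Dsub tD unfolding circle_def by auto
  then have "good ?zs T D l r ?d" using all_good[of ?zs] unfolding all_good_def by blast
  then have "good ?zs T (set ys - Sp) l r ?d" using Dsub by (rule good_mono)
  then have "good ys T (set ys - Sp) l r ?d" using good_rotate[of "l # S" P] PS by simp
  then show ?thesis using dS dr dl by blast
qed

section \<open>Circuit matchings as partner maps\<close>

text \<open>This form is free of positions and fits the encoding of perfect matchings below. The
  values of \<open>\<sigma>\<close> on \<open>W\<close> are arbitrary.\<close>

definition spoke_involution :: "'a list \<Rightarrow> ('a \<Rightarrow> 'a) \<Rightarrow> 'a set \<Rightarrow> 'a \<Rightarrow> 'a set \<Rightarrow> ('a \<Rightarrow> 'a) \<Rightarrow> bool" where
  "spoke_involution xs T D s W \<sigma> \<longleftrightarrow> (\<exists>U. U \<subseteq> D \<and> tclosed T U \<and> W = insert s U) \<and>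
     tclosed \<sigma> (set xs - W) \<and> (\<forall>x\<in>set xs - W. adj xs x (\<sigma> x))"

text \<open>The last conjunct keeps track of the individual edges of \<open>gs\<close>, which is
  what carries a cover over to the partner maps.\<close>

lemma cyc_imp_involution:
  assumes d: "distinct xs" "3 \<le> length xs" and c: "cyc xs gs W"
  shows "\<exists>\<sigma>. tclosed \<sigma> (set xs - W) \<and> (\<forall>x\<in>set xs - W. adj xs x (\<sigma> x)) \<and>
    (\<forall>i<length xs. gs ! i \<longrightarrow> (let x = xs ! i; y = xs ! (Suc i mod length xs) in
       x \<notin> W \<and> y \<notin> W \<and> \<sigma> x = y \<and> \<sigma> y = x))"
proof -
  let ?n = "length xs"
  let ?s = "\<lambda>i. Suc i mod ?n" and ?p = "\<lambda>i. (i + ?n - 1) mod ?n"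
  have l: "length gs = ?n" and sp: "\<And>i. i < ?n \<Longrightarrow> \<not> (gs ! i \<and> gs ! ?s i)"
    and W: "W = unc (last gs) xs gs" using c by (auto simp: cyc_def sparse_cyc)
  have n0: "0 < ?n" using d(2) by linarith
  have sn: "?s i < ?n" "?p i < ?n" for i using n0 by simp_all
  have inj: "i < ?n \<Longrightarrow> j < ?n \<Longrightarrow> xs ! i = xs ! j \<longleftrightarrow> i = j" for i j
    using d(1) nth_eq_iff_index_eq by blast
  have inW: "xs ! i \<in> W \<longleftrightarrow> \<not> gs ! i \<and> \<not> gs ! ?p i" if "i < ?n" for i
    unfolding W unc_cyc[OF l] using inj that by auto
  define idx where "idx x = (THE i. i < ?n \<and> xs ! i = x)" for x
  have idx: "idx (xs ! i) = i" if "i < ?n" for i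
    unfolding idx_def using that inj by (intro the_equality) auto
  define \<sigma> where "\<sigma> x = (if gs ! idx x then xs ! ?s (idx x) else xs ! ?p (idx x))" for x
  have up: "\<sigma> (xs ! i) = xs ! ?s i" "\<sigma> (xs ! ?s i) = xs ! i" "xs ! i \<notin> W" "xs ! ?s i \<notin> W"
    if i: "i < ?n" "gs ! i" for i
  proof -
    show "\<sigma> (xs ! i) = xs ! ?s i" using i idx by (simp add: \<sigma>_def)
    have p: "?p (?s i) = i" using pred_Suc_mod[OF i(1)] .
    have "\<not> gs ! ?s i" using sp i by blast
    then show "\<sigma> (xs ! ?s i) = xs ! i" using idx[OF sn(1)] p by (simp add: \<sigma>_def)
    show "xs ! i \<notin> W" "xs ! ?s i \<notin> W" using inW[OF i(1)] inW[OF sn(1)[of i]] i(2) p by auto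
  qed
  have ne: "xs ! i \<noteq> xs ! ?s i" if "i < ?n" for i
    using inj[OF that sn(1)[of i]] that d(2) by (auto simp: Suc_mod)
  have ex: "\<exists>i<?n. gs ! i \<and> (x = xs ! i \<or> x = xs ! ?s i)" if x: "x \<in> set xs - W" for x
  proof -
    obtain i where i: "i < ?n" "x = xs ! i" using x by (auto simp: in_set_conv_nth)
    then have "gs ! i \<or> gs ! ?p i" using inW x by auto
    then show ?thesis using i sn(2)[of i] Suc_pred_mod[OF i(1)] by metis
  qed
  have aj: "adj xs (xs ! i) (xs ! ?s i)" if "i < ?n" for i using that by (auto simp: adj_def)
  have "\<sigma> x \<in> set xs - W \<and> \<sigma> x \<noteq> x \<and> \<sigma> (\<sigma> x) = x \<and> adj xs x (\<sigma> x)" if x: "x \<in> set xs - W" for x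
  proof -
    obtain i where i: "i < ?n" "gs ! i" "x = xs ! i \<or> x = xs ! ?s i" using ex[OF x] by blast
    show ?thesis
      using i(3) up[OF i(1,2)] ne[OF i(1)] aj[OF i(1)] adj_sym[OF aj[OF i(1)]] i(1) sn(1)[of i]
      by (elim disjE) auto
  qed
  then show ?thesis using up by (intro exI[of _ \<sigma>]) (auto simp: tclosed_def Let_def)
qed

lemma good_imp_involutions:
  assumes d: "distinct xs" "3 \<le> length xs" and g: "good xs T D a b c"
  obtains W1 W2 W3 \<sigma>1 \<sigma>2 \<sigma>3 where "spoke_involution xs T D a W1 \<sigma>1" "spoke_involution xs T D b W2 \<sigma>2"
    "spoke_involution xs T D c W3 \<sigma>3"
    "\<And>x y. adj xs x y \<Longrightarrow> (x \<notin> W1 \<and> \<sigma>1 x = y) \<or> (x \<notin> W2 \<and> \<sigma>2 x = y) \<or> (x \<notin> W3 \<and> \<sigma>3 x = y)"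
proof -
  obtain p q r where pqr: "spoke_match xs T D a p" "spoke_match xs T D b q" "spoke_match xs T D c r"
    and cov: "cover3 p q r" using g by (auto simp: good_def)
  have *: "\<exists>W \<sigma>. spoke_involution xs T D s W \<sigma> \<and> (\<forall>i<length xs. p ! i \<longrightarrow> (let x = xs ! i; y = xs ! (Suc i mod length xs) in
       x \<notin> W \<and> y \<notin> W \<and> \<sigma> x = y \<and> \<sigma> y = x))" if "spoke_match xs T D s p" for s p
  proof -
    obtain U where U: "U \<subseteq> D" "tclosed T U" "cyc xs p (insert s U)" using \<open>spoke_match xs T D s p\<close>
      by (auto simp: spoke_match_def)
    then show ?thesis using cyc_imp_involution[OF d U(3)] unfolding spoke_involution_def by blast
  qed
  obtain W1 \<sigma>1 where 1: "spoke_involution xs T D a W1 \<sigma>1" "\<forall>i<length xs. p ! i \<longrightarrow> (let x = xs ! i; y = xs ! (Suc i mod length xs) in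
       x \<notin> W1 \<and> y \<notin> W1 \<and> \<sigma>1 x = y \<and> \<sigma>1 y = x)" using *[OF pqr(1)] by blast
  obtain W2 \<sigma>2 where 2: "spoke_involution xs T D b W2 \<sigma>2" "\<forall>i<length xs. q ! i \<longrightarrow> (let x = xs ! i; y = xs ! (Suc i mod length xs) in
       x \<notin> W2 \<and> y \<notin> W2 \<and> \<sigma>2 x = y \<and> \<sigma>2 y = x)" using *[OF pqr(2)] by blast
  obtain W3 \<sigma>3 where 3: "spoke_involution xs T D c W3 \<sigma>3" "\<forall>i<length xs. r ! i \<longrightarrow> (let x = xs ! i; y = xs ! (Suc i mod length xs) in
       x \<notin> W3 \<and> y \<notin> W3 \<and> \<sigma>3 x = y \<and> \<sigma>3 y = x)" using *[OF pqr(3)] by blast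
  have l: "length p = length xs" "length q = length xs" "length r = length xs"
    using pqr by (auto dest: spoke_match_length)
  have cv: "p ! i \<or> q ! i \<or> r ! i" if "i < length xs" for i
    using cov that l by (auto simp: cover3_def list_all_length)
  show thesis
  proof (rule that[OF 1(1) 2(1) 3(1)])
    fix x y assume "adj xs x y"
    then obtain i where i: "i < length xs" "x = xs ! i \<and> y = xs ! (Suc i mod length xs) \<or> y = xs ! i \<and> x = xs ! (Suc i mod length xs)"
      by (auto simp: adj_def doubleton_eq_iff)
    then show "(x \<notin> W1 \<and> \<sigma>1 x = y) \<or> (x \<notin> W2 \<and> \<sigma>2 x = y) \<or> (x \<notin> W3 \<and> \<sigma>3 x = y)"
      using cv[OF i(1)] 1(2) 2(2) 3(2) by (fastforce simp: Let_def)
  qed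
qed

lemma adj_Cons:
  assumes "ws \<noteq> []"
  shows "adj (u # ws) x y \<longleftrightarrow> {x, y} = {u, hd ws} \<or> {x, y} = {last ws, u} \<or>
    (\<exists>j. Suc j < length ws \<and> {x, y} = {ws ! j, ws ! Suc j})" (is "_ \<longleftrightarrow> ?R")
proof
  assume "adj (u # ws) x y"
  then obtain i where i: "i < Suc (length ws)"
    and e: "{x, y} = {(u # ws) ! i, (u # ws) ! (Suc i mod Suc (length ws))}" by (auto simp: adj_def)
  show ?R
  proof (cases i)
    case 0
    then show ?thesis using e assms by (auto simp: hd_conv_nth)
  next
    case (Suc j)
    show ?thesis
    proof (cases "Suc j = length ws")
      case True
      then have "ws ! j = last ws" using assms by (metis diff_Suc_1 last_conv_nth)
      moreover have "Suc i mod Suc (length ws) = 0" using Suc True by simp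
      moreover have "(u # ws) ! i = ws ! j" using Suc by simp
      ultimately show ?thesis using e by simp
    next
      case False
      then have "Suc j < length ws" using i Suc by simp
      moreover from this have "{x, y} = {ws ! j, ws ! Suc j}" using e Suc by simp
      ultimately show ?thesis by blast
    qed
  qed
next
  assume ?R
  then consider "{x, y} = {u, hd ws}" | "{x, y} = {last ws, u}" | j where "Suc j < length ws" "{x, y} = {ws ! j, ws ! Suc j}"
    by blast
  then show "adj (u # ws) x y"
  proof cases
    case 1
    then show ?thesis unfolding adj_def using assms by (intro exI[of _ 0]) (auto simp: hd_conv_nth)
  next
    case 2
    then show ?thesis unfolding adj_def using assms
      by (intro exI[of _ "length ws"]) (auto simp: last_conv_nth nth_Cons')
  next
    case 3
    then show ?thesis unfolding adj_def by (intro exI[of _ "Suc j"]) auto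
  qed
qed


section \<open>Perfect matchings of the cubic graph as involutions\<close>

text \<open>The circuit is \<open>V\<close>, with edges given by \<open>h\<close>, \<open>g\<close> and the two pairs \<open>{u, p1}\<close>, \<open>{u, p2}\<close>. The fixed
  points \<open>u, b, c\<close> of \<open>T\<close> are the neighbours of the deleted vertex.\<close>

locale arcs =
  fixes V :: "'a set" and u b c p1 p2 :: 'a and h g T :: "'a \<Rightarrow> 'a"
  assumes finV: "finite V" and inV: "{u, b, c, p1, p2} \<subseteq> V"
    and dist: "distinct [u, b, c]" "distinct [u, p1, p2]"
    and invh: "involution_on V h" and fixh: "x \<in> V \<Longrightarrow> h x = x \<longleftrightarrow> x = u"
    and invg: "involution_on V g" and fixg: "x \<in> V \<Longrightarrow> g x = x \<longleftrightarrow> x \<in> {u, p1, p2}"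
    and invT: "involution_on V T" and fixT: "x \<in> V \<Longrightarrow> T x = x \<longleftrightarrow> x \<in> {u, b, c}"
    and conn: "C \<subseteq> V \<Longrightarrow> p1 \<in> C \<Longrightarrow> (\<And>x. x \<in> C \<Longrightarrow> h x \<in> C \<and> g x \<in> C) \<Longrightarrow> V - {u} \<subseteq> C"
begin

text \<open>A perfect matching of the graph is encoded by the involution \<open>\<rho>\<close> that swaps the ends of its
  edges on the circuit and fixes the vertices covered by edges outside the circuit.\<close>

definition pm :: "('a \<Rightarrow> 'a) \<Rightarrow> bool" where
  "pm \<rho> \<longleftrightarrow> involution_on V \<rho> \<and>
     (\<forall>x\<in>V. \<rho> x = x \<or> \<rho> x = h x \<or> \<rho> x = g x \<or> {x, \<rho> x} = {u, p1} \<or> {x, \<rho> x} = {u, p2}) \<and>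
     (\<exists>s. {x \<in> {u, b, c}. \<rho> x = x} = {s}) \<and> (\<forall>x\<in>V. \<rho> x = x \<longrightarrow> \<rho> (T x) = T x)"

definition pm_cover :: "('a \<Rightarrow> 'a) list \<Rightarrow> bool" where
  "pm_cover Ms \<longleftrightarrow> (\<forall>\<rho>\<in>set Ms. pm \<rho>) \<and> (\<forall>x\<in>V - {u}. \<exists>\<rho>\<in>set Ms. \<rho> x = h x) \<and>
     (\<forall>x\<in>V - {u, p1, p2}. \<exists>\<rho>\<in>set Ms. \<rho> x = g x) \<and> (\<exists>\<rho>\<in>set Ms. \<rho> u = p1) \<and>
     (\<exists>\<rho>\<in>set Ms. \<rho> u = p2) \<and> (\<forall>x\<in>V. \<exists>\<rho>\<in>set Ms. \<rho> x = x)"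

text \<open>A vertex is covered by \<open>h\<close> on \<open>H\<close>, by its edge off the circuit
  on \<open>F\<close>, by the edge between \<open>u\<close> and \<open>w\<close>, and by
  \<open>g\<close> elsewhere. The value \<open>w = u\<close> stands for no circuit edge at
  \<open>u\<close>; then \<open>u\<close> belongs in \<open>F\<close>.\<close>

definition glue :: "'a set \<Rightarrow> 'a set \<Rightarrow> 'a \<Rightarrow> 'a \<Rightarrow> 'a" where
  "glue H F w x = (if x \<in> H then h x else if x \<in> F then x else if x = u then w
     else if x = w then u else g x)"

lemma V_h: "x \<in> V \<Longrightarrow> h x \<in> V" "x \<in> V \<Longrightarrow> h (h x) = x"
  and V_g: "x \<in> V \<Longrightarrow> g x \<in> V" "x \<in> V \<Longrightarrow> g (g x) = x"
  and V_T: "x \<in> V \<Longrightarrow> T x \<in> V" "x \<in> V \<Longrightarrow> T (T x) = x"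
  using invh invg invT by (auto simp: involution_on_def)

lemma fixed_points: "h u = u" "g u = u" "g p1 = p1" "g p2 = p2" "T u = u" "T b = b" "T c = c"
  using fixh fixg fixT inV by auto

lemma u_only: "x \<in> V \<Longrightarrow> h x = u \<longleftrightarrow> x = u" "x \<in> V \<Longrightarrow> g x = u \<longleftrightarrow> x = u" "x \<in> V \<Longrightarrow> T x = u \<longleftrightarrow> x = u"
  using V_h V_g V_T fixed_points by metis+

text \<open>The last hypothesis concerns the vertices left to \<open>g\<close>: they must be closed
  under it and contain none of its fixed points.\<close>

lemma pm_glue:
  assumes H: "H \<subseteq> V - {u}" "\<And>x. x \<in> H \<Longrightarrow> h x \<in> H"
    and F: "F \<subseteq> V" "\<And>x. x \<in> F \<Longrightarrow> T x \<in> F" "H \<inter> F = {}" "F \<inter> {u, b, c} = {s}"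
    and w: "w \<in> {u, p1, p2}" "w \<notin> H" "w = u \<Longrightarrow> u \<in> F" "w \<noteq> u \<Longrightarrow> u \<notin> F \<and> w \<notin> F"
    and R: "\<And>x. x \<in> V \<Longrightarrow> x \<notin> H \<union> F \<union> {u, w} \<Longrightarrow> g x \<notin> H \<union> F \<union> {u, w} \<and> x \<notin> {p1, p2}"
  shows "pm (glue H F w)"
proof -
  let ?r = "glue H F w"
  have wV: "w \<in> V" using w inV by auto
  have fx: "?r x = x \<longleftrightarrow> x \<in> F" if x: "x \<in> V" for x
    using x F(3) fixh[of x] fixg[of x] H(1) w R[of x] by (auto simp: glue_def)
  have "?r x \<in> V \<and> ?r (?r x) = x" if x: "x \<in> V" for x
  proof -
    consider "x \<in> H" | "x \<in> F" "x \<notin> H" | "x \<notin> H" "x \<notin> F" "x = u" | "x \<notin> H" "x \<notin> F" "x = w" "x \<noteq> u"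
      | "x \<notin> H \<union> F \<union> {u, w}" by blast
    then show ?thesis
    proof cases
      case 3
      then have "w \<noteq> u" "w \<notin> F" using w by auto
      then show ?thesis using 3 w H(1) wV inV by (auto simp: glue_def)
    next
      case 4
      then show ?thesis using w H(1) wV inV by (auto simp: glue_def)
    next
      case 5
      then show ?thesis using R[OF x 5] V_g[OF x] by (auto simp: glue_def)
    qed (use H x V_h in \<open>auto simp: glue_def\<close>)
  qed
  then have "involution_on V ?r" by (simp add: involution_on_def)
  moreover have "?r x = x \<or> ?r x = h x \<or> ?r x = g x \<or> {x, ?r x} = {u, p1} \<or> {x, ?r x} = {u, p2}" if "x \<in> V" for x
    using w(1) by (auto simp: glue_def)
  moreover have "{x \<in> {u, b, c}. ?r x = x} = F \<inter> {u, b, c}" using fx inV by auto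
  then have "{x \<in> {u, b, c}. ?r x = x} = {s}" using F(4) by simp
  moreover have "\<forall>x\<in>V. ?r x = x \<longrightarrow> ?r (T x) = T x" using fx F(2) V_T by simp
  ultimately show ?thesis unfolding pm_def by blast
qed

lemma pm_h: "pm (glue (V - {u}) {u} u)"
  by (rule pm_glue[where s = u]) (use dist inV V_h u_only fixed_points in auto)

text \<open>The assumption \<open>conn\<close> says that \<open>h\<close> and \<open>g\<close> form
  a single path off \<open>u\<close>. It holds from the other end as well, since the complement of a
  closed set is closed.\<close>

lemma arcs_swap: "arcs V u b c p2 p1 h g T"
proof
  show "V - {u} \<subseteq> C" if C: "C \<subseteq> V" "p2 \<in> C" "\<And>x. x \<in> C \<Longrightarrow> h x \<in> C \<and> g x \<in> C" for C
  proof (cases "p1 \<in> C")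
    case True
    then show ?thesis using conn C by blast
  next
    case False
    have "V - {u} \<subseteq> V - C"
    proof (rule conn)
      fix x assume x: "x \<in> V - C"
      then have "h x \<notin> C" "g x \<notin> C" using C(3) V_h V_g by (metis DiffE)+
      then show "h x \<in> V - C \<and> g x \<in> V - C" using x V_h V_g by auto
    qed (use False inV in auto)
    then show ?thesis using C(2) dist inV by auto
  qed
qed (use finV inV dist invh fixh invg fixg invT fixT in auto)

text \<open>The path contains \<open>b\<close> and \<open>p1\<close> but neither \<open>c\<close>
  nor \<open>p2\<close>. One matching takes \<open>T\<close> on the path, \<open>g\<close> off it
  and the edge from \<open>u\<close> to \<open>p2\<close>; the other exchanges the roles and uses
  \<open>p1\<close>. Their edges at the deleted vertex go to \<open>b\<close> and \<open>c\<close>.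
  Repetitions of the matching \<open>h\<close> fill the list up to five.\<close>

lemma cover_linked:
  assumes ws: "alt_path g T b ws" "set ws \<subseteq> V - {u}" "last ws = p1"
  shows "\<exists>Ms. length Ms = 5 \<and> pm_cover Ms"
proof -
  let ?S = "set ws"
  have SV: "x \<in> ?S \<Longrightarrow> x \<in> V" "u \<notin> ?S" for x using ws(2) by auto
  have p1S: "p1 \<in> ?S" "b \<in> ?S" using alt_path_ends[OF ws(1)] ws(3) by auto
  have cS: "c \<notin> ?S"
  proof
    assume c: "c \<in> ?S"
    show False
    proof (cases "c = p1")
      case True
      then show False using alt_path_last_fixed(1)[OF ws(1)] ws(3) dist fixed_points by auto
    next
      case False
      then show False using alt_path_moves(2)[OF ws(1) c] ws(3) dist fixed_points by auto
    qed
  qed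
  have p2S: "p2 \<notin> ?S"
  proof
    assume p: "p2 \<in> ?S"
    then show False
      using alt_path_moves(2,3)[OF ws(1) p] ws(3) dist fixed_points by (cases "p2 = b") auto
  qed
  have cl: "x \<in> V \<Longrightarrow> g x \<in> ?S \<longleftrightarrow> x \<in> ?S" "x \<in> V \<Longrightarrow> T x \<in> ?S \<longleftrightarrow> x \<in> ?S" for x
    using alt_path_closed(1,2)[OF ws(1)] V_g V_T by metis+
  have gp: "x \<in> V \<Longrightarrow> g x = p2 \<longleftrightarrow> x = p2" "x \<in> V \<Longrightarrow> g x = p1 \<longleftrightarrow> x = p1" for x
    using V_g fixed_points by metis+
  have A: "pm (glue {} ?S p2)"
    by (rule pm_glue[where s = b]) (use SV p1S cS p2S cl gp dist inV u_only in auto)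
  have B: "pm (glue {} (V - {u} - ?S) p1)"
    by (rule pm_glue[where s = c]) (use SV p1S cS p2S cl gp dist inV u_only V_T in auto)
  let ?Ms = "[glue (V - {u}) {u} u, glue {} ?S p2, glue {} (V - {u} - ?S) p1,
    glue (V - {u}) {u} u, glue (V - {u}) {u} u]"
  have "pm_cover ?Ms"
    unfolding pm_cover_def using A B pm_h SV p1S p2S dist by (auto simp: glue_def)
  then show ?thesis by (intro exI[of _ ?Ms]) simp
qed

end


section \<open>Two odd circuits and the even circuits\<close>

text \<open>The case in which the path from \<open>b\<close> ends in \<open>c\<close>. In the list \<open>ys = u # ws\<close> below the vertex \<open>u\<close>
  stands for the deleted vertex of the graph, whereas the circle through \<open>B\<close> contains the real \<open>u\<close>.\<close>

locale separated = arcs +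
  fixes ws ls :: "'a list"
  assumes ws: "alt_path g T b ws" "set ws \<subseteq> V - {u}" "last ws = c"
    and ls: "alt_path T g p1 ls" "set ls \<subseteq> V - {u} - set ws"
begin

text \<open>The odd circuits without the deleted vertex and without \<open>u\<close>, respectively,
  and the vertices of the even circuits.\<close>

definition "A = set ws"
definition "B = set ls"
definition "K = V - {u} - A - B"

lemma A_V: "A \<subseteq> V - {u}" and B_V: "B \<subseteq> V - {u} - A" and K_V: "K \<subseteq> V - {u}"
  using ws ls by (auto simp: A_def B_def K_def)

lemma V_cases: "x \<in> V \<Longrightarrow> x = u \<or> x \<in> A \<or> x \<in> B \<or> x \<in> K"
  by (auto simp: K_def)

lemma A_closed: "x \<in> V \<Longrightarrow> g x \<in> A \<longleftrightarrow> x \<in> A" "x \<in> V \<Longrightarrow> T x \<in> A \<longleftrightarrow> x \<in> A"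
  unfolding A_def using alt_path_closed(1,2)[OF ws(1)] V_g V_T by metis+

lemma B_closed: "x \<in> V \<Longrightarrow> g x \<in> B \<longleftrightarrow> x \<in> B" "x \<in> V \<Longrightarrow> T x \<in> B \<longleftrightarrow> x \<in> B"
  unfolding B_def using alt_path_closed(1,2)[OF ls(1)] V_g V_T by metis+

lemma K_closed: "x \<in> K \<Longrightarrow> g x \<in> K"
  using A_closed B_closed V_g u_only by (auto simp: K_def)

lemma bc_A: "b \<in> A" "c \<in> A"
  using alt_path_ends[OF ws(1)] ws(3) by (auto simp: A_def)

lemma p_A: "p1 \<notin> A" "p2 \<notin> A"
proof -
  have "p \<notin> A" if p: "p \<in> V" "g p = p" for p
  proof
    assume pA: "p \<in> A"
    have "c \<noteq> b" using dist by auto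
    then show False
      using alt_path_moves(2,3)[OF ws(1), of p] alt_path_last_fixed(1)[OF ws(1)] pA p ws(3) fixed_points
      unfolding A_def by (cases "p = c"; cases "p = b") auto
  qed
  then show "p1 \<notin> A" "p2 \<notin> A" using inV fixed_points by auto
qed

lemma ws_even: "even (length ws)" "2 \<le> length ws"
proof -
  have "last ws \<noteq> b" using ws(3) dist by auto
  then show e: "even (length ws)" using alt_path_last_fixed(2)[OF ws(1)] ws(3) fixed_points by simp
  show "2 \<le> length ws" using e alt_path_pos[OF ws(1)] by (cases "length ws"; cases "length ws - 1") auto
qed

lemma B_moves: "x \<in> B \<Longrightarrow> T x \<noteq> x"
  using B_V fixT[of x] bc_A by auto

text \<open>All fixed points of \<open>T\<close> other than \<open>u\<close> lie in
  \<open>A\<close>, so the path from \<open>p1\<close> can only stop at a fixed point of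
  \<open>g\<close>, and only \<open>p2\<close> remains.\<close>

lemma ls_last: "last ls = p2" "even (length ls)" and p_B: "p1 \<in> B" "p2 \<in> B"
proof -
  show p1: "p1 \<in> B" using alt_path_ends[OF ls(1)] by (simp add: B_def)
  have lB: "last ls \<in> B" using alt_path_ends[OF ls(1)] by (simp add: B_def)
  have np: "last ls \<noteq> p1" using alt_path_fixed_p[OF ls(1)] B_moves p1 by blast
  then have "g (last ls) = last ls" using alt_path_last_fixed(1)[OF ls(1)] B_moves lB by blast
  then show l: "last ls = p2" using fixg[of "last ls"] lB B_V np by auto
  show "p2 \<in> B" using lB l by simp
  show "even (length ls)" using alt_path_last_fixed(2)[OF ls(1) np] l fixed_points by simp
qed

section \<open>Links: chords and spokes formed by alternating paths\<close>

text \<open>The \<open>h\<close>-edges are joined through the circuits in \<open>K\<close> to paths between vertices of the two odd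
  circles. A matching that does not use such a path takes \<open>g\<close> on its interior.\<close>

definition "gK x = (if x \<in> K then g x else x)"

lemma inv_off_u: "involution_on (V - {u}) h" "involution_on (V - {u}) gK"
    "involution_on (V - {u}) (\<lambda>x. if x \<in> A then x else g x)"
  using V_h V_g u_only K_closed A_closed by (auto simp: involution_on_def gK_def)

lemma gK_fixed: "x \<in> V - {u} \<Longrightarrow> gK x = x \<longleftrightarrow> x \<notin> K"
  using fixg[of x] p_B by (auto simp: gK_def K_def)

lemma h_moves: "x \<in> V - {u} \<Longrightarrow> h x \<noteq> x"
  using fixh by auto

definition "linkpath x = (SOME rs. alt_path h gK x rs \<and> set rs \<subseteq> V - {u})"
definition "link x = set (linkpath x)"
definition "other_end x = last (linkpath x)"

lemma linkpath:
  assumes "x \<in> A \<union> B" shows "alt_path h gK x (linkpath x)" "set (linkpath x) \<subseteq> V - {u}"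
proof -
  have "x \<in> V - {u}" "x \<notin> K" using assms A_V B_V by (auto simp: K_def)
  then obtain rs where "alt_path h gK x rs" "set rs \<subseteq> V - {u}"
    using alt_path_exists[of "V - {u}" x gK h] finV inv_off_u gK_fixed by (metis finite_Diff)
  then have "alt_path h gK x (linkpath x) \<and> set (linkpath x) \<subseteq> V - {u}"
    unfolding linkpath_def by (intro someI[of "\<lambda>rs. alt_path h gK x rs \<and> set rs \<subseteq> V - {u}"]) simp
  then show "alt_path h gK x (linkpath x)" "set (linkpath x) \<subseteq> V - {u}" by simp_all
qed

lemma link_closed: "x \<in> A \<union> B \<Longrightarrow> y \<in> link x \<Longrightarrow> h y \<in> link x \<and> gK y \<in> link x"
  using alt_path_closed(1,2)[OF linkpath(1)] by (simp add: link_def)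

lemma link_V: "x \<in> A \<union> B \<Longrightarrow> link x \<subseteq> V - {u}"
  using linkpath(2) by (simp add: link_def)

lemma link_least:
  assumes "x \<in> A \<union> B" "x \<in> C" "\<And>y. y \<in> C \<Longrightarrow> h y \<in> C \<and> gK y \<in> C"
  shows "link x \<subseteq> C"
  unfolding link_def using alt_path_least[OF linkpath(1)[OF assms(1)] assms(2)] assms(3) by blast

lemma other_end_neq: "x \<in> A \<union> B \<Longrightarrow> other_end x \<noteq> x"
  using alt_path_fixed_p[OF linkpath(1)] h_moves A_V B_V unfolding other_end_def by blast

text \<open>\<open>gK\<close> is the identity off \<open>K\<close>, so inner vertices of a link lie
  in \<open>K\<close>. As \<open>h\<close> moves every vertex, the far end is a fixed point of
  \<open>gK\<close> and hence not in \<open>K\<close>.\<close>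

lemma link_ends:
  assumes x: "x \<in> A \<union> B"
  shows "link x \<inter> (A \<union> B) = {x, other_end x}" and "other_end x \<in> A \<union> B"
proof -
  note lp = linkpath[OF x]
  have e: "x \<in> link x" "other_end x \<in> link x"
    using alt_path_ends[OF lp(1)] by (auto simp: link_def other_end_def)
  then have eV: "other_end x \<in> V - {u}" using link_V[OF x] by blast
  have "gK (other_end x) = other_end x"
    using alt_path_last_fixed(1)[OF lp(1)] other_end_neq[OF x] h_moves[OF eV] by (simp add: other_end_def)
  then have "other_end x \<notin> K" using gK_fixed[OF eV] by simp
  then show o: "other_end x \<in> A \<union> B" using eV by (auto simp: K_def)
  have "y \<in> K" if y: "y \<in> link x" "y \<noteq> x" "y \<noteq> other_end x" for y
  proof -
    have "gK y \<noteq> y" using alt_path_moves(2)[OF lp(1), of y] y by (simp add: link_def other_end_def)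
    then show ?thesis by (auto simp: gK_def split: if_splits)
  qed
  then show "link x \<inter> (A \<union> B) = {x, other_end x}" using e x o by (auto simp: K_def)
qed

text \<open>The link of the far end is contained in the given link, by minimality, and therefore has
  the same two ends.\<close>

lemma other_end_other_end:
  assumes x: "x \<in> A \<union> B" shows "other_end (other_end x) = x"
proof -
  let ?y = "other_end x"
  have y: "?y \<in> A \<union> B" "?y \<in> link x" using link_ends[OF x] by auto
  have "link ?y \<subseteq> link x" using link_least[OF y(1,2)] link_closed[OF x] by blast
  moreover have "other_end ?y \<in> link ?y" "other_end ?y \<in> A \<union> B" using link_ends[OF y(1)] by auto
  ultimately have "other_end ?y \<in> {x, ?y}" using link_ends(1)[OF x] by blast
  then show ?thesis using other_end_neq[OF y(1)] by auto
qed

section \<open>The two prescribed spokes\<close>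

text \<open>The path of \<open>h \<union> g\<close> from an end \<open>q\<close> of the other path to its first vertex in \<open>A\<close>.\<close>

definition side :: "'a \<Rightarrow> 'a set \<Rightarrow> 'a \<Rightarrow> bool" where
  "side q S l \<longleftrightarrow> S \<subseteq> V - {u} \<and> q \<in> S \<and> S \<inter> A = {l} \<and> (\<forall>x\<in>S. h x \<in> S) \<and> (\<forall>x\<in>S - A. g x \<in> S) \<and>
     S \<inter> {p1, p2} = {q} \<and> (\<forall>C. q \<in> C \<longrightarrow> (\<forall>x\<in>C. h x \<in> C \<and> (x \<notin> A \<longrightarrow> g x \<in> C)) \<longrightarrow> S \<subseteq> C)"

lemma side_exists:
  assumes q: "q \<in> {p1, p2}" shows "\<exists>S l. side q S l"
proof -
  \<comment> \<open>Fixing all of \<open>A\<close> makes the walk stop at its first vertex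
    there.\<close>
  let ?g = "\<lambda>x. if x \<in> A then x else g x"
  have qV: "q \<in> V - {u}" "q \<notin> A" "g q = q" using q inV dist p_A fixed_points by auto
  obtain ss where ss: "alt_path h ?g q ss" "set ss \<subseteq> V - {u}"
    using alt_path_exists[of "V - {u}" q ?g h] finV inv_off_u qV by (metis finite_Diff)
  let ?S = "set ss"
  note cl = alt_path_closed(1,2)[OF ss(1)]
  have lS: "last ss \<in> ?S" "q \<in> ?S" using alt_path_ends[OF ss(1)] by auto
  have lq: "last ss \<noteq> q" using alt_path_fixed_p[OF ss(1)] h_moves qV(1) by blast
  have "?g (last ss) = last ss"
    using alt_path_last_fixed(1)[OF ss(1) lq] h_moves lS ss(2) by blast
  have inner: "?g x \<noteq> x" if "x \<in> ?S" "x \<noteq> q" "x \<noteq> last ss" for x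
    using alt_path_moves(2)[OF ss(1) that(1,3,2)] by simp
  \<comment> \<open>A path that missed \<open>A\<close> would be closed under \<open>h\<close> and
    \<open>g\<close>; by \<open>conn\<close> it would contain everything but \<open>u\<close>, in
    particular \<open>b\<close>.\<close>
  have lA: "last ss \<in> A"
  proof (rule ccontr)
    assume n: "last ss \<notin> A"
    have "?S \<inter> A = {}" using inner n qV(2) by fastforce
    then have "h x \<in> ?S \<and> g x \<in> ?S" if "x \<in> ?S" for x using cl[of x] that by (auto split: if_splits)
    then have "V - {u} \<subseteq> ?S"
      using conn[of ?S] arcs.conn[OF arcs_swap, of ?S] lS(2) q ss(2) by blast
    then show False using \<open>?S \<inter> A = {}\<close> bc_A A_V by blast
  qed
  have "?S \<inter> A = {last ss}" using inner lA lS qV(2) by fastforce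
  moreover have "x \<notin> ?S" if "x \<in> {p1, p2}" "x \<noteq> q" for x
    using inner[of x] that fixed_points p_A lA by (cases "x = last ss") (auto split: if_splits)
  then have "?S \<inter> {p1, p2} = {q}" using q lS by auto
  moreover have "?S \<subseteq> C" if "q \<in> C" "\<forall>x\<in>C. h x \<in> C \<and> (x \<notin> A \<longrightarrow> g x \<in> C)" for C
    by (rule alt_path_least[OF ss(1) that(1)]) (use that(2) in auto)
  moreover have "\<forall>x\<in>?S. h x \<in> ?S" using cl(1) by blast
  moreover have "g x \<in> ?S" if "x \<in> ?S - A" for x using cl(2)[of x] that by simp
  ultimately have "side q ?S (last ss)" unfolding side_def using ss(2) lS(2) by blast
  then show ?thesis by blast
qed

lemma side_gK: "side q S l \<Longrightarrow> x \<in> S \<Longrightarrow> gK x \<in> S"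
  by (auto simp: side_def gK_def K_def)

text \<open>Off \<open>A\<close> neither \<open>h\<close> nor \<open>g\<close> leads into
  \<open>S'\<close> from outside, and \<open>h\<close> never does. So \<open>S - S'\<close> has the
  closure properties for which \<open>S\<close> is minimal, and it contains
  \<open>p1\<close>.\<close>

lemma side_disjoint:
  assumes "side p1 S l" "side p2 S' l'" shows "S \<inter> S' = {}"
proof -
  let ?C = "S - S'"
  have "p1 \<notin> S'" using assms(2) dist by (auto simp: side_def)
  then have "p1 \<in> ?C" using assms(1) by (auto simp: side_def)
  moreover have "h x \<in> ?C \<and> (x \<notin> A \<longrightarrow> g x \<in> ?C)" if x: "x \<in> ?C" for x
  proof -
    have xV: "x \<in> V" using x assms(1) by (auto simp: side_def)
    have "h x \<notin> S'" using x assms(2) V_h(2)[OF xV] unfolding side_def by (metis DiffD2)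
    moreover have "x \<notin> A \<Longrightarrow> g x \<notin> S'"
      using x assms(2) V_g[OF xV] A_closed(1)[OF xV] unfolding side_def by (metis DiffD2 DiffI)
    ultimately show ?thesis using x assms(1) unfolding side_def by blast
  qed
  moreover have "S \<subseteq> C" if "p1 \<in> C" "\<forall>x\<in>C. h x \<in> C \<and> (x \<notin> A \<longrightarrow> g x \<in> C)" for C
    using assms(1) that unfolding side_def by simp
  ultimately have "S \<subseteq> ?C" by simp
  then show ?thesis by blast
qed

text \<open>The link of \<open>l\<close> runs back inside \<open>S\<close>, where \<open>l\<close>
  is the only vertex of \<open>A\<close>; its other end must be in \<open>B\<close>.\<close>

lemma side_spoke:
  assumes "side q S l" shows "l \<in> A" "other_end l \<in> B"
proof -
  show l: "l \<in> A" using assms by (auto simp: side_def)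
  have "h y \<in> S \<and> gK y \<in> S" if "y \<in> S" for y
    using side_gK[OF assms that] assms that by (simp add: side_def)
  moreover have "l \<in> S" using assms by (auto simp: side_def)
  ultimately have "link l \<subseteq> S" using link_least l by blast
  moreover have "other_end l \<in> link l" "other_end l \<in> A \<union> B" "other_end l \<noteq> l"
    using link_ends[of l] other_end_neq[of l] l by auto
  ultimately show "other_end l \<in> B" using assms by (auto simp: side_def)
qed

section \<open>The circle through the deleted vertex\<close>

definition "ys = u # ws"
definition "D = {x \<in> A. other_end x \<in> A}"

lemma adj_ys: "adj ys x y \<longleftrightarrow> {x, y} = {u, b} \<or> {x, y} = {c, u} \<or>
    (\<exists>j. Suc j < length ws \<and> {x, y} = {ws ! j, ws ! Suc j})"
proof -
  have "ws \<noteq> []" "hd ws = b" using ws(1) by (auto simp: alt_path_def hd_conv_nth)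
  then show ?thesis unfolding ys_def using adj_Cons ws(3) by metis
qed

lemma adj_A: "adj ys x y \<Longrightarrow> x \<in> A \<Longrightarrow> y \<in> A \<Longrightarrow> y = g x \<or> y = T x"
proof -
  assume a: "adj ys x y" "x \<in> A" "y \<in> A"
  then have "x \<noteq> u" "y \<noteq> u" using A_V by auto
  then have "{x, y} \<noteq> {u, b}" "{x, y} \<noteq> {c, u}" by (auto simp: doubleton_eq_iff)
  then obtain j where j: "Suc j < length ws" "{x, y} = {ws ! j, ws ! Suc j}"
    using a(1) unfolding adj_ys by blast
  then show "y = g x \<or> y = T x"
    using alt_path_up[OF ws(1) j(1)] by (cases "even j") (auto simp: doubleton_eq_iff)
qed

lemma adj_u: "adj ys x u \<Longrightarrow> x \<in> A \<Longrightarrow> x = b \<or> x = c"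
proof -
  assume a: "adj ys x u" "x \<in> A"
  have n: "ws ! j \<noteq> u" if "j < length ws" for j using that ws(2) nth_mem by blast
  have "u \<notin> {ws ! j, ws ! Suc j}" if "Suc j < length ws" for j using that n[of j] n[of "Suc j"] by auto
  then have "{x, u} \<noteq> {ws ! j, ws ! Suc j}" if "Suc j < length ws" for j using that by blast
  then show "x = b \<or> x = c" using a A_V unfolding adj_ys by (auto simp: doubleton_eq_iff)
qed

text \<open>The circle edge at \<open>x\<close> other than \<open>g\<close> leads to
  \<open>T x\<close> or, at \<open>b\<close> and \<open>c\<close>, to the deleted vertex. In both
  cases it is the edge of the graph off the Hamiltonian circuit.\<close>

lemma adj_g: "x \<in> A \<Longrightarrow> adj ys x (g x)" and adj_not_g: "x \<in> A \<Longrightarrow> \<exists>y. adj ys x y \<and> y \<noteq> g x"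
proof -
  assume x: "x \<in> A"
  then obtain i where i: "i < length ws" "x = ws ! i" by (auto simp: A_def in_set_conv_nth)
  have gu: "g x \<noteq> u" using x A_V u_only by auto
  have cyc: "adj ys (ws ! j) (ws ! Suc j)" "adj ys (ws ! Suc j) (ws ! j)" if "Suc j < length ws" for j
    unfolding adj_ys using that by (auto simp: insert_commute)
  show "adj ys x (g x)"
  proof (cases "even i")
    case True
    then have "Suc i < length ws" using i ws_even(1) by (metis Suc_lessI even_Suc)
    then show ?thesis using alt_path_up(1)[OF ws(1), of i] True cyc i by simp
  next
    case False
    then obtain j where "i = Suc j" "even j" by (cases i) auto
    then show ?thesis using alt_path_up(2)[OF ws(1), of j] cyc i by simp
  qed
  show "\<exists>y. adj ys x y \<and> y \<noteq> g x"
  proof (cases "even i")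
    case True
    have n: "Suc i < length ws" using True i ws_even(1) by (metis Suc_lessI even_Suc)
    show ?thesis
    proof (cases i)
      case 0
      then have "x = b" using i ws(1) by (simp add: alt_path_def)
      then have "adj ys x u" by (auto simp: adj_ys insert_commute)
      then show ?thesis using gu by blast
    next
      case (Suc j)
      then have "ws ! j \<noteq> ws ! Suc i" using alt_path_inj[OF ws(1), of j "Suc i"] n by auto
      moreover have "g x = ws ! Suc i" using alt_path_up(1)[OF ws(1) n] True i by simp
      moreover have "adj ys x (ws ! j)" using cyc[of j] Suc i by simp
      ultimately show ?thesis by metis
    qed
  next
    case False
    then obtain j where j: "i = Suc j" "even j" by (cases i) auto
    then have gx: "g x = ws ! j" using alt_path_up(2)[OF ws(1), of j] i by simp
    show ?thesis
    proof (cases "Suc i < length ws")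
      case True
      then have "ws ! j \<noteq> ws ! Suc i" using alt_path_inj[OF ws(1), of j "Suc i"] j by auto
      then show ?thesis using cyc[OF True] gx i by metis
    next
      case False
      then have "i = length ws - 1" using i by simp
      then have "x = c" using i ws(3) alt_path_last[OF ws(1)] by simp
      then have "adj ys x u" by (auto simp: adj_ys)
      then show ?thesis using gu by blast
    qed
  qed
qed

text \<open>The vertices that the perfect matching will cover by their edge off the Hamiltonian
  circuit, that is, by \<open>T\<close> or by the edge to the deleted vertex.\<close>

definition "tpart W \<sigma> = {x \<in> A - W. \<sigma> x \<noteq> g x}"

lemma spoke_involutionD:
  assumes "spoke_involution ys other_end D s W \<sigma>"
  obtains U where "U \<subseteq> D" "tclosed other_end U" "W = insert s U"
    and "\<And>x. x \<in> set ys - W \<Longrightarrow> \<sigma> x \<in> set ys - W \<and> \<sigma> x \<noteq> x \<and> \<sigma> (\<sigma> x) = x \<and> adj ys x (\<sigma> x)"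
proof -
  obtain U where "U \<subseteq> D" "tclosed other_end U" "W = insert s U"
    using assms unfolding spoke_involution_def by blast
  moreover have "\<sigma> x \<in> set ys - W \<and> \<sigma> x \<noteq> x \<and> \<sigma> (\<sigma> x) = x \<and> adj ys x (\<sigma> x)"
    if x: "x \<in> set ys - W" for x
    using assms x unfolding spoke_involution_def tclosed_def by blast
  ultimately show thesis by (rule that)
qed

lemma set_ys: "set ys = insert u A"
  by (simp add: ys_def A_def)

lemma tpart_T:
  assumes si: "spoke_involution ys other_end D s W \<sigma>" and x: "x \<in> tpart W \<sigma>"
  shows "T x \<in> tpart W \<sigma>"
proof -
  obtain U where U: "U \<subseteq> D" "tclosed other_end U" "W = insert s U"
    and i: "\<And>x. x \<in> set ys - W \<Longrightarrow> \<sigma> x \<in> set ys - W \<and> \<sigma> x \<noteq> x \<and> \<sigma> (\<sigma> x) = x \<and> adj ys x (\<sigma> x)"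
    by (rule spoke_involutionD[OF si]) blast
  have xx: "x \<in> A" "x \<notin> W" "\<sigma> x \<noteq> g x" using x by (auto simp: tpart_def)
  have s: "\<sigma> x \<in> set ys - W" "\<sigma> x \<noteq> x" "\<sigma> (\<sigma> x) = x" "adj ys x (\<sigma> x)" using i[of x] xx by (auto simp: set_ys)
  show ?thesis
  proof (cases "\<sigma> x = u")
    case True
    then have "x = b \<or> x = c" using adj_u s xx by simp
    then have "T x = x" using fixed_points by auto
    then show ?thesis using x by simp
  next
    case False
    then have sA: "\<sigma> x \<in> A" using s by (auto simp: set_ys)
    then have "\<sigma> x = T x" using adj_A[OF s(4) xx(1)] xx(3) by blast
    moreover have "\<sigma> (\<sigma> x) \<noteq> g (\<sigma> x)" using s(3) xx(3) V_g(2) sA A_V by (metis Diff_iff subsetD)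
    ultimately show ?thesis using sA s(1) by (auto simp: tpart_def)
  qed
qed

text \<open>This determines the edge at the deleted vertex: if that vertex is the spoke, neither the
  edge to \<open>b\<close> nor that to \<open>c\<close> is used; otherwise exactly one of them
  is.\<close>

lemma tpart_bc:
  assumes si: "spoke_involution ys other_end D s W \<sigma>" and sA: "s \<in> A \<union> {u}"
  shows "s = u \<Longrightarrow> tpart W \<sigma> \<inter> {b, c} = {}" "s \<noteq> u \<Longrightarrow> \<exists>t. tpart W \<sigma> \<inter> {b, c} = {t}"
proof -
  obtain U where U: "U \<subseteq> D" "tclosed other_end U" "W = insert s U"
    and i: "\<And>x. x \<in> set ys - W \<Longrightarrow> \<sigma> x \<in> set ys - W \<and> \<sigma> x \<noteq> x \<and> \<sigma> (\<sigma> x) = x \<and> adj ys x (\<sigma> x)"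
    by (rule spoke_involutionD[OF si]) blast
  have uU: "u \<notin> U" using U(1) A_V by (auto simp: D_def)
  have key: "x \<in> tpart W \<sigma> \<longleftrightarrow> x \<notin> W \<and> \<sigma> x = u" if x: "x \<in> {b, c}" for x
  proof
    assume xt: "x \<in> tpart W \<sigma>"
    then have xx: "x \<in> A" "x \<notin> W" "\<sigma> x \<noteq> g x" by (auto simp: tpart_def)
    have s: "\<sigma> x \<in> set ys - W" "\<sigma> x \<noteq> x" "adj ys x (\<sigma> x)" using i[of x] xx by (auto simp: set_ys)
    have "\<sigma> x \<notin> A" using adj_A[OF s(3) xx(1)] xx(3) s(2) x fixed_points by auto
    then show "x \<notin> W \<and> \<sigma> x = u" using s(1) xx by (auto simp: set_ys)
  next
    assume "x \<notin> W \<and> \<sigma> x = u"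
    moreover have "g x \<noteq> u" "x \<in> A" using x bc_A A_V u_only by auto
    ultimately show "x \<in> tpart W \<sigma>" by (auto simp: tpart_def)
  qed
  show "tpart W \<sigma> \<inter> {b, c} = {}" if "s = u"
    using key i bc_A U(3) that by (auto simp: set_ys)
  show "\<exists>t. tpart W \<sigma> \<inter> {b, c} = {t}" if "s \<noteq> u"
  proof -
    have "u \<notin> W" using that uU U(3) by simp
    then have s: "\<sigma> u \<in> set ys - W" "\<sigma> u \<noteq> u" "\<sigma> (\<sigma> u) = u" "adj ys u (\<sigma> u)" using i[of u] by (auto simp: set_ys)
    have t: "\<sigma> u \<in> {b, c}" using adj_u[OF adj_sym[OF s(4)]] s by (auto simp: set_ys)
    have "x = \<sigma> u" if "x \<in> tpart W \<sigma> \<inter> {b, c}" for x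
    proof -
      have "x \<notin> W" "\<sigma> x = u" "x \<in> set ys" using that key bc_A by (auto simp: set_ys)
      then show ?thesis using i[of x] by auto
    qed
    moreover have "\<sigma> u \<in> tpart W \<sigma>" using key[OF t] s by auto
    ultimately show ?thesis using t by (intro exI[of _ "\<sigma> u"]) blast
  qed
qed

lemma tpart_A: "tpart W \<sigma> \<subseteq> A - W"
  by (auto simp: tpart_def)

lemma rest_A:
  assumes si: "spoke_involution ys other_end D s W \<sigma>" and x: "x \<in> A" "x \<notin> W" "x \<notin> tpart W \<sigma>"
  shows "g x \<in> A - W - tpart W \<sigma>"
proof -
  have e: "\<sigma> x = g x" using x by (auto simp: tpart_def)
  have i: "\<sigma> x \<in> set ys - W" "\<sigma> (\<sigma> x) = x"
    using spoke_involutionD[OF si] x set_ys by (metis Diff_iff insertCI)+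
  have xV: "x \<in> V" using x A_V by auto
  have "g x \<in> A" using A_closed xV x by simp
  then show ?thesis using i e V_g(2)[OF xV] by (auto simp: tpart_def)
qed

section \<open>Extending circle matchings to perfect matchings\<close>

text \<open>The sets on which a matching may take \<open>h\<close>: the rest of \<open>K\<close> is
  then closed under \<open>g\<close>.\<close>

definition link_closed_set :: "'a set \<Rightarrow> bool" where
  "link_closed_set H \<longleftrightarrow> H \<subseteq> V - {u} \<and> (\<forall>x\<in>H. h x \<in> H \<and> gK x \<in> H)"

lemma link_closed_set_g:
  assumes H: "link_closed_set H" and x: "x \<in> K" "x \<notin> H" shows "g x \<notin> H"
proof
  assume "g x \<in> H"
  then have "gK (g x) \<in> H" using H by (simp add: link_closed_set_def)
  then show False using x K_closed[OF x(1)] V_g(2)[of x] K_V by (auto simp: gK_def)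
qed

text \<open>The perfect matching obtained from a matching of the circle \<open>ys\<close> that leaves \<open>s\<close> uncovered:
  the links of the uncovered vertices are used, and \<open>E\<close> is the set of vertices of the other circle that
  are covered by \<open>T\<close>.\<close>

lemma pm_crossing:
  assumes si: "spoke_involution ys other_end D s W \<sigma>" and s: "s \<in> A"
    and H: "link_closed_set H" "H \<inter> A = W"
    and E: "E \<subseteq> B" "\<And>x. x \<in> E \<Longrightarrow> T x \<in> E" "E \<inter> H = {}" and w: "w \<in> {p1, p2}" "w \<notin> H" "w \<notin> E"
    and R: "\<And>x. x \<in> B - H - E - {w} \<Longrightarrow> g x \<in> B - H - E - {w} - {p1, p2} \<and> x \<notin> {p1, p2}"
  shows "pm (glue H (tpart W \<sigma> \<union> E) w)"
proof -
  have su: "s \<noteq> u" "s \<in> A \<union> {u}" using s A_V by auto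
  obtain t where t: "tpart W \<sigma> \<inter> {b, c} = {t}" using tpart_bc(2)[OF si su(2,1)] by blast
  have wB: "w \<in> B" "w \<noteq> u" using w p_B B_V by auto
  note tA = tpart_A[of W \<sigma>]
  show ?thesis
  proof (rule pm_glue[where s = t])
    show "H \<subseteq> V - {u}" "\<And>x. x \<in> H \<Longrightarrow> h x \<in> H" using H by (auto simp: link_closed_set_def)
    show "tpart W \<sigma> \<union> E \<subseteq> V" using tA E A_V B_V by blast
    show "T x \<in> tpart W \<sigma> \<union> E" if "x \<in> tpart W \<sigma> \<union> E" for x using that tpart_T[OF si] E(2) by blast
    show "H \<inter> (tpart W \<sigma> \<union> E) = {}" using tA H(2) E(3) by blast
    show "(tpart W \<sigma> \<union> E) \<inter> {u, b, c} = {t}" using t tA E(1) A_V B_V bc_A by blast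
    show "w \<in> {u, p1, p2}" "w \<notin> H" "w = u \<Longrightarrow> u \<in> tpart W \<sigma> \<union> E" using w wB by auto
    show "u \<notin> tpart W \<sigma> \<union> E \<and> w \<notin> tpart W \<sigma> \<union> E" if "w \<noteq> u" using wB w tA E(1) A_V B_V by blast
    show "g x \<notin> H \<union> (tpart W \<sigma> \<union> E) \<union> {u, w} \<and> x \<notin> {p1, p2}"
      if x: "x \<in> V" "x \<notin> H \<union> (tpart W \<sigma> \<union> E) \<union> {u, w}" for x
    proof -
      have gu: "g x \<noteq> u" using x u_only by auto
      consider "x \<in> A" | "x \<in> B" | "x \<in> K" using V_cases[OF x(1)] x(2) by blast
      then show ?thesis
      proof cases
        case 1
        then have "g x \<in> A - W - tpart W \<sigma>" using rest_A[OF si] x H(2) by blast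
        then show ?thesis using 1 gu H(2) E(1) B_V wB p_A by blast
      next
        case 2
        then have "g x \<in> B - H - E - {w}" "x \<notin> {p1, p2}" using R[of x] x by auto
        then show ?thesis using gu tA B_V by blast
      next
        case 3
        then have "g x \<in> K" "g x \<notin> H" using K_closed link_closed_set_g[OF H(1)] x by auto
        moreover have "K \<inter> A = {}" "K \<inter> B = {}" by (auto simp: K_def)
        ultimately show ?thesis using 3 gu tA E(1) wB p_B by blast
      qed
    qed
  qed
qed

text \<open>Here the deleted vertex is matched with \<open>u\<close>. No link crosses to
  \<open>B\<close>, and all of \<open>B\<close> is covered by \<open>T\<close>.\<close>

lemma pm_u:
  assumes si: "spoke_involution ys other_end D u W \<sigma>" and H: "link_closed_set H" "H \<inter> A = W \<inter> A" "H \<inter> B = {}"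
  shows "pm (glue H (tpart W \<sigma> \<union> insert u B) u)"
proof -
  note tA = tpart_A[of W \<sigma>]
  show ?thesis
  proof (rule pm_glue[where s = u])
    show "H \<subseteq> V - {u}" "\<And>x. x \<in> H \<Longrightarrow> h x \<in> H" using H by (auto simp: link_closed_set_def)
    show "tpart W \<sigma> \<union> insert u B \<subseteq> V" using tA inV A_V B_V by blast
    show "T x \<in> tpart W \<sigma> \<union> insert u B" if "x \<in> tpart W \<sigma> \<union> insert u B" for x
      using that tpart_T[OF si] B_closed(2)[of x] B_V fixed_points by blast
    show "H \<inter> (tpart W \<sigma> \<union> insert u B) = {}" using tA H(1-3) unfolding link_closed_set_def by blast
    show "(tpart W \<sigma> \<union> insert u B) \<inter> {u, b, c} = {u}" using tpart_bc(1)[OF si] tA B_V bc_A by blast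
    show "g x \<notin> H \<union> (tpart W \<sigma> \<union> insert u B) \<union> {u, u} \<and> x \<notin> {p1, p2}"
      if x: "x \<in> V" "x \<notin> H \<union> (tpart W \<sigma> \<union> insert u B) \<union> {u, u}" for x
    proof -
      have gu: "g x \<noteq> u" using x u_only by auto
      consider "x \<in> A" | "x \<in> K" using V_cases[OF x(1)] x(2) by blast
      then show ?thesis
      proof cases
        case 1
        then have "g x \<in> A - W - tpart W \<sigma>" using rest_A[OF si] x H(2) by blast
        then show ?thesis using 1 gu H(2) B_V p_A by blast
      next
        case 2
        then have "g x \<in> K" "g x \<notin> H" using K_closed link_closed_set_g[OF H(1)] x by auto
        moreover have "K \<inter> A = {}" "K \<inter> B = {}" by (auto simp: K_def)
        ultimately show ?thesis using 2 gu tA p_B by blast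
      qed
    qed
  qed (use H in \<open>auto simp: link_closed_set_def\<close>)
qed

lemma links_of_chords:
  assumes U: "U \<subseteq> D" "tclosed other_end U"
  shows "link_closed_set (\<Union>x\<in>U. link x)" "(\<Union>x\<in>U. link x) \<inter> (A \<union> B) = U"
proof -
  have UA: "x \<in> A \<union> B" if "x \<in> U" for x using that U(1) by (auto simp: D_def)
  show "link_closed_set (\<Union>x\<in>U. link x)"
    using link_V[OF UA] link_closed[OF UA] unfolding link_closed_set_def by blast
  show "(\<Union>x\<in>U. link x) \<inter> (A \<union> B) = U"
  proof
    show "(\<Union>x\<in>U. link x) \<inter> (A \<union> B) \<subseteq> U"
    proof
      fix y assume y: "y \<in> (\<Union>x\<in>U. link x) \<inter> (A \<union> B)"
      then obtain x where x: "x \<in> U" "y \<in> link x \<inter> (A \<union> B)" by blast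
      then have "y \<in> {x, other_end x}" using link_ends(1)[OF UA[OF x(1)]] by simp
      then show "y \<in> U" using x(1) U(2) by (auto simp: tclosed_def)
    qed
    show "U \<subseteq> (\<Union>x\<in>U. link x) \<inter> (A \<union> B)" using link_ends(1)[OF UA] UA by blast
  qed
qed

lemma link_closed_set_Un: "link_closed_set H \<Longrightarrow> link_closed_set H' \<Longrightarrow> link_closed_set (H \<union> H')"
  by (auto simp: link_closed_set_def)

text \<open>Collects what the final count needs. A circle edge other than \<open>g\<close> shows up
  in \<open>\<rho>\<close> as a fixed point.\<close>

definition extends :: "('a \<Rightarrow> 'a) \<Rightarrow> 'a set \<Rightarrow> 'a set \<Rightarrow> ('a \<Rightarrow> 'a) \<Rightarrow> bool" where
  "extends \<rho> H W \<sigma> \<longleftrightarrow> pm \<rho> \<and> link_closed_set H \<and> H \<inter> A = W \<inter> A \<and> (\<forall>x\<in>K - H. \<rho> x = g x) \<and>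
     (\<forall>x\<in>A - W. \<rho> x = (if \<sigma> x = g x then g x else x))"

lemma extends_glue:
  assumes "pm (glue H (tpart W \<sigma> \<union> E) w)" "link_closed_set H" "H \<inter> A = W \<inter> A" "E \<subseteq> insert u B" "w \<in> {u, p1, p2}"
  shows "extends (glue H (tpart W \<sigma> \<union> E) w) H W \<sigma>"
  unfolding extends_def
proof (intro conjI ballI)
  fix x assume x: "x \<in> K - H"
  then have "x \<notin> A" "x \<notin> insert u B" "x \<noteq> w" using assms(5) p_B by (auto simp: K_def)
  then show "glue H (tpart W \<sigma> \<union> E) w x = g x" using x assms(4) tpart_A[of W \<sigma>] by (auto simp: glue_def)
next
  fix x assume x: "x \<in> A - W"
  then have "x \<notin> H" "x \<noteq> u" "x \<noteq> w" "x \<notin> E" using assms(3-5) A_V B_V p_A by auto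
  then show "glue H (tpart W \<sigma> \<union> E) w x = (if \<sigma> x = g x then g x else x)"
    using x by (auto simp: glue_def tpart_def)
qed (use assms in auto)

text \<open>\<open>h\<close> is taken on the whole side \<open>S\<close>, not just on the link of
  \<open>l\<close>. Then \<open>g\<close> pairs the vertices of \<open>B - S\<close> apart from
  \<open>q'\<close>, which is matched with \<open>u\<close>.\<close>

lemma extends_side:
  assumes sd: "side q S l" and q: "{q, q'} = {p1, p2}" and si: "spoke_involution ys other_end D l W \<sigma>"
  shows "\<exists>\<rho> H. extends \<rho> H W \<sigma> \<and> H \<inter> B = S \<inter> B \<and> \<rho> u = q' \<and> (\<forall>x\<in>B - S - {q'}. \<rho> x = g x)"
proof -
  obtain U where U: "U \<subseteq> D" "tclosed other_end U" "W = insert l U"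
    by (rule spoke_involutionD[OF si]) blast
  define H where "H = S \<union> (\<Union>x\<in>U. link x)"
  have SV: "S \<subseteq> V - {u}" "S \<inter> A = {l}" "S \<inter> {p1, p2} = {q}" and lA: "l \<in> A" using sd by (auto simp: side_def)
  have cS: "link_closed_set S" using sd side_gK[OF sd] by (auto simp: side_def link_closed_set_def)
  then have cH: "link_closed_set H" unfolding H_def using links_of_chords(1)[OF U(1,2)] by (rule link_closed_set_Un)
  have UA: "U \<subseteq> A" using U(1) by (auto simp: D_def)
  have HB: "H \<inter> B = S \<inter> B" and HA: "H \<inter> A = W"
  proof -
    have "(\<Union>x\<in>U. link x) \<inter> A = U" "(\<Union>x\<in>U. link x) \<inter> B = {}"
      using links_of_chords(2)[OF U(1,2)] UA B_V by blast+
    then show "H \<inter> B = S \<inter> B" "H \<inter> A = W" using SV(2) U(3) by (simp_all add: H_def Int_Un_distrib2)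
  qed
  have qs: "q \<in> S" "q' \<notin> S" "q' \<in> {p1, p2}" "q' \<in> B" "q' \<notin> A" "g q' = q'" "q' \<noteq> u"
  proof -
    have c: "(q = p1 \<and> q' = p2) \<or> (q = p2 \<and> q' = p1)" using q by (auto simp: doubleton_eq_iff)
    then have "q \<noteq> q'" "q' \<in> {p1, p2}" using dist by auto
    then have n: "q' \<notin> S \<inter> {p1, p2}" unfolding SV(3) by simp
    have "q \<in> S \<inter> {p1, p2}" unfolding SV(3) by simp
    then show "q \<in> S" by simp
    show "q' \<notin> S" using n \<open>q' \<in> {p1, p2}\<close> by blast
    show "q' \<in> {p1, p2}" "q' \<in> B" "q' \<notin> A" "g q' = q'" "q' \<noteq> u" using c p_A p_B dist fixed_points by auto
  qed
  have "pm (glue H (tpart W \<sigma> \<union> {}) q')"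
  proof (rule pm_crossing[OF si lA cH HA])
    show "q' \<in> {p1, p2}" "q' \<notin> H" using qs HB by blast+
    show "g x \<in> B - H - {} - {q'} - {p1, p2} \<and> x \<notin> {p1, p2}" if x: "x \<in> B - H - {} - {q'}" for x
    proof -
      have xV: "x \<in> V" "x \<notin> A" "x \<in> B" "x \<notin> S" using x B_V HB by auto
      have xp: "x \<notin> {p1, p2}" using q qs x xV by (auto simp: doubleton_eq_iff)
      have gV: "g x \<in> V" "g x \<notin> A" "g x \<in> B" "g (g x) = x" using xV V_g A_closed B_closed by auto
      have "g x \<notin> S" using sd gV xV unfolding side_def by (metis DiffI)
      moreover have "g x \<notin> {p1, p2}" using gV xp fixed_points by auto
      ultimately show ?thesis using gV xp HB qs by blast
    qed
  qed auto
  then have pm: "pm (glue H (tpart W \<sigma>) q')" by simp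
  have "extends (glue H (tpart W \<sigma> \<union> {}) q') H W \<sigma>"
    by (rule extends_glue) (use pm cH HA qs in auto)
  moreover have "glue H (tpart W \<sigma>) q' u = q'"
    using cH tpart_A[of W \<sigma>] A_V by (auto simp: glue_def link_closed_set_def)
  moreover have "\<forall>x\<in>B - S - {q'}. glue H (tpart W \<sigma>) q' x = g x"
    using HB tpart_A[of W \<sigma>] B_V by (auto simp: glue_def)
  ultimately show ?thesis using HB by auto
qed

text \<open>\<open>B\<close> together with \<open>u\<close> forms an odd circuit, so without
  \<open>y\<close> it is a path with an even number of vertices, matched alternately.
  \<open>E\<close> is the part covered by \<open>T\<close>, and \<open>w\<close> is the partner of
  \<open>u\<close>.\<close>

lemma split_B:
  assumes y: "y \<in> B"
  obtains E w where "E \<subseteq> B - {y}" "\<And>x. x \<in> E \<Longrightarrow> T x \<in> E" "w \<in> {p1, p2}" "w \<notin> E" "w \<noteq> y"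
    "\<And>x. x \<in> B - {y} - E - {w} \<Longrightarrow> g x \<in> B - {y} - E - {w} - {p1, p2} \<and> x \<notin> {p1, p2}"
proof -
  let ?n = "length ls"
  obtain k where k: "k < ?n" "y = ls ! k" using y by (auto simp: B_def in_set_conv_nth)
  define seg where "seg i j = (!) ls ` {i..<j}" for i j
  have all: "B = seg 0 ?n" by (auto simp: seg_def B_def set_conv_nth)
  have p1: "p1 = ls ! 0" using ls(1) by (simp add: alt_path_def)
  have p2: "p2 = ls ! (?n - 1)" using alt_path_last[OF ls(1)] ls_last(1) by simp
  have inj: "i < ?n \<Longrightarrow> j < ?n \<Longrightarrow> ls ! i = ls ! j \<longleftrightarrow> i = j" for i j by (rule alt_path_inj[OF ls(1)])
  have sub: "j \<le> ?n \<Longrightarrow> seg i j \<subseteq> B" for i j by (auto simp: seg_def B_def)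
  have mem: "j \<le> ?n \<Longrightarrow> m < ?n \<Longrightarrow> ls ! m \<in> seg i j \<longleftrightarrow> i \<le> m \<and> m < j" for i j m
    by (auto simp: seg_def inj)
  have segT: "x \<in> seg i j \<Longrightarrow> T x \<in> seg i j" if "even i" "even j" "j \<le> ?n" for i j x
    using alt_path_seg(1)[OF ls(1) that(3), of i x] that by (cases "i < ?n") (auto simp: seg_def)
  have segg: "x \<in> seg i j \<Longrightarrow> g x \<in> seg i j" if "odd i" "odd j" "j \<le> ?n" for i j x
    using alt_path_seg(2)[OF ls(1) that(3), of i x] that by (cases "i < ?n") (auto simp: seg_def)
  have evn: "even ?n" "0 < ?n" using ls_last(2) alt_path_pos[OF ls(1)] by auto
  show thesis
  \<comment> \<open>Along \<open>ls\<close> the steps are \<open>T\<close>, \<open>g\<close>,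
    \<open>T\<close> and so on, beginning at \<open>p1\<close>. The parity of \<open>k\<close>
    decides whether \<open>T\<close> covers the part before or after \<open>y\<close>.\<close>
  proof (cases "even k")
    case True
    then have k1: "k < ?n - 1" "Suc k \<le> ?n - 1" using k evn by (cases "k = ?n - 1"; auto)+
    have "{0..<?n} = {0..<k} \<union> {k} \<union> {Suc k..<?n - 1} \<union> {?n - 1}" using k1 by auto
    then have "B = seg 0 k \<union> {y} \<union> seg (Suc k) (?n - 1) \<union> {p2}"
      unfolding all seg_def using k p2 by (simp add: image_Un)
    moreover have "y \<notin> seg (Suc k) (?n - 1)" "p2 \<notin> seg (Suc k) (?n - 1)" "p1 \<notin> seg (Suc k) (?n - 1)"
        "y \<notin> seg 0 k" "p2 \<notin> seg 0 k" "p2 \<noteq> y"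
      using k k1 evn unfolding p1 p2 by (simp_all add: mem inj)
    moreover have "seg 0 k \<inter> seg (Suc k) (?n - 1) = {}" using k by (auto simp: seg_def inj)
    ultimately have R: "B - {y} - seg 0 k - {p2} = seg (Suc k) (?n - 1)" "p1 \<notin> seg (Suc k) (?n - 1)"
        "p2 \<notin> seg (Suc k) (?n - 1)" "p2 \<notin> seg 0 k" "y \<notin> seg 0 k" "p2 \<noteq> y" by blast+
    show ?thesis
    proof (rule that[of "seg 0 k" p2])
      show "seg 0 k \<subseteq> B - {y}" using sub[of k 0] k R by auto
      show "T x \<in> seg 0 k" if "x \<in> seg 0 k" for x using segT[of 0 k x] that True k by simp
      show "g x \<in> B - {y} - seg 0 k - {p2} - {p1, p2} \<and> x \<notin> {p1, p2}" if "x \<in> B - {y} - seg 0 k - {p2}" for x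
        using segg[of "Suc k" "?n - 1" x] that True evn R by auto
    qed (use R in auto)
  next
    case False
    then have k1: "0 < k" "Suc 0 \<le> k" by (cases k; auto)+
    have "{0..<?n} = {0} \<union> {1..<k} \<union> {k} \<union> {Suc k..<?n}" using k k1 by auto
    then have "B = {p1} \<union> seg 1 k \<union> {y} \<union> seg (Suc k) ?n"
      unfolding all seg_def using k p1 by (simp add: image_Un)
    moreover have "y \<notin> seg 1 k" "p1 \<notin> seg 1 k" "p2 \<notin> seg 1 k"
        "y \<notin> seg (Suc k) ?n" "p1 \<notin> seg (Suc k) ?n" "p1 \<noteq> y"
      using k k1 evn unfolding p1 p2 by (auto simp add: mem inj)
    moreover have "seg 1 k \<inter> seg (Suc k) ?n = {}" using k by (auto simp: seg_def inj)
    ultimately have R: "B - {y} - seg (Suc k) ?n - {p1} = seg 1 k" "p1 \<notin> seg 1 k"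
        "p2 \<notin> seg 1 k" "p1 \<notin> seg (Suc k) ?n" "y \<notin> seg (Suc k) ?n" "p1 \<noteq> y" by blast+
    show ?thesis
    proof (rule that[of "seg (Suc k) ?n" p1])
      show "seg (Suc k) ?n \<subseteq> B - {y}" using sub[of ?n "Suc k"] R by auto
      show "T x \<in> seg (Suc k) ?n" if "x \<in> seg (Suc k) ?n" for x using segT[of "Suc k" ?n x] that False evn by simp
      show "g x \<in> B - {y} - seg (Suc k) ?n - {p1} - {p1, p2} \<and> x \<notin> {p1, p2}" if "x \<in> B - {y} - seg (Suc k) ?n - {p1}" for x
        using segg[of 1 k x] that False k R by auto
    qed (use R in auto)
  qed
qed

lemma extends_third:
  assumes si: "spoke_involution ys other_end D s W \<sigma>" and s: "s = u \<or> s \<in> A \<and> other_end s \<in> B"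
  shows "\<exists>\<rho> H. extends \<rho> H W \<sigma>"
proof -
  obtain U where U: "U \<subseteq> D" "tclosed other_end U" "W = insert s U"
    by (rule spoke_involutionD[OF si]) blast
  define H where "H = (\<Union>x\<in>U. link x)"
  have UA: "U \<subseteq> A" using U(1) by (auto simp: D_def)
  have cH: "link_closed_set H" unfolding H_def by (rule links_of_chords(1)[OF U(1,2)])
  have HAB: "H \<inter> A = U" "H \<inter> B = {}"
    using links_of_chords(2)[OF U(1,2)] UA B_V unfolding H_def by blast+
  show ?thesis
  proof (cases "s = u")
    case True
    have W: "H \<inter> A = W \<inter> A" using HAB U(3) True UA A_V by auto
    have "pm (glue H (tpart W \<sigma> \<union> insert u B) u)"
      by (rule pm_u[OF _ cH W HAB(2)]) (use si True in simp)
    then have "extends (glue H (tpart W \<sigma> \<union> insert u B) u) H W \<sigma>"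
      by (rule extends_glue) (use cH W in auto)
    then show ?thesis by blast
  next
    case False
    then have sA: "s \<in> A" "other_end s \<in> B" "s \<in> A \<union> B" using s by auto
    let ?y = "other_end s" let ?H = "H \<union> link s"
    have c: "link_closed_set (link s)"
      using link_V[OF sA(3)] link_closed[OF sA(3)] by (auto simp: link_closed_set_def)
    have cH': "link_closed_set ?H" using cH c by (rule link_closed_set_Un)
    have l: "link s \<inter> A = {s}" "link s \<inter> B = {?y}" using link_ends(1)[OF sA(3)] sA B_V by blast+
    have HA: "?H \<inter> A = W" and HB: "?H \<inter> B = {?y}" using HAB l U(3) by (simp_all add: Int_Un_distrib2)
    obtain E w where E: "E \<subseteq> B - {?y}" "\<And>x. x \<in> E \<Longrightarrow> T x \<in> E" and w: "w \<in> {p1, p2}" "w \<notin> E" "w \<noteq> ?y"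
      and R: "\<And>x. x \<in> B - {?y} - E - {w} \<Longrightarrow> g x \<in> B - {?y} - E - {w} - {p1, p2} \<and> x \<notin> {p1, p2}"
      by (rule split_B[OF sA(2)]) blast
    have BH: "B - ?H = B - {?y}" using HB by blast
    have wB: "w \<in> B" using w(1) p_B by auto
    have "pm (glue ?H (tpart W \<sigma> \<union> E) w)"
    proof (rule pm_crossing[OF si sA(1) cH' HA])
      show "E \<subseteq> B" "E \<inter> ?H = {}" "w \<notin> ?H" using E(1) HB w wB by blast+
      show "g x \<in> B - ?H - E - {w} - {p1, p2} \<and> x \<notin> {p1, p2}" if "x \<in> B - ?H - E - {w}" for x
        using R[of x] that unfolding BH by blast
    qed (use E w in auto)
    then have "extends (glue ?H (tpart W \<sigma> \<union> E) w) ?H W \<sigma>"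
      by (rule extends_glue) (use cH' HA A_V sA E w in auto)
    then show ?thesis by blast
  qed
qed

section \<open>The five matchings in the separated case\<close>

lemma cover_separated: "\<exists>Ms. length Ms = 5 \<and> pm_cover Ms"
proof -
  obtain S l where S: "side p1 S l" using side_exists[of p1] by auto
  obtain S' r where S': "side p2 S' r" using side_exists[of p2] by auto
  have dis: "S \<inter> S' = {}" by (rule side_disjoint[OF S S'])
  define Sp where "Sp = insert u {x \<in> A. other_end x \<in> B}"
  have l: "l \<in> Sp" "l \<in> S" and r: "r \<in> Sp" "r \<in> S'"
    using side_spoke[OF S] side_spoke[OF S'] S S' by (auto simp: Sp_def side_def)
  have lr: "l \<noteq> r" using l r dis by auto
  have uA: "u \<notin> A" using A_V by auto
  have AB: "A \<inter> B = {}" using B_V by auto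
  have Deq: "set ys - Sp = D"
    using uA AB link_ends(2) by (fastforce simp: set_ys Sp_def D_def)
  have tD: "tclosed other_end (set ys - Sp)"
    unfolding Deq tclosed_def using other_end_other_end other_end_neq by (auto simp: D_def)
  have dy: "distinct ys" "odd (length ys)" "3 \<le> length ys"
    using ws(1) uA ws_even by (auto simp: ys_def A_def alt_path_def)
  have "Sp \<subseteq> set ys" by (auto simp: Sp_def set_ys)
  then obtain d where d: "d \<in> Sp - {l, r}" "good ys other_end D l r d"
    using third_spoke[OF dy(1,2) _ tD l(1) r(1) lr] Deq by auto
  obtain W1 W2 W3 \<sigma>1 \<sigma>2 \<sigma>3 where si: "spoke_involution ys other_end D l W1 \<sigma>1"
      "spoke_involution ys other_end D r W2 \<sigma>2" "spoke_involution ys other_end D d W3 \<sigma>3"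
    and cov: "\<And>x y. adj ys x y \<Longrightarrow> (x \<notin> W1 \<and> \<sigma>1 x = y) \<or> (x \<notin> W2 \<and> \<sigma>2 x = y) \<or> (x \<notin> W3 \<and> \<sigma>3 x = y)"
    by (rule good_imp_involutions[OF dy(1,3) d(2)]) blast
  obtain \<rho>1 H1 where 1: "extends \<rho>1 H1 W1 \<sigma>1" "H1 \<inter> B = S \<inter> B" "\<rho>1 u = p2" "\<forall>x\<in>B - S - {p2}. \<rho>1 x = g x"
    using extends_side[OF S _ si(1), of p2] by auto
  obtain \<rho>2 H2 where 2: "extends \<rho>2 H2 W2 \<sigma>2" "H2 \<inter> B = S' \<inter> B" "\<rho>2 u = p1" "\<forall>x\<in>B - S' - {p1}. \<rho>2 x = g x"
    using extends_side[OF S' _ si(2), of p1] by auto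
  obtain \<rho>3 H3 where 3: "extends \<rho>3 H3 W3 \<sigma>3"
    using extends_third[OF si(3)] d(1) by (auto simp: Sp_def)
  \<comment> \<open>\<open>?X\<close> takes \<open>g\<close> on \<open>A\<close> and the edges off
    the Hamiltonian circuit everywhere else, including the edge at \<open>u\<close>.\<close>
  let ?M = "glue (V - {u}) {u} u" and ?X = "glue {} (V - A) u"
  have pmX: "pm ?X"
    by (rule pm_glue[where s = u]) (use A_V bc_A p_A inV V_T A_closed u_only in auto)
  let ?Ms = "[?M, ?X, \<rho>1, \<rho>2, \<rho>3]"
  have inA: "(\<rho>1 x = z) \<or> (\<rho>2 x = z) \<or> (\<rho>3 x = z)"
    if x: "x \<in> A" "adj ys x y" and z: "z = (if y = g x then g x else x)" for x y z
    using cov[OF x(2)] 1(1) 2(1) 3 x(1) z unfolding extends_def by (elim disjE) auto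
  \<comment> \<open>A vertex of \<open>K\<close> in all three sets would never be matched by
    \<open>g\<close> in these matchings. The circle cover keeps the intersection off
    \<open>A\<close>, and the disjoint sides keep it off \<open>B\<close>. It is then closed under
    \<open>h\<close> and \<open>g\<close>, so \<open>conn\<close>, applied to its complement, makes
    it empty.\<close>
  have disH: "H1 \<inter> H2 \<inter> H3 = {}"
  proof (rule ccontr)
    let ?I = "H1 \<inter> H2 \<inter> H3"
    assume "?I \<noteq> {}"
    then obtain x where x: "x \<in> ?I" by blast
    have cI: "link_closed_set ?I" using 1(1) 2(1) 3 by (auto simp: extends_def link_closed_set_def)
    have "?I \<inter> A = {}"
      using 1(1) 2(1) 3 cov[OF adj_g] unfolding extends_def by blast
    moreover have "?I \<inter> B = {}" using 1(2) 2(2) dis by blast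
    ultimately have IK: "?I \<subseteq> K" using cI by (auto simp: link_closed_set_def K_def)
    have "V - {u} \<subseteq> V - ?I"
    proof (rule conn)
      show "p1 \<in> V - ?I" using IK p_B inV by (auto simp: K_def)
      fix y assume y: "y \<in> V - ?I"
      have "h y \<notin> ?I" using y V_h(2)[of y] cI unfolding link_closed_set_def by (metis DiffD1 DiffD2)
      moreover have "g y \<notin> ?I"
      proof
        assume gI: "g y \<in> ?I"
        then have "gK (g y) = y" using IK y V_g(2)[of y] by (auto simp: gK_def)
        then show False using gI cI y unfolding link_closed_set_def by (metis DiffD2)
      qed
      ultimately show "h y \<in> V - ?I \<and> g y \<in> V - ?I" using y V_h V_g by auto
    qed auto
    then show False using x cI by (auto simp: link_closed_set_def)
  qed
  have "pm_cover ?Ms"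
    unfolding pm_cover_def
  proof (intro conjI ballI)
    show "pm \<rho>" if "\<rho> \<in> set ?Ms" for \<rho> using that pm_h pmX 1(1) 2(1) 3 by (auto simp: extends_def)
    show "\<exists>\<rho>\<in>set ?Ms. \<rho> x = h x" if "x \<in> V - {u}" for x using that by (auto simp: glue_def)
    show "\<exists>\<rho>\<in>set ?Ms. \<rho> u = p1" "\<exists>\<rho>\<in>set ?Ms. \<rho> u = p2" using 1(3) 2(3) by auto
    show "\<exists>\<rho>\<in>set ?Ms. \<rho> x = g x" if x: "x \<in> V - {u, p1, p2}" for x
    proof -
      consider "x \<in> A" | "x \<in> B" | "x \<in> K" using V_cases x by blast
      then show ?thesis
      proof cases
        case 1
        then show ?thesis using inA[OF 1 adj_g[OF 1], of "g x"] by auto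
      next
        case b: 2
        then have "x \<notin> S \<or> x \<notin> S'" using dis by blast
        then show ?thesis using b x 1(4) 2(4) by auto
      next
        case k: 3
        then have "x \<notin> H1 \<or> x \<notin> H2 \<or> x \<notin> H3" using disH by blast
        then show ?thesis using k 1(1) 2(1) 3 unfolding extends_def by auto
      qed
    qed
    show "\<exists>\<rho>\<in>set ?Ms. \<rho> x = x" if x: "x \<in> V" for x
    proof (cases "x \<in> A")
      case True
      then obtain y where "adj ys x y" "y \<noteq> g x" using adj_not_g by blast
      then show ?thesis using inA[OF True, of y x] by auto
    next
      case False
      then show ?thesis using x by (auto simp: glue_def)
    qed
  qed
  then show ?thesis by (intro exI[of _ ?Ms]) simp
qed

end

section \<open>Combining the cases\<close>

context arcs
begin

text \<open>A path that starts at \<open>b\<close> and avoids \<open>u\<close> can only stop at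
  \<open>p1\<close>, \<open>p2\<close> or \<open>c\<close>. The second case is the first one with
  the circuit reversed.\<close>

lemma pm_cover_exists: "\<exists>Ms. length Ms = 5 \<and> pm_cover Ms"
proof -
  have bV: "b \<in> V - {u}" and pV: "p1 \<in> V - {u}" using inV dist by auto
  have off_u: "involution_on (V - {u}) g" "involution_on (V - {u}) T"
    using V_g V_T u_only by (auto simp: involution_on_def)
  obtain ws where ws: "alt_path g T b ws" "set ws \<subseteq> V - {u}"
    using alt_path_exists[of "V - {u}" b T g] finV off_u bV fixed_points by (metis finite_Diff)
  have lV: "last ws \<in> V - {u}" using alt_path_ends(2)[OF ws(1)] ws(2) by blast
  have "g (last ws) = last ws \<or> T (last ws) = last ws" using ws(1) by (auto simp: alt_path_def split: if_splits)
  moreover have "last ws \<noteq> b \<or> g (last ws) = last ws" using alt_path_fixed_p[OF ws(1)] by auto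
  ultimately have "last ws \<in> {p1, p2, c}" using fixg[of "last ws"] fixT[of "last ws"] lV by auto
  then consider "last ws = p1" | "last ws = p2" | "last ws = c" by blast
  then show ?thesis
  proof cases
    case 1
    then show ?thesis using cover_linked ws by blast
  next
    case 2
    then obtain Ms where Ms: "length Ms = 5" "arcs.pm_cover V u b c p2 p1 h g T Ms"
      using arcs.cover_linked[OF arcs_swap ws] by blast
    have "arcs.pm V u b c p2 p1 h g T \<rho> = pm \<rho>" for \<rho>
      unfolding arcs.pm_def[OF arcs_swap] pm_def by blast
    then have "pm_cover Ms"
      using Ms(2) unfolding arcs.pm_cover_def[OF arcs_swap] pm_cover_def by (simp add: insert_commute)
    then show ?thesis using Ms(1) by blast
  next
    case 3
    have cl: "involution_on (V - {u} - set ws) g" "involution_on (V - {u} - set ws) T"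
    proof -
      have "g x \<in> set ws \<longleftrightarrow> x \<in> set ws" "T x \<in> set ws \<longleftrightarrow> x \<in> set ws" if "x \<in> V" for x
        using alt_path_closed(1,2)[OF ws(1)] V_g V_T that by metis+
      then show "involution_on (V - {u} - set ws) g" "involution_on (V - {u} - set ws) T"
        using off_u by (auto simp: involution_on_def)
    qed
    have "p1 \<notin> set ws"
    proof
      assume p: "p1 \<in> set ws"
      have "c \<noteq> b" using dist by auto
      then show False
        using alt_path_moves(2,3)[OF ws(1), of p1] alt_path_last_fixed(1)[OF ws(1)] p 3 fixed_points
        by (cases "p1 = c"; cases "p1 = b") auto
    qed
    then obtain ls where ls: "alt_path T g p1 ls" "set ls \<subseteq> V - {u} - set ws"
      using alt_path_exists[of "V - {u} - set ws" p1 g T] finV cl pV fixed_points by (metis DiffI finite_Diff)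
    interpret separated V u b c p1 p2 h g T ws ls
      by unfold_locales (use ws ls 3 in auto)
    show ?thesis by (rule cover_separated)
  qed
qed

end


section \<open>From the graph to the involutions\<close>

lemma circuit_rotate:
  assumes "circuit G vs es" shows "circuit G (rotate k vs) (rotate k es)"
proof -
  let ?n = "length vs"
  have c: "2 \<le> ?n" "length es = ?n" "distinct vs" "distinct es" "set vs \<subseteq> verts G" "set es \<subseteq> edges G"
    and e: "\<And>i. i < ?n \<Longrightarrow> ends G (es ! i) = {vs ! i, vs ! (Suc i mod ?n)}"
    using assms by (auto simp: circuit_def)
  have "ends G (rotate k es ! i) = {rotate k vs ! i, rotate k vs ! (Suc i mod ?n)}" if i: "i < ?n" for i
  proof -
    have n: "0 < ?n" using i by linarith
    have "(k + Suc i mod ?n) mod ?n = Suc ((k + i) mod ?n) mod ?n"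
      by (simp add: mod_add_right_eq mod_Suc_eq)
    then show ?thesis
      using e[of "(k + i) mod ?n"] i c(2) n by (simp add: nth_rotate)
  qed
  then show ?thesis using c by (simp add: circuit_def)
qed

lemma card_2_other: "card S = 2 \<Longrightarrow> x \<in> S \<Longrightarrow> \<exists>y. S = {x, y} \<and> x \<noteq> y"
  by (auto simp: card_2_iff insert_commute)

locale near_hamiltonian =
  fixes G :: "('v, 'e) mgraph" and v :: 'v and vs es
  assumes multi: "multigraph G" and cub: "cubic G" and vG: "v \<in> verts G"
    and ham: "hamiltonian_circuit (delete_vertex G v) vs es"
begin

abbreviation "n \<equiv> length vs"

lemma circ: "2 \<le> n" "length es = n" "distinct vs" "distinct es" "set vs = verts G - {v}" "set es \<subseteq> edges G"
    "i < n \<Longrightarrow> ends G (es ! i) = {vs ! i, vs ! (Suc i mod n)}"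
  using ham by (auto simp: hamiltonian_circuit_def circuit_def delete_vertex_def induced_subgraph_def)

lemma vs_inj: "i < n \<Longrightarrow> j < n \<Longrightarrow> vs ! i = vs ! j \<longleftrightarrow> i = j"
  using circ(3) nth_eq_iff_index_eq by blast

lemma v_notin: "v \<notin> set vs"
  using circ(5) by simp

lemma mod_n: "Suc i mod n < n" "(i + n - 1) mod n < n"
proof -
  have "0 < n" using circ(1) by linarith
  then show "Suc i mod n < n" "(i + n - 1) mod n < n" by simp_all
qed

lemma incident_circuit:
  assumes "i < n" "j < n"
  shows "vs ! i \<in> ends G (es ! j) \<longleftrightarrow> j = i \<or> j = (i + n - 1) mod n"
proof -
  have "vs ! i \<in> ends G (es ! j) \<longleftrightarrow> i = j \<or> i = Suc j mod n"
    using circ(7)[OF assms(2)] vs_inj assms mod_n by auto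
  moreover have "i = Suc j mod n \<longleftrightarrow> j = (i + n - 1) mod n"
    using Suc_pred_mod[OF assms(1)] pred_Suc_mod[OF assms(2)] by auto
  ultimately show ?thesis by auto
qed

text \<open>Two of the three edges at \<open>x\<close> are on the circuit; they are distinct edges
  even if the circuit has length 2.\<close>

lemma third_ex1:
  assumes x: "x \<in> set vs"
  shows "\<exists>!e. e \<in> edges G \<and> e \<notin> set es \<and> x \<in> ends G e"
proof -
  obtain i where i: "i < n" "x = vs ! i" using x by (auto simp: in_set_conv_nth)
  let ?p = "(i + n - 1) mod n"
  let ?R = "{e \<in> edges G. e \<notin> set es \<and> x \<in> ends G e}"
  have fin: "finite (edges G)" using multi by (simp add: multigraph_def)
  have "card {e \<in> edges G. x \<in> ends G e} = 3"
    using cub x circ(5) by (auto simp: regular_def degree_def)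
  moreover have "{e \<in> edges G. x \<in> ends G e} = {es ! i, es ! ?p} \<union> ?R"
  proof -
    have "{e \<in> set es. x \<in> ends G e} = {es ! i, es ! ?p}"
      using incident_circuit[OF i(1)] i mod_n(2)[of i] circ(2) by (auto simp: in_set_conv_nth)
    then show ?thesis using circ(6) by blast
  qed
  moreover have "{es ! i, es ! ?p} \<inter> ?R = {}" using i(1) mod_n(2)[of i] circ(2) by auto
  moreover have "card {es ! i, es ! ?p} = 2"
  proof -
    have "i \<noteq> ?p" using circ(1) i(1) unfolding pred_mod[OF i(1)] by auto
    then have "es ! i \<noteq> es ! ?p" using circ(2,4) i(1) mod_n(2)[of i] nth_eq_iff_index_eq by metis
    then show ?thesis by simp
  qed
  moreover have "finite ?R" using fin by simp
  ultimately have "card ?R = 1" using card_Un_disjoint[of "{es ! i, es ! ?p}" ?R] by simp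
  then obtain e where e: "?R = {e}" by (rule card_1_singletonE)
  then show ?thesis by (intro ex1I[of _ e]) auto
qed

definition "third x = (THE e. e \<in> edges G \<and> e \<notin> set es \<and> x \<in> ends G e)"

lemma third:
  assumes "x \<in> set vs" shows "third x \<in> edges G" "third x \<notin> set es" "x \<in> ends G (third x)"
  using theI'[OF third_ex1[OF assms]] unfolding third_def by auto

lemma third_eq: "x \<in> set vs \<Longrightarrow> e \<in> edges G \<Longrightarrow> e \<notin> set es \<Longrightarrow> x \<in> ends G e \<Longrightarrow> e = third x"
  unfolding third_def by (rule the1_equality[OF third_ex1, symmetric]) auto

lemma ends_G: "e \<in> edges G \<Longrightarrow> card (ends G e) = 2" "e \<in> edges G \<Longrightarrow> ends G e \<subseteq> insert v (set vs)"
  using multi circ(5) by (auto simp: multigraph_def)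

definition "spokes = {x \<in> set vs. v \<in> ends G (third x)}"

definition "T x = (if x \<in> spokes then x else THE y. ends G (third x) = {x, y})"

lemma third_ends:
  assumes x: "x \<in> set vs"
  shows "x \<in> spokes \<Longrightarrow> ends G (third x) = {x, v}"
    and "x \<notin> spokes \<Longrightarrow> ends G (third x) = {x, T x} \<and> T x \<in> set vs - spokes \<and> T x \<noteq> x \<and> third (T x) = third x"
proof -
  have "card (ends G (third x)) = 2" using ends_G(1) third(1)[OF x] .
  then obtain y where y: "ends G (third x) = {x, y}" "x \<noteq> y"
    using card_2_other[OF _ third(3)[OF x]] by auto
  show "x \<in> spokes \<Longrightarrow> ends G (third x) = {x, v}" using y v_notin by (auto simp: spokes_def)
  assume ns: "x \<notin> spokes"
  then have "T x = y"
    using y by (auto simp: T_def doubleton_eq_iff intro!: the_equality)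
  moreover have "y \<noteq> v" using ns x y by (auto simp: spokes_def)
  then have yv: "y \<in> set vs" using ends_G(2)[OF third(1)[OF x]] y by auto
  moreover have ty: "third y = third x" using third_eq[OF yv, of "third x"] third[OF x] y by simp
  moreover have "y \<notin> spokes" using ns x yv ty by (auto simp: spokes_def)
  ultimately show "ends G (third x) = {x, T x} \<and> T x \<in> set vs - spokes \<and> T x \<noteq> x \<and> third (T x) = third x"
    using y by simp
qed

lemma T_T: "x \<in> set vs \<Longrightarrow> T (T x) = x"
proof (cases "x \<in> spokes")
  case False
  assume x: "x \<in> set vs"
  have a: "ends G (third x) = {x, T x}" "T x \<in> set vs" "T x \<notin> spokes" "T x \<noteq> x" "third (T x) = third x"
    using third_ends(2)[OF x False] by auto
  have "ends G (third (T x)) = {T x, T (T x)}" "T (T x) \<noteq> T x" using third_ends(2)[OF a(2,3)] by auto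
  then show ?thesis using a by (auto simp: doubleton_eq_iff)
qed (simp add: T_def)

lemma T_fixed: "x \<in> set vs \<Longrightarrow> T x = x \<longleftrightarrow> x \<in> spokes" "x \<in> set vs \<Longrightarrow> T x \<in> set vs"
  using third_ends(2)[of x] by (auto simp: T_def)

lemma third_same: "x \<in> set vs \<Longrightarrow> y \<in> set vs \<Longrightarrow> third x = third y \<Longrightarrow> y = x \<or> y = T x"
  using third(3)[of y] third_ends[of x] v_notin by (cases "x \<in> spokes") auto

text \<open>Edges at \<open>v\<close> cannot be parallel, because a circuit vertex has only one edge
  off the circuit.\<close>

lemma card_spokes: "card spokes = 3"
proof -
  let ?E = "{e \<in> edges G. v \<in> ends G e}"
  have "third ` spokes = ?E"
  proof
    show "third ` spokes \<subseteq> ?E" using third by (auto simp: spokes_def)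
    show "?E \<subseteq> third ` spokes"
    proof
      fix e assume e: "e \<in> ?E"
      then obtain y where y: "ends G e = {v, y}" "v \<noteq> y"
        using card_2_other[of "ends G e" v] ends_G(1)[of e] by auto
      then have yv: "y \<in> set vs" using ends_G(2)[of e] e by auto
      have "e \<notin> set es"
      proof
        assume "e \<in> set es"
        then obtain i where i: "i < n" "e = es ! i" using circ(2) by (auto simp: in_set_conv_nth)
        then have "ends G e \<subseteq> set vs" using circ(7)[OF i(1)] mod_n(1)[of i] by auto
        then show False using e v_notin by auto
      qed
      then have "e = third y" using third_eq[OF yv] e y by auto
      then show "e \<in> third ` spokes" using yv y by (auto simp: spokes_def)
    qed
  qed
  moreover have "inj_on third spokes"
  proof (rule inj_onI)
    fix x y assume xy: "x \<in> spokes" "y \<in> spokes" "third x = third y"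
    then have "x \<in> set vs" "y \<in> set vs" "T x = x" by (auto simp: spokes_def T_def)
    then show "x = y" using third_same[of x y] xy(3) by auto
  qed
  ultimately have "card spokes = card ?E" using card_image by metis
  then show ?thesis using cub vG by (auto simp: regular_def degree_def)
qed

text \<open>\<open>T\<close> pairs all circuit vertices but the three spokes.\<close>

lemma n_odd: "odd n" "3 \<le> n"
proof -
  have "tclosed T (set vs - spokes)"
    using third_ends(2) T_T by (auto simp: tclosed_def)
  then have "even (card (set vs - spokes))" by (rule tclosed_even_card[rotated]) simp
  moreover have s: "spokes \<subseteq> set vs" by (auto simp: spokes_def)
  then have "card spokes \<le> card (set vs)" by (intro card_mono) auto
  moreover have "card (set vs) = n" using circ(3) by (rule distinct_card)
  moreover have "card (set vs - spokes) = card (set vs) - card spokes"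
    using s by (intro card_Diff_subset) (auto intro: finite_subset)
  ultimately show "odd n" "3 \<le> n" using card_spokes by auto
qed

text \<open>A chord parallel to a circuit edge causes no ambiguity: the circuit edge is encoded by
  swapping its ends, the chord by fixing them.\<close>

definition edge_set :: "('v \<Rightarrow> 'v) \<Rightarrow> 'e set" where
  "edge_set \<rho> = {es ! i | i. i < n \<and> \<rho> (vs ! i) = vs ! (Suc i mod n) \<and> \<rho> (vs ! (Suc i mod n)) = vs ! i} \<union>
     third ` {x \<in> set vs. \<rho> x = x}"

lemma edge_set_es: "i < n \<Longrightarrow> es ! i \<in> edge_set \<rho> \<longleftrightarrow> \<rho> (vs ! i) = vs ! (Suc i mod n) \<and> \<rho> (vs ! (Suc i mod n)) = vs ! i"
proof -
  assume i: "i < n"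
  have "es ! i \<notin> third ` {x \<in> set vs. \<rho> x = x}" using third(2) i circ(2) by (metis (no_types, lifting) imageE mem_Collect_eq nth_mem)
  moreover have "es ! i = es ! j \<longleftrightarrow> i = j" if "j < n" for j
    using that i circ(2,4) nth_eq_iff_index_eq by metis
  ultimately show ?thesis using i by (auto simp: edge_set_def)
qed

lemma edge_set_third:
  assumes x: "x \<in> set vs" and F: "\<And>x. x \<in> set vs \<Longrightarrow> \<rho> x = x \<Longrightarrow> \<rho> (T x) = T x"
  shows "third x \<in> edge_set \<rho> \<longleftrightarrow> \<rho> x = x"
proof
  assume "third x \<in> edge_set \<rho>"
  then have "third x \<in> third ` {x \<in> set vs. \<rho> x = x}"
    using third(2)[OF x] circ(2) by (auto simp: edge_set_def)
  then obtain y where y: "y \<in> set vs" "\<rho> y = y" "third y = third x" by auto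
  then have "x = y \<or> x = T y" using third_same x by blast
  then show "\<rho> x = x" using F y by auto
qed (use x in \<open>auto simp: edge_set_def\<close>)

text \<open>At a circuit vertex \<open>x\<close> the value of \<open>\<rho> x\<close> selects the
  next, the previous or the outer edge; the three values differ because \<open>n\<close> is at least
  3. At \<open>v\<close> the only edge is that of the fixed spoke \<open>s\<close>.\<close>

lemma perfect_matching_edge_set:
  assumes inv: "involution_on (set vs) \<rho>" and ad: "\<And>x. x \<in> set vs \<Longrightarrow> \<rho> x = x \<or> adj vs x (\<rho> x)"
    and F: "\<And>x. x \<in> set vs \<Longrightarrow> \<rho> x = x \<Longrightarrow> \<rho> (T x) = T x" and s: "{x \<in> spokes. \<rho> x = x} = {s}"
  shows "perfect_matching G (edge_set \<rho>)"
proof -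
  let ?H = "\<lparr>verts = verts G, edges = edge_set \<rho>, ends = ends G\<rparr>"
  have sub: "edge_set \<rho> \<subseteq> edges G" using circ(2,6) third(1) by (auto simp: edge_set_def)
  then have "multigraph ?H" using multi finite_subset[OF sub] by (auto simp: multigraph_def)
  then have sp: "spanning_subgraph ?H G" using sub by (auto simp: spanning_subgraph_def subgraph_def)
  have deg: "card {e \<in> edge_set \<rho>. x \<in> ends G e} = 1" if x: "x \<in> verts G" for x
  proof (cases "x = v")
    case True
    have "{e \<in> edge_set \<rho>. v \<in> ends G e} = {third s}"
    proof -
      have "v \<notin> ends G (es ! i)" if "i < n" for i
        using circ(7)[OF that] v_notin mod_n(1)[of i] nth_mem[OF that] nth_mem[OF mod_n(1)[of i]] by auto
      then have "{e \<in> edge_set \<rho>. v \<in> ends G e} = third ` {x \<in> spokes. \<rho> x = x}"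
        by (auto simp: edge_set_def spokes_def)
      then show ?thesis using s by simp
    qed
    then show ?thesis using True by simp
  next
    case False
    then have xv: "x \<in> set vs" using x circ(5) by simp
    then obtain i where i: "i < n" "x = vs ! i" by (auto simp: in_set_conv_nth)
    let ?p = "(i + n - 1) mod n"
    have sp: "Suc ?p mod n = i" using Suc_pred_mod[OF i(1)] .
    have inc: "x \<in> ends G e \<longleftrightarrow> e \<in> {es ! i, es ! ?p, third x}" if e: "e \<in> edges G" for e
    proof (cases "e \<in> set es")
      case True
      then obtain j where "j < n" "e = es ! j" using circ(2) by (auto simp: in_set_conv_nth)
      moreover have "third x \<noteq> e" using third(2)[OF xv] True by auto
      moreover have "es ! j = es ! k \<longleftrightarrow> j = k" if "j < n" "k < n" for j k
        using that circ(2,4) nth_eq_iff_index_eq by metis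
      ultimately show ?thesis using incident_circuit[OF i(1)] i mod_n(2)[of i] by auto
    next
      case ne: False
      have "e \<noteq> es ! i" "e \<noteq> es ! ?p" using ne i(1) mod_n(2)[of i] circ(2) nth_mem by metis+
      then show ?thesis using third_eq[OF xv e ne] third(3)[OF xv] by auto
    qed
    have rr: "\<rho> (\<rho> x) = x" "\<rho> x \<in> set vs" using inv xv by (auto simp: involution_on_def)
    have ei: "es ! i \<in> edge_set \<rho> \<longleftrightarrow> \<rho> x = vs ! (Suc i mod n)" using edge_set_es[OF i(1), of \<rho>] rr i by auto
    have ep: "es ! ?p \<in> edge_set \<rho> \<longleftrightarrow> \<rho> x = vs ! ?p" using edge_set_es[OF mod_n(2), of i \<rho>] sp rr i by auto
    have et: "third x \<in> edge_set \<rho> \<longleftrightarrow> \<rho> x = x" using edge_set_third[OF xv F] .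
    have neq: "i \<noteq> Suc i mod n" "i \<noteq> ?p" "Suc i mod n \<noteq> ?p"
      using n_odd(2) i(1) unfolding pred_mod[OF i(1)] Suc_mod[OF i(1)] by auto
    then have vneq: "x \<noteq> vs ! (Suc i mod n)" "x \<noteq> vs ! ?p" "vs ! (Suc i mod n) \<noteq> vs ! ?p"
      using vs_inj i(1,2) mod_n by auto
    have cases: "\<rho> x = x \<or> \<rho> x = vs ! (Suc i mod n) \<or> \<rho> x = vs ! ?p"
    proof (cases "\<rho> x = x")
      case False
      then obtain j where j: "j < n" "{x, \<rho> x} = {vs ! j, vs ! (Suc j mod n)}" using ad[OF xv] by (auto simp: adj_def)
      then consider "x = vs ! j" "\<rho> x = vs ! (Suc j mod n)" | "x = vs ! (Suc j mod n)" "\<rho> x = vs ! j"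
        by (auto simp: doubleton_eq_iff)
      then show ?thesis
      proof cases
        case 1
        then show ?thesis using vs_inj[OF i(1) j(1)] i by auto
      next
        case 2
        then have "i = Suc j mod n" using vs_inj[OF i(1) mod_n(1)[of j]] i by auto
        then show ?thesis using 2 pred_Suc_mod[OF j(1)] by simp
      qed
    qed simp
    have S: "{e \<in> edge_set \<rho>. x \<in> ends G e} = {es ! i, es ! ?p, third x} \<inter> edge_set \<rho>"
      using inc sub by blast
    have "{es ! i, es ! ?p, third x} \<inter> edge_set \<rho> =
        (if \<rho> x = x then {third x} else if \<rho> x = vs ! (Suc i mod n) then {es ! i} else {es ! ?p})"
      using cases ei ep et vneq by auto
    then show ?thesis unfolding S by simp
  qed
  then have "regular 1 ?H" by (simp add: regular_def degree_def)
  then show ?thesis using sp unfolding perfect_matching_def by (intro exI[of _ ?H]) simp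
qed

section \<open>The matchings \<open>h\<close> and \<open>g\<close> by position\<close>

text \<open>Position 0 is \<open>u\<close>. As \<open>n\<close> is odd, \<open>h\<close> can pair 1
  with 2, 3 with 4, up to \<open>n - 1\<close>; \<open>g\<close> pairs 2 with 3 and so on, leaving
  out 0 and its neighbours 1 and \<open>n - 1\<close>.\<close>

definition hpos :: "nat \<Rightarrow> nat" where
  "hpos i = (if i = 0 then 0 else if odd i then Suc i else i - 1)"

definition gpos :: "nat \<Rightarrow> nat" where
  "gpos i = (if i \<le> 1 \<or> i = n - 1 then i else if even i then Suc i else i - 1)"

definition "pos x = (THE i. i < n \<and> vs ! i = x)"

lemma pos: "i < n \<Longrightarrow> pos (vs ! i) = i"
  unfolding pos_def using vs_inj by (intro the_equality) auto

lemma hpos: "i < n \<Longrightarrow> hpos i < n" "hpos (hpos i) = i" "hpos i = i \<longleftrightarrow> i = 0"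
proof -
  have "odd i \<Longrightarrow> i < n \<Longrightarrow> Suc i < n" using n_odd(1) by (metis Suc_lessI even_Suc)
  then show "hpos i < n" if "i < n" using that by (auto simp: hpos_def)
  show "hpos (hpos i) = i" "hpos i = i \<longleftrightarrow> i = 0" by (auto simp: hpos_def)
qed

lemma gpos: "i < n \<Longrightarrow> gpos i < n" "i < n \<Longrightarrow> gpos (gpos i) = i" "gpos i = i \<longleftrightarrow> i \<le> 1 \<or> i = n - 1"
proof -
  show "gpos i < n" if "i < n" using that by (auto simp: gpos_def)
  show "gpos (gpos i) = i" if i: "i < n"
  proof (cases "i \<le> 1 \<or> i = n - 1")
    case False
    show ?thesis
    proof (cases "even i")
      case True
      have "even (n - 1)" using n_odd(1) by simp
      then have "Suc i \<noteq> n - 1" using True by (metis even_Suc)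
      then show ?thesis using False True by (auto simp: gpos_def)
    next
      case o: False
      then have "i - 1 \<noteq> 1" "i - 1 \<noteq> 0" "i - 1 \<noteq> n - 1" "even (i - 1)" using False i by (auto elim: oddE)
      then show ?thesis using False o by (auto simp: gpos_def)
    qed
  qed (simp add: gpos_def)
  show "gpos i = i \<longleftrightarrow> i \<le> 1 \<or> i = n - 1" by (auto simp: gpos_def)
qed

definition "h x = vs ! hpos (pos x)"
definition "g x = vs ! gpos (pos x)"

lemma h_g_nth: "i < n \<Longrightarrow> h (vs ! i) = vs ! hpos i" "i < n \<Longrightarrow> g (vs ! i) = vs ! gpos i"
  by (simp_all add: h_def g_def pos)

lemma arcs:
  assumes s: "spokes = {vs ! 0, b, c}" shows "arcs (set vs) (vs ! 0) b c (vs ! Suc 0) (vs ! (n - Suc 0)) h g T"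
proof
  have n3: "0 < n" "1 < n" "n - 1 < n" using n_odd(2) by auto
  show "finite (set vs)" by simp
  show "{vs ! 0, b, c, vs ! Suc 0, vs ! (n - Suc 0)} \<subseteq> set vs" using s n3 nth_mem[of _ vs] by (auto simp: spokes_def)
  show "distinct [vs ! 0, b, c]" using card_spokes unfolding s by (auto simp: card_insert_if split: if_splits)
  show "distinct [vs ! 0, vs ! Suc 0, vs ! (n - Suc 0)]" using vs_inj n3 n_odd(2) by auto
  have "h x \<in> set vs \<and> h (h x) = x \<and> g x \<in> set vs \<and> g (g x) = x" if x: "x \<in> set vs" for x
  proof -
    obtain i where i: "i < n" "x = vs ! i" using x by (auto simp: in_set_conv_nth)
    then show ?thesis using hpos(1,2)[of i] gpos(1,2)[of i] by (simp add: h_g_nth)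
  qed
  then show "involution_on (set vs) h" "involution_on (set vs) g" by (simp_all add: involution_on_def)
  show "involution_on (set vs) T" using T_T T_fixed by (auto simp: involution_on_def)
  fix x assume x: "x \<in> set vs"
  then obtain i where i: "i < n" "x = vs ! i" by (auto simp: in_set_conv_nth)
  show "h x = x \<longleftrightarrow> x = vs ! 0"
    using i n3 vs_inj[of "hpos i" i] vs_inj[of i 0] hpos by (simp add: h_g_nth)
  show "g x = x \<longleftrightarrow> x \<in> {vs ! 0, vs ! Suc 0, vs ! (n - Suc 0)}"
    using i n3 vs_inj[of "gpos i" i] vs_inj[of i 0] vs_inj[of i 1] vs_inj[of i "n - 1"] gpos[of i] by (auto simp: h_g_nth)
  show "T x = x \<longleftrightarrow> x \<in> {vs ! 0, b, c}" using T_fixed(1)[OF x] s by simp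
next
  fix C assume C: "C \<subseteq> set vs" "vs ! Suc 0 \<in> C" "\<And>x. x \<in> C \<Longrightarrow> h x \<in> C \<and> g x \<in> C"
  \<comment> \<open>From position 1 on, \<open>h\<close> and \<open>g\<close> lead alternately to
    the next position.\<close>
  have "vs ! Suc i \<in> C" if "Suc i < n" for i
    using that
  proof (induction i)
    case (Suc i)
    then have "vs ! Suc i \<in> C" "Suc i < n" by auto
    then have "vs ! hpos (Suc i) \<in> C" "vs ! gpos (Suc i) \<in> C" using C(3) h_g_nth by metis+
    then show ?case using Suc.prems by (cases "even i") (auto simp: hpos_def gpos_def split: if_splits)
  qed (use C(2) in simp)
  then show "set vs - {vs ! 0} \<subseteq> C"
    by (auto simp: in_set_conv_nth) (metis not0_implies_Suc)
qed

lemma adj_h_g: "i < n \<Longrightarrow> vs ! hpos i = vs ! i \<or> adj vs (vs ! i) (vs ! hpos i)"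
    "i < n \<Longrightarrow> vs ! gpos i = vs ! i \<or> adj vs (vs ! i) (vs ! gpos i)"
proof -
  have up: "adj vs (vs ! j) (vs ! Suc j)" "adj vs (vs ! Suc j) (vs ! j)" if "Suc j < n" for j
    unfolding adj_def using that by (auto intro!: exI[of _ j])
  assume i: "i < n"
  then have "hpos i < n" "gpos i < n" using hpos gpos by auto
  then show "vs ! hpos i = vs ! i \<or> adj vs (vs ! i) (vs ! hpos i)" "vs ! gpos i = vs ! i \<or> adj vs (vs ! i) (vs ! gpos i)"
    using up[of i] up[of "i - 1"] i by (auto simp: hpos_def gpos_def split: if_splits)
qed

lemma cover_exists:
  assumes s: "vs ! 0 \<in> spokes"
  shows "\<exists>\<M>. perfect_matching_cover G \<M> \<and> size \<M> = 5"
proof -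
  obtain x y z where xyz: "spokes = {x, y, z}" "x \<noteq> y" "y \<noteq> z" "x \<noteq> z"
    using card_spokes by (auto simp: card_3_iff)
  then have "\<exists>b c. spokes = {vs ! 0, b, c}" using s by auto
  then obtain b c where sp: "spokes = {vs ! 0, b, c}" by blast
  interpret arcs "set vs" "vs ! 0" b c "vs ! Suc 0" "vs ! (n - Suc 0)" h g T by (rule arcs[OF sp])
  obtain Ms where Ms: "length Ms = 5" "pm_cover Ms" using pm_cover_exists by blast
  have n3: "0 < n" "1 < n" "n - 1 < n" "n \<noteq> 1" using n_odd(2) by auto
  have ends: "adj vs (vs ! 0) (vs ! Suc 0)" "adj vs (vs ! 0) (vs ! (n - Suc 0))"
    unfolding adj_def using n3 by (auto intro: exI[of _ 0] exI[of _ "n - 1"])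
  have PM: "perfect_matching G (edge_set \<rho>)" if "\<rho> \<in> set Ms" for \<rho>
  proof -
    have pm: "pm \<rho>" using that Ms(2) by (simp add: pm_cover_def)
    then obtain s where s: "{x \<in> {vs ! 0, b, c}. \<rho> x = x} = {s}" by (auto simp: pm_def)
    show ?thesis
    proof (rule perfect_matching_edge_set)
      show "involution_on (set vs) \<rho>" using pm by (simp add: pm_def)
      show "\<rho> x = x \<or> adj vs x (\<rho> x)" if x: "x \<in> set vs" for x
      proof -
        obtain i where i: "i < n" "x = vs ! i" using x by (auto simp: in_set_conv_nth)
        have "\<rho> x = x \<or> \<rho> x = h x \<or> \<rho> x = g x \<or> {x, \<rho> x} = {vs ! 0, vs ! Suc 0} \<or> {x, \<rho> x} = {vs ! 0, vs ! (n - Suc 0)}"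
          using pm x by (simp add: pm_def)
        then show ?thesis
          using adj_h_g[OF i(1)] h_g_nth[OF i(1)] i ends adj_sym[OF ends(1)] adj_sym[OF ends(2)]
          by (auto simp: doubleton_eq_iff)
      qed
      show "\<rho> (T x) = T x" if "x \<in> set vs" "\<rho> x = x" for x using pm that by (simp add: pm_def)
      show "{x \<in> spokes. \<rho> x = x} = {s}" using s sp by simp
    qed
  qed
  have inv: "\<rho> x = y \<Longrightarrow> \<rho> y = x" if "\<rho> \<in> set Ms" "x \<in> set vs" for \<rho> x y
    using Ms(2) that by (auto simp: pm_cover_def pm_def involution_on_def)
  have cov: "\<exists>\<rho>\<in>set Ms. e \<in> edge_set \<rho>" if e: "e \<in> edges G" for e
  proof (cases "e \<in> set es")
    case True
    then obtain i where i: "i < n" "e = es ! i" using circ(2) by (auto simp: in_set_conv_nth)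
    have iv: "vs ! i \<in> set vs" using i by simp
    have "\<exists>\<rho>\<in>set Ms. \<rho> (vs ! i) = vs ! (Suc i mod n)"
    proof -
      \<comment> \<open>The first two cases are the circuit edges at \<open>u\<close>. Otherwise an
        odd position starts an edge of \<open>h\<close> and an even one an edge of
        \<open>g\<close>.\<close>
      consider "i = 0" | "i = n - 1" | "odd i" "i \<noteq> n - 1" | "even i" "i \<noteq> 0" "i \<noteq> n - 1" by blast
      then show ?thesis
      proof cases
        case 1
        then show ?thesis using Ms(2) n3 by (simp add: pm_cover_def)
      next
        case 2
        then have "Suc i mod n = 0" using n3 by simp
        moreover obtain \<rho> where "\<rho> \<in> set Ms" "\<rho> (vs ! 0) = vs ! (n - Suc 0)" using Ms(2) by (auto simp: pm_cover_def)
        ultimately show ?thesis using inv[of \<rho> "vs ! 0"] 2 n3 by auto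
      next
        case 3
        then have "h (vs ! i) = vs ! (Suc i mod n)" using i by (auto simp: h_g_nth hpos_def)
        moreover have "vs ! i \<noteq> vs ! 0" using vs_inj[OF i(1) n3(1)] 3 by auto
        ultimately show ?thesis using Ms(2) iv unfolding pm_cover_def by (metis Diff_iff singletonD)
      next
        case 4
        then have i1: "i \<noteq> 1" by auto
        then have "g (vs ! i) = vs ! (Suc i mod n)" using i 4 by (auto simp: h_g_nth gpos_def)
        moreover have "vs ! i \<notin> {vs ! 0, vs ! Suc 0, vs ! (n - Suc 0)}"
          using vs_inj[OF i(1) n3(1)] vs_inj[OF i(1) n3(2)] vs_inj[OF i(1) n3(3)] 4 i1 by auto
        ultimately show ?thesis using Ms(2) iv unfolding pm_cover_def by (metis DiffI)
      qed
    qed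
    then show ?thesis using edge_set_es[OF i(1)] inv iv i(2) by metis
  next
    case False
    have "card (ends G e) = 2" by (rule ends_G(1)[OF e])
    then obtain x y where xy: "ends G e = {x, y}" "x \<noteq> y" by (auto simp: card_2_iff)
    then have "x \<in> set vs \<or> y \<in> set vs" using ends_G(2)[OF e] by auto
    then obtain z where z: "z \<in> ends G e" "z \<in> set vs" using xy(1) by auto
    have "e = third z" using third_eq[OF z(2) e False z(1)] .
    moreover obtain \<rho> where "\<rho> \<in> set Ms" "\<rho> z = z" using Ms(2) z(2) by (auto simp: pm_cover_def)
    ultimately show ?thesis using z(2) by (auto simp: edge_set_def)
  qed
  let ?\<M> = "mset (map edge_set Ms)"
  have "perfect_matching_cover G ?\<M>" using PM cov by (auto simp: perfect_matching_cover_def)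
  then show ?thesis using Ms(1) by (intro exI[of _ ?\<M>]) simp
qed

end

theorem theorem3p2:
  fixes G :: "('v, 'e) mgraph" and v :: 'v
  assumes "multigraph G"
    and "cubic G"
    and "v \<in> verts G"
    and "\<exists>vs es. hamiltonian_circuit (delete_vertex G v) vs es"
  shows "\<exists>\<M>. perfect_matching_cover G \<M> \<and> size \<M> = 5"
proof -
  obtain vs es where ham: "hamiltonian_circuit (delete_vertex G v) vs es" using assms(4) by blast
  interpret near_hamiltonian G v vs es by unfold_locales (fact assms ham)+
  have "spokes \<noteq> {}" using card_spokes by auto
  then obtain k where k: "k < length vs" "vs ! k \<in> spokes" by (auto simp: spokes_def in_set_conv_nth)
  \<comment> \<open>The position-based matchings need a neighbour of \<open>v\<close> at position
    0.\<close>
  let ?vs = "rotate k vs" and ?es = "rotate k es"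
  have "hamiltonian_circuit (delete_vertex G v) ?vs ?es"
    using ham circuit_rotate by (auto simp: hamiltonian_circuit_def)
  then interpret rot: near_hamiltonian G v ?vs ?es by unfold_locales (use assms in auto)
  \<comment> \<open>The outer edges depend on the circuit only through its edge set, so the rotation
    does not change the spokes.\<close>
  have "rot.third = third" unfolding rot.third_def third_def by simp
  then have "rot.spokes = spokes" by (simp add: rot.spokes_def spokes_def)
  moreover have "0 < length vs" using k(1) by linarith
  then have "?vs ! 0 = vs ! k" using k(1) by (simp add: nth_rotate)
  ultimately show ?thesis using rot.cover_exists k(2) by simp
qed


end
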